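(* Let $\mathcal{T}$ be a top on an oriented Riemannian $3$-manifold $(M,g)$, with associated plane bundles $\xi_\theta$, $\theta\in\mathbb{P}^1(\mathbb{R})$. Then all the plane bundles $\xi_\theta$ are of the same nature: either $\xi_\theta$ is integrable for every $\theta$, or $\xi_\theta$ is a contact structure for every $\theta$.
   Context: All objects are smooth. Rotation speed: on an oriented Riemannian $3$-manifold $(M,g)$ with Levi-Civita connection $\nabla$ and cross product $\times$, for unit vector fields $Y,Z$ (defined at least along the curve) and a curve $\gamma$, the rotation speed of $Y$ about $Z$ along $\gamma$ is $R_\gamma(Y,Z)=g(\nabla_{\dot\gamma}Y, Z\times Y)$. Indexed pencil bundle: given two 1-forms $\omega_1,\omega_2$ on $M$ that are linearly independent at every point, put $\omega^\theta=\cos\theta\,\omega_1+\sin\theta\,\omega_2$. The family of plane bundles $\xi_\theta=\ker\omega^\theta$, indexed by $\theta \bmod \pi\in\mathbb{P}^1(\mathbb{R})$, is the indexed pencil bundle defined by the circle of 1-forms $\{\omega^\theta\}$; its axis bundle is the line bundle $\bigcap_\theta\xi_\theta$. A moving frame $(X_1,X_2,X_3)$ is adapted to the pencil bundle if $X_3$ is parallel to the axis bundle and there are forms $\eta_1,\eta_2$ in the defining circle with $\eta_1(X_2)=\eta_2(X_1)=0$ everywhere. Top: an indexed pencil bundle is a top if there is a (global) orthonormal moving frame $(X_1,X_2,X_3)$ adapted to it such that (all geodesics being parameterized by arc length): (i) along any geodesic $\gamma$, the angle between $\dot\gamma$ and $X_3$ is constant; (ii) along any geodesic $\gamma$ transverse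 to the axis bundle, $R_\gamma(X_3,\dot\gamma)$ is constant; (iii) along any geodesic $\gamma$, $R_\gamma(X_1,X_3)$ is constant; (iv) for any pair of geodesics $\gamma_1,\gamma_2$ making equal angles with $X_3$, the rotation speed of $X_1$ about $X_3$ is the same along $\gamma_1$ and $\gamma_2$. A top is completely determined by such a frame: the underlying indexed pencil bundle is the one defined by the 1-forms $\omega_1,\omega_2$ of the dual coframe $(\omega_1,\omega_2,\omega_3)$.
   Formalization: The manifold M is assumed connected; without this the claim fails, e.g. for a disjoint union of a Nil component (all plane bundles integrable) and a flat component with rotating frame (all contact) with the same rotation speed of X_1 about X_3. *)

theory Defs
  imports "HOL-Analysis.Analysis"
begin

section \<open>Smooth maps\<close>

text \<open>On an open set \<open>S\<close> of a finite-dimensional space, \<open>smooth_on S f\<close> says that all iterated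
  directional derivatives of \<open>f\<close> exist and are continuous, i.e. that \<open>f\<close> is of class \<open>C\<close>-infinity.\<close>

fun higher_differentiable_on ::
  "'a::real_normed_vector set \<Rightarrow> ('a \<Rightarrow> 'b::real_normed_vector) \<Rightarrow> nat \<Rightarrow> bool" where
  "higher_differentiable_on S f 0 \<longleftrightarrow> continuous_on S f"
| "higher_differentiable_on S f (Suc n) \<longleftrightarrow>
     (\<forall>x\<in>S. f differentiable (at x)) \<and>
     (\<forall>v. higher_differentiable_on S (\<lambda>x. frechet_derivative f (at x) v) n)"

definition smooth_on :: "'a::real_normed_vector set \<Rightarrow> ('a \<Rightarrow> 'b::real_normed_vector) \<Rightarrow> bool" where
  "smooth_on S f \<longleftrightarrow> (\<forall>n. higher_differentiable_on S f n)"


section \<open>Oriented 3-manifolds and tensor fields\<close>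

text \<open>The manifold \<open>M\<close> is the whole type \<open>'m\<close>, with a (not necessarily maximal) atlas of positively
  oriented charts. A chart is a pair \<open>(U, \<phi>)\<close>.\<close>

type_synonym 'm chart = "'m set \<times> ('m \<Rightarrow> real^3)"

abbreviation cdom :: "'m chart \<Rightarrow> 'm set" where "cdom c \<equiv> fst c"
abbreviation coord :: "'m chart \<Rightarrow> 'm \<Rightarrow> real^3" where "coord c \<equiv> snd c"
abbreviation cimg :: "'m chart \<Rightarrow> (real^3) set" where "cimg c \<equiv> coord c ` cdom c"

definition is_chart :: "('m::topological_space) chart \<Rightarrow> bool" where
  "is_chart c \<longleftrightarrow> open (cdom c) \<and> open (cimg c) \<and>
     homeomorphism (cdom c) (cimg c) (coord c) (inv_into (cdom c) (coord c))"

definition overlap :: "'m chart \<Rightarrow> 'm chart \<Rightarrow> (real^3) set" where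
  "overlap c d = coord c ` (cdom c \<inter> cdom d)"

definition transition :: "'m chart \<Rightarrow> 'm chart \<Rightarrow> real^3 \<Rightarrow> real^3" where
  "transition c d = coord d \<circ> inv_into (cdom c) (coord c)"

definition jacobian :: "'m chart \<Rightarrow> 'm chart \<Rightarrow> real^3 \<Rightarrow> real^3^3" where
  "jacobian c d x = matrix (frechet_derivative (transition c d) (at x))"

definition oriented_atlas :: "('m::topological_space) chart set \<Rightarrow> bool" where
  "oriented_atlas A \<longleftrightarrow> (\<forall>c\<in>A. is_chart c) \<and> (\<Union>c\<in>A. cdom c) = UNIV \<and>
     (\<forall>c\<in>A. \<forall>d\<in>A. smooth_on (overlap c d) (transition c d) \<and>
        (\<forall>x\<in>overlap c d. det (jacobian c d x) > 0))"

text \<open>A tensor field is given by its components in every chart, as functions of the coordinates,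
  subject to the usual transformation law. Only the values at \<open>c \<in> A\<close>, \<open>x \<in> cimg c\<close> matter.
  The value of a 1-form \<open>\<omega>\<close> on a vector \<open>v\<close> is \<open>\<omega> c x \<bullet> v\<close>, and the inner product of two
  vectors is \<open>u \<bullet> (G c x *v v)\<close>.\<close>

type_synonym 'm vfield = "'m chart \<Rightarrow> real^3 \<Rightarrow> real^3"
type_synonym 'm form1 = "'m chart \<Rightarrow> real^3 \<Rightarrow> real^3"
type_synonym 'm metric_tensor = "'m chart \<Rightarrow> real^3 \<Rightarrow> real^3^3"

definition vector_field :: "'m chart set \<Rightarrow> 'm vfield \<Rightarrow> bool" where
  "vector_field A X \<longleftrightarrow> (\<forall>c\<in>A. smooth_on (cimg c) (X c)) \<and>
     (\<forall>c\<in>A. \<forall>d\<in>A. \<forall>x\<in>overlap c d. X d (transition c d x) = jacobian c d x *v X c x)"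

definition one_form :: "'m chart set \<Rightarrow> 'm form1 \<Rightarrow> bool" where
  "one_form A \<omega> \<longleftrightarrow> (\<forall>c\<in>A. smooth_on (cimg c) (\<omega> c)) \<and>
     (\<forall>c\<in>A. \<forall>d\<in>A. \<forall>x\<in>overlap c d.
        \<omega> c x = transpose (jacobian c d x) *v \<omega> d (transition c d x))"

definition riemannian_metric :: "'m chart set \<Rightarrow> 'm metric_tensor \<Rightarrow> bool" where
  "riemannian_metric A G \<longleftrightarrow>
     (\<forall>c\<in>A. smooth_on (cimg c) (G c) \<and>
        (\<forall>x\<in>cimg c. transpose (G c x) = G c x \<and> (\<forall>v. v \<noteq> 0 \<longrightarrow> v \<bullet> (G c x *v v) > 0))) \<and>
     (\<forall>c\<in>A. \<forall>d\<in>A. \<forall>x\<in>overlap c d.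
        G c x = transpose (jacobian c d x) ** G d (transition c d x) ** jacobian c d x)"

text \<open>Manifolds are Hausdorff, second countable and connected.\<close>

definition oriented_riemannian_3manifold ::
  "('m::{t2_space, second_countable_topology}) chart set \<Rightarrow> 'm metric_tensor \<Rightarrow> bool" where
  "oriented_riemannian_3manifold A G \<longleftrightarrow>
     connected (UNIV :: 'm set) \<and> oriented_atlas A \<and> riemannian_metric A G"


section \<open>Riemannian geometry in a chart\<close>

definition riem_inner :: "real^3^3 \<Rightarrow> real^3 \<Rightarrow> real^3 \<Rightarrow> real" where
  "riem_inner g u v = u \<bullet> (g *v v)"

definition riem_angle :: "real^3^3 \<Rightarrow> real^3 \<Rightarrow> real^3 \<Rightarrow> real" where
  "riem_angle g u v = arccos (riem_inner g u v / (sqrt (riem_inner g u u) * sqrt (riem_inner g v v)))"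

text \<open>The cross product \<open>u \<times> v\<close> is the vector dual to \<open>vol(u, v, _)\<close>, where \<open>vol\<close> is the Riemannian
  volume form, equal to \<open>sqrt (det g)\<close> times the determinant in positively oriented coordinates.\<close>

definition riem_cross :: "real^3^3 \<Rightarrow> real^3 \<Rightarrow> real^3 \<Rightarrow> real^3" where
  "riem_cross g u v = sqrt (det g) *\<^sub>R (matrix_inv g *v cross3 u v)"

lemma matrix_mul_matrix_inv:
  fixes g :: "real^3^3"
  assumes "invertible g"
  shows "g ** matrix_inv g = mat 1"
  using someI_ex[OF assms[unfolded invertible_def]] unfolding matrix_inv_def by blast

lemma riem_inner_cross:
  assumes "invertible g"
  shows "riem_inner g w (riem_cross g u v) = sqrt (det g) * det (vector [w, u, v])"
proof -
  have "g *v (matrix_inv g *v cross3 u v) = cross3 u v"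
    using matrix_mul_matrix_inv[OF assms] by (simp add: matrix_vector_mul_assoc)
  then show ?thesis
    unfolding riem_inner_def riem_cross_def
    by (simp only: matrix_vector_mult_scaleR inner_scaleR_right dot_cross_det)
qed

text \<open>Christoffel symbols of the Levi-Civita connection, contracted with \<open>u\<close> and \<open>v\<close>. Writing
  \<open>D\<close> for the derivative of the components of the metric, the covector in the last factor has
  \<open>l\<close>-th component \<open>(1/2) \<Sum>i j. (D\<^sub>i g\<^sub>j\<^sub>l + D\<^sub>j g\<^sub>i\<^sub>l - D\<^sub>l g\<^sub>i\<^sub>j) u\<^sub>i v\<^sub>j\<close>. The two lemmas below say that
  the connection is torsion free and metric.\<close>

definition christoffel :: "(real^3 \<Rightarrow> real^3^3) \<Rightarrow> real^3 \<Rightarrow> real^3 \<Rightarrow> real^3 \<Rightarrow> real^3" where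
  "christoffel g x u v = matrix_inv (g x) *v ((1/2) *\<^sub>R
     (frechet_derivative g (at x) u *v v + frechet_derivative g (at x) v *v u
      - (\<chi> l. u \<bullet> (frechet_derivative g (at x) (axis l 1) *v v))))"

lemma frechet_derivative_symmetric_matrix:
  fixes g :: "real^3 \<Rightarrow> real^3^3"
  assumes "open U" "x \<in> U" "\<And>y. y \<in> U \<Longrightarrow> transpose (g y) = g y" "g differentiable (at x)"
  shows "transpose (frechet_derivative g (at x) u) = frechet_derivative g (at x) u"
proof -
  let ?D = "frechet_derivative g (at x)"
  have D: "(g has_derivative ?D) (at x)"
    using assms(4) frechet_derivative_works by blast
  have lin: "bounded_linear (transpose :: real^3^3 \<Rightarrow> real^3^3)"
    by (intro linear_conv_bounded_linear[THEN iffD1] linearI) (simp_all add: transpose_def vec_eq_iff)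
  have "((\<lambda>y. transpose (g y)) has_derivative (\<lambda>u. transpose (?D u))) (at x)"
    using bounded_linear.has_derivative[OF lin D] .
  then have "(g has_derivative (\<lambda>u. transpose (?D u))) (at x)"
    using has_derivative_transform_within_open[OF _ assms(1,2)] assms(3) by blast
  then show ?thesis
    using D has_derivative_unique by metis
qed

lemma christoffel_symmetric:
  assumes "open U" "x \<in> U" "\<And>y. y \<in> U \<Longrightarrow> transpose (g y) = g y" "g differentiable (at x)"
  shows "christoffel g x u v = christoffel g x v u"
proof -
  have "u \<bullet> (frechet_derivative g (at x) w *v v) = v \<bullet> (frechet_derivative g (at x) w *v u)" for w
    using frechet_derivative_symmetric_matrix[OF assms, of w]
    by (metis dot_lmul_matrix inner_commute transpose_matrix_vector)
  then show ?thesis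
    unfolding christoffel_def by (simp add: add.commute)
qed

lemma christoffel_metric:
  assumes "open U" "x \<in> U" "\<And>y. y \<in> U \<Longrightarrow> transpose (g y) = g y" "g differentiable (at x)"
    and inv: "invertible (g x)"
  shows "v \<bullet> (frechet_derivative g (at x) u *v w) =
     riem_inner (g x) (christoffel g x u v) w + riem_inner (g x) v (christoffel g x u w)"
proof -
  let ?D = "frechet_derivative g (at x)"
  have lin: "linear ?D"
    using assms(4) linear_frechet_derivative by blast
  have sym: "a \<bullet> (?D c *v b) = b \<bullet> (?D c *v a)" for a b c
    using frechet_derivative_symmetric_matrix[OF assms(1-4), of c]
    by (metis dot_lmul_matrix inner_commute transpose_matrix_vector)
  have symg: "riem_inner (g x) a b = riem_inner (g x) b a" for a b
    unfolding riem_inner_def using assms(3)[OF assms(2)]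
    by (metis dot_lmul_matrix inner_commute transpose_matrix_vector)
  have grad: "b \<bullet> (\<chi> l. a \<bullet> (?D (axis l 1) *v c)) = a \<bullet> (?D b *v c)" for a b c
  proof -
    have linh: "linear (\<lambda>b. a \<bullet> (?D b *v c))"
      by (intro linearI)
        (simp_all add: linear_add[OF lin] linear_scale[OF lin] matrix_vector_mult_add_rdistrib
          inner_add_right scaleR_matrix_vector_assoc[symmetric])
    have "a \<bullet> (?D b *v c) = (\<lambda>b. a \<bullet> (?D b *v c)) (\<Sum>l\<in>UNIV. b $ l *\<^sub>R axis l 1)"
      using basis_expansion[of b] by (simp add: scalar_mult_eq_scaleR)
    also have "\<dots> = (\<Sum>l\<in>UNIV. b $ l * (a \<bullet> (?D (axis l 1) *v c)))"
      by (simp only: linear_sum[OF linh] linear_scale[OF linh] real_scaleR_def)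
    finally show ?thesis
      by (simp add: inner_vec_def)
  qed
  have key: "riem_inner (g x) b (christoffel g x a c) =
     (b \<bullet> (?D a *v c) + b \<bullet> (?D c *v a) - a \<bullet> (?D b *v c)) / 2" for a b c
  proof -
    have "g x *v (matrix_inv (g x) *v z) = z" for z
      using matrix_mul_matrix_inv[OF inv] by (simp add: matrix_vector_mul_assoc)
    then show ?thesis
      unfolding riem_inner_def christoffel_def
      by (simp only: inner_scaleR_right inner_add_right inner_diff_right grad)
  qed
  show ?thesis
    unfolding symg[of "christoffel g x u v" w] key
    using sym[of v u w] sym[of v w u] sym[of w v u] by argo
qed

section \<open>Geodesics and rotation speed\<close>

text \<open>Vector fields along a curve are given by their components in every chart, as functions of the
  parameter.\<close>

definition velocity :: "(real \<Rightarrow> 'm) \<Rightarrow> 'm chart \<Rightarrow> real \<Rightarrow> real^3" where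
  "velocity \<gamma> c t = vector_derivative (\<lambda>s. coord c (\<gamma> s)) (at t)"

definition along :: "(real \<Rightarrow> 'm) \<Rightarrow> 'm vfield \<Rightarrow> 'm chart \<Rightarrow> real \<Rightarrow> real^3" where
  "along \<gamma> X c t = X c (coord c (\<gamma> t))"

definition cov_deriv ::
  "'m metric_tensor \<Rightarrow> (real \<Rightarrow> 'm) \<Rightarrow> ('m chart \<Rightarrow> real \<Rightarrow> real^3) \<Rightarrow> 'm chart \<Rightarrow> real \<Rightarrow> real^3" where
  "cov_deriv G \<gamma> Y c t = vector_derivative (Y c) (at t) +
     christoffel (G c) (coord c (\<gamma> t)) (velocity \<gamma> c t) (Y c t)"

definition geodesic ::
  "('m::topological_space) chart set \<Rightarrow> 'm metric_tensor \<Rightarrow> real set \<Rightarrow> (real \<Rightarrow> 'm) \<Rightarrow> bool" where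
  "geodesic A G I \<gamma> \<longleftrightarrow> open I \<and> is_interval I \<and> I \<noteq> {} \<and> continuous_on I \<gamma> \<and>
     (\<forall>c\<in>A. smooth_on {t\<in>I. \<gamma> t \<in> cdom c} (\<lambda>t. coord c (\<gamma> t)) \<and>
        (\<forall>t\<in>I. \<gamma> t \<in> cdom c \<longrightarrow>
           riem_inner (G c (coord c (\<gamma> t))) (velocity \<gamma> c t) (velocity \<gamma> c t) = 1 \<and>
           cov_deriv G \<gamma> (velocity \<gamma>) c t = 0))"

text \<open>The quantities below do not depend on the chart \<open>c\<close> around \<open>\<gamma> t\<close> in which they are computed.\<close>

definition rotation_speed ::
  "'m metric_tensor \<Rightarrow> (real \<Rightarrow> 'm) \<Rightarrow> ('m chart \<Rightarrow> real \<Rightarrow> real^3) \<Rightarrow> ('m chart \<Rightarrow> real \<Rightarrow> real^3) \<Rightarrow>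
     'm chart \<Rightarrow> real \<Rightarrow> real" where
  "rotation_speed G \<gamma> Y Z c t =
     riem_inner (G c (coord c (\<gamma> t))) (cov_deriv G \<gamma> Y c t)
       (riem_cross (G c (coord c (\<gamma> t))) (Z c t) (Y c t))"

definition angle_with ::
  "'m metric_tensor \<Rightarrow> (real \<Rightarrow> 'm) \<Rightarrow> 'm vfield \<Rightarrow> 'm chart \<Rightarrow> real \<Rightarrow> real" where
  "angle_with G \<gamma> X c t =
     riem_angle (G c (coord c (\<gamma> t))) (velocity \<gamma> c t) (along \<gamma> X c t)"

definition has_constant_value ::
  "'m chart set \<Rightarrow> real set \<Rightarrow> (real \<Rightarrow> 'm) \<Rightarrow> ('m chart \<Rightarrow> real \<Rightarrow> real) \<Rightarrow> real \<Rightarrow> bool" where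
  "has_constant_value A I \<gamma> F k \<longleftrightarrow> (\<forall>t\<in>I. \<forall>c\<in>A. \<gamma> t \<in> cdom c \<longrightarrow> F c t = k)"


section \<open>Plane bundles and pencils\<close>

type_synonym 'm plane_bundle = "'m chart \<Rightarrow> real^3 \<Rightarrow> (real^3) set"

definition kernel :: "'m form1 \<Rightarrow> 'm plane_bundle" where
  "kernel \<omega> c x = {v. \<omega> c x \<bullet> v = 0}"

definition pencil_form :: "'m form1 \<Rightarrow> 'm form1 \<Rightarrow> real \<Rightarrow> 'm form1" where
  "pencil_form \<omega>1 \<omega>2 \<theta> c x = cos \<theta> *\<^sub>R \<omega>1 c x + sin \<theta> *\<^sub>R \<omega>2 c x"

text \<open>The index \<open>\<theta>\<close> modulo \<open>\<pi>\<close> is represented by a real number; the bundle \<open>\<xi> \<theta>\<close> is then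
  automatically \<open>\<pi>\<close>-periodic in \<open>\<theta>\<close>.\<close>

definition indexed_pencil ::
  "'m chart set \<Rightarrow> 'm form1 \<Rightarrow> 'm form1 \<Rightarrow> (real \<Rightarrow> 'm plane_bundle) \<Rightarrow> bool" where
  "indexed_pencil A \<omega>1 \<omega>2 \<xi> \<longleftrightarrow> one_form A \<omega>1 \<and> one_form A \<omega>2 \<and>
     (\<forall>c\<in>A. \<forall>x\<in>cimg c.
        (\<forall>a b. a *\<^sub>R \<omega>1 c x + b *\<^sub>R \<omega>2 c x = 0 \<longrightarrow> a = 0 \<and> b = 0) \<and>
        (\<forall>\<theta>. \<xi> \<theta> c x = kernel (pencil_form \<omega>1 \<omega>2 \<theta>) c x))"

definition axis_bundle :: "(real \<Rightarrow> 'm plane_bundle) \<Rightarrow> 'm plane_bundle" where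
  "axis_bundle \<xi> c x = (\<Inter>\<theta>. \<xi> \<theta> c x)"

definition adapted_frame ::
  "'m chart set \<Rightarrow> 'm form1 \<Rightarrow> 'm form1 \<Rightarrow> (real \<Rightarrow> 'm plane_bundle) \<Rightarrow>
     'm vfield \<Rightarrow> 'm vfield \<Rightarrow> 'm vfield \<Rightarrow> bool" where
  "adapted_frame A \<omega>1 \<omega>2 \<xi> X1 X2 X3 \<longleftrightarrow>
     (\<forall>c\<in>A. \<forall>x\<in>cimg c. X3 c x \<in> axis_bundle \<xi> c x) \<and>
     (\<exists>\<theta>1 \<theta>2. \<forall>c\<in>A. \<forall>x\<in>cimg c.
        pencil_form \<omega>1 \<omega>2 \<theta>1 c x \<bullet> X2 c x = 0 \<and> pencil_form \<omega>1 \<omega>2 \<theta>2 c x \<bullet> X1 c x = 0)"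

definition orthonormal_frame ::
  "'m chart set \<Rightarrow> 'm metric_tensor \<Rightarrow> 'm vfield \<Rightarrow> 'm vfield \<Rightarrow> 'm vfield \<Rightarrow> bool" where
  "orthonormal_frame A G X1 X2 X3 \<longleftrightarrow> vector_field A X1 \<and> vector_field A X2 \<and> vector_field A X3 \<and>
     (\<forall>c\<in>A. \<forall>x\<in>cimg c.
        riem_inner (G c x) (X1 c x) (X1 c x) = 1 \<and> riem_inner (G c x) (X1 c x) (X2 c x) = 0 \<and>
        riem_inner (G c x) (X2 c x) (X2 c x) = 1 \<and> riem_inner (G c x) (X1 c x) (X3 c x) = 0 \<and>
        riem_inner (G c x) (X3 c x) (X3 c x) = 1 \<and> riem_inner (G c x) (X2 c x) (X3 c x) = 0)"

definition dual_coframe ::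
  "'m chart set \<Rightarrow> 'm vfield \<Rightarrow> 'm vfield \<Rightarrow> 'm vfield \<Rightarrow> 'm form1 \<Rightarrow> 'm form1 \<Rightarrow> 'm form1 \<Rightarrow> bool" where
  "dual_coframe A X1 X2 X3 \<omega>1 \<omega>2 \<omega>3 \<longleftrightarrow> one_form A \<omega>1 \<and> one_form A \<omega>2 \<and> one_form A \<omega>3 \<and>
     (\<forall>c\<in>A. \<forall>x\<in>cimg c.
        \<omega>1 c x \<bullet> X1 c x = 1 \<and> \<omega>1 c x \<bullet> X2 c x = 0 \<and> \<omega>1 c x \<bullet> X3 c x = 0 \<and>
        \<omega>2 c x \<bullet> X1 c x = 0 \<and> \<omega>2 c x \<bullet> X2 c x = 1 \<and> \<omega>2 c x \<bullet> X3 c x = 0 \<and>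
        \<omega>3 c x \<bullet> X1 c x = 0 \<and> \<omega>3 c x \<bullet> X2 c x = 0 \<and> \<omega>3 c x \<bullet> X3 c x = 1)"

text \<open>A plane bundle is integrable if it is tangent to a foliation: locally, the leaves are the
  level sets of a submersion \<open>f\<close>.\<close>

definition integrable_bundle :: "'m chart set \<Rightarrow> 'm plane_bundle \<Rightarrow> bool" where
  "integrable_bundle A \<xi> \<longleftrightarrow> (\<forall>c\<in>A. \<forall>x\<in>cimg c. \<exists>V (f :: real^3 \<Rightarrow> real).
     open V \<and> x \<in> V \<and> V \<subseteq> cimg c \<and> smooth_on V f \<and>
     (\<forall>y\<in>V. (\<exists>v. frechet_derivative f (at y) v \<noteq> 0) \<and>
        \<xi> c y = {v. frechet_derivative f (at y) v = 0}))"

definition ext_deriv :: "(real^3 \<Rightarrow> real^3) \<Rightarrow> real^3 \<Rightarrow> real^3 \<Rightarrow> real^3 \<Rightarrow> real" where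
  "ext_deriv \<alpha> y u v =
     frechet_derivative \<alpha> (at y) u \<bullet> v - frechet_derivative \<alpha> (at y) v \<bullet> u"

text \<open>The 3-form \<open>\<alpha> \<and> d\<alpha>\<close>.\<close>

definition wedge_ext_deriv ::
  "(real^3 \<Rightarrow> real^3) \<Rightarrow> real^3 \<Rightarrow> real^3 \<Rightarrow> real^3 \<Rightarrow> real^3 \<Rightarrow> real" where
  "wedge_ext_deriv \<alpha> y u v w = (\<alpha> y \<bullet> u) * ext_deriv \<alpha> y v w +
     (\<alpha> y \<bullet> v) * ext_deriv \<alpha> y w u + (\<alpha> y \<bullet> w) * ext_deriv \<alpha> y u v"

definition contact_structure :: "'m chart set \<Rightarrow> 'm plane_bundle \<Rightarrow> bool" where
  "contact_structure A \<xi> \<longleftrightarrow> (\<forall>c\<in>A. \<forall>x\<in>cimg c. \<exists>V \<alpha>.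
     open V \<and> x \<in> V \<and> V \<subseteq> cimg c \<and> smooth_on V \<alpha> \<and>
     (\<forall>y\<in>V. \<xi> c y = {v. \<alpha> y \<bullet> v = 0} \<and> (\<exists>u v w. wedge_ext_deriv \<alpha> y u v w \<noteq> 0)))"


section \<open>Tops\<close>

text \<open>The frame is not required to be positively oriented. The pencil bundle underlying a top is
  the one defined by the first two forms of the coframe dual to the frame; adaptedness of
  the frame alone would only determine these forms up to nowhere vanishing factors.\<close>

definition is_top ::
  "('m::topological_space) chart set \<Rightarrow> 'm metric_tensor \<Rightarrow> (real \<Rightarrow> 'm plane_bundle) \<Rightarrow> bool" where
  "is_top A G \<xi> \<longleftrightarrow> (\<exists>X1 X2 X3 \<omega>1 \<omega>2 \<omega>3.
     orthonormal_frame A G X1 X2 X3 \<and> dual_coframe A X1 X2 X3 \<omega>1 \<omega>2 \<omega>3 \<and>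
     indexed_pencil A \<omega>1 \<omega>2 \<xi> \<and> adapted_frame A \<omega>1 \<omega>2 \<xi> X1 X2 X3 \<and>
     (\<forall>I \<gamma>. geodesic A G I \<gamma> \<longrightarrow>
        (\<exists>k. has_constant_value A I \<gamma> (angle_with G \<gamma> X3) k)) \<and>
     (\<forall>I \<gamma>. geodesic A G I \<gamma> \<and>
        (\<forall>t\<in>I. \<forall>c\<in>A. \<gamma> t \<in> cdom c \<longrightarrow> velocity \<gamma> c t \<notin> axis_bundle \<xi> c (coord c (\<gamma> t))) \<longrightarrow>
        (\<exists>k. has_constant_value A I \<gamma> (rotation_speed G \<gamma> (along \<gamma> X3) (velocity \<gamma>)) k)) \<and>
     (\<forall>I \<gamma>. geodesic A G I \<gamma> \<longrightarrow>
        (\<exists>k. has_constant_value A I \<gamma> (rotation_speed G \<gamma> (along \<gamma> X1) (along \<gamma> X3)) k)) \<and>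
     (\<forall>I \<gamma> J \<delta> a. geodesic A G I \<gamma> \<and> geodesic A G J \<delta> \<and>
        has_constant_value A I \<gamma> (angle_with G \<gamma> X3) a \<and>
        has_constant_value A J \<delta> (angle_with G \<delta> X3) a \<longrightarrow>
        (\<exists>k. has_constant_value A I \<gamma> (rotation_speed G \<gamma> (along \<gamma> X1) (along \<gamma> X3)) k \<and>
             has_constant_value A J \<delta> (rotation_speed G \<delta> (along \<delta> X1) (along \<delta> X3)) k)))"

end

theory Submission
  imports Defs
begin

text \<open>Feeding the geodesics of a top into its defining conditions determines the connection in the
  frame. Condition (i) makes \<open>X3\<close> a unit Killing field, so \<open>\<nabla>\<^sub>u X3 = \<tau> (u1 X2 - u2 X1)\<close> for a function
  \<open>\<tau>\<close>. Up to the orientation sign of the frame, condition (ii) says that \<open>\<tau>\<close> is constant along every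
  geodesic transverse to the axis, hence locally constant, hence constant. Condition (iv) says
  that \<open>u \<mapsto> \<langle>\<nabla>\<^sub>u X1, X2\<rangle>\<close> depends on the \<open>X3\<close>-component of \<open>u\<close> only, so it is \<open>\<kappa> u3\<close> with \<open>\<kappa>\<close> constant.
  Hence \<open>d\<omega>1 = \<delta> \<omega>2 \<and> \<omega>3\<close> and \<open>d\<omega>2 = - \<delta> \<omega>1 \<and> \<omega>3\<close> with \<open>\<delta> = \<tau> - \<kappa>\<close>, and \<open>\<omega>\<^sup>\<theta> \<and> d\<omega>\<^sup>\<theta>\<close> is \<open>\<delta>\<close> times the
  volume of the coframe for every \<open>\<theta>\<close>. If \<open>\<delta>\<close> vanishes, all \<open>\<omega>\<^sup>\<theta>\<close> are closed, and the Poincare lemma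
  yields the first integrals, without the Frobenius theorem.

  The geodesics come from the Picard--Lindelof theorem in one chart; that they satisfy the
  equation in all charts is the transformation law of the Christoffel symbols.\<close>

section \<open>Calculus of smooth maps\<close>

text \<open>The dichotomy is a matter of connectedness: up to the sign of the frame, the factor
  \<delta> is the difference of two quantities that take the same value at every point, so it
  vanishes everywhere or nowhere. The frame may be negatively oriented, whereas rotation speeds
  refer to the oriented cross product. Hence \<open>pitch\<close> and \<open>spin\<close> carry the
  factor \<open>orientation\<close>, whose square is 1; it cancels in the structure equations. These
  quantities are computed in charts, but their independence of the chart is not obtained from
  transformation laws: the hypotheses assert constancy in all charts at once, so geodesics compare
  the values in different charts. Only the geodesics themselves have to be transported, and this is
  what requires the symmetry of second derivatives. Condition (ii) is silent along the axis, so the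
  derivative of \<tau> in that direction is recovered by linearity from an oblique one. The
  Christoffel symbols contain the inverse metric; the frame expresses it explicitly, which gives the
  smoothness that the existence theorem asks for.\<close>

lemma higher_differentiable_mono_Suc: "higher_differentiable_on S f (Suc n) \<Longrightarrow> higher_differentiable_on S f n"
proof (induction n arbitrary: f)
  case 0
  then show ?case
    by (auto intro!: continuous_at_imp_continuous_on differentiable_imp_continuous_within)
next
  case (Suc n)
  have "\<forall>x\<in>S. f differentiable (at x)"
    and "\<forall>v. higher_differentiable_on S (\<lambda>x. frechet_derivative f (at x) v) (Suc n)"
    using Suc.prems unfolding higher_differentiable_on.simps(2)[of S f "Suc n"] by blast+
  then show ?case
    unfolding higher_differentiable_on.simps(2)[of S f n] using Suc.IH by blast
qed

lemma higher_differentiable_mono: "higher_differentiable_on S f n \<Longrightarrow> m \<le> n \<Longrightarrow> higher_differentiable_on S f m"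
proof (induction n)
  case (Suc n)
  then show ?case using higher_differentiable_mono_Suc[of S f n] le_Suc_eq by blast
qed simp

lemma higher_differentiable_continuous: "higher_differentiable_on S f n \<Longrightarrow> continuous_on S f"
  using higher_differentiable_mono[of S f n 0] by simp

lemma higher_differentiable_subset: "higher_differentiable_on S f n \<Longrightarrow> T \<subseteq> S \<Longrightarrow> higher_differentiable_on T f n"
  by (induction n arbitrary: f) (auto intro: continuous_on_subset)

lemma higher_differentiable_has_derivative:
  "higher_differentiable_on S f (Suc n) \<Longrightarrow> x \<in> S \<Longrightarrow>
    (f has_derivative frechet_derivative f (at x)) (at x)"
  by (simp add: frechet_derivative_works)

lemma higher_differentiable_SucI:
  assumes "\<And>x. x \<in> S \<Longrightarrow> (f has_derivative f' x) (at x)"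
    and "\<And>v. higher_differentiable_on S (\<lambda>x. frechet_derivative f (at x) v) n"
  shows "higher_differentiable_on S f (Suc n)"
  using assms by (auto simp: differentiable_def)

text \<open>On an open set the Frechet derivative at a point depends only on nearby values in the
  set, so agreement on \<open>S\<close> passes to all higher derivatives.\<close>

lemma higher_differentiable_cong:
  assumes "open S" "higher_differentiable_on S f n" "\<And>x. x \<in> S \<Longrightarrow> f x = g x"
  shows "higher_differentiable_on S g n"
  using assms(2,3)
proof (induction n arbitrary: f g)
  case 0
  then show ?case using continuous_on_cong by (metis higher_differentiable_on.simps(1))
next
  case (Suc n)
  have D: "(g has_derivative frechet_derivative f (at x)) (at x)" if "x \<in> S" for x
    using has_derivative_transform_within_open[OF higher_differentiable_has_derivative[OF Suc.prems(1) that] assms(1) that]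
      Suc.prems(2) by blast
  show ?case
  proof (rule higher_differentiable_SucI[OF D])
    fix v
    show "higher_differentiable_on S (\<lambda>x. frechet_derivative g (at x) v) n"
      by (rule Suc.IH[of "\<lambda>x. frechet_derivative f (at x) v"])
        (use Suc.prems(1) frechet_derivative_at[OF D] in auto)
  qed
qed

text \<open>Lets any known derivative \<open>f'\<close> stand for \<open>frechet_derivative\<close>,
  so that the inductions below can quote the product and chain rules directly.\<close>

lemma higher_differentiable_SucI':
  assumes "open S" "\<And>x. x \<in> S \<Longrightarrow> (f has_derivative f' x) (at x)"
    and "\<And>v. higher_differentiable_on S (\<lambda>x. f' x v) n"
  shows "higher_differentiable_on S f (Suc n)"
proof (rule higher_differentiable_SucI[OF assms(2)])
  fix v show "higher_differentiable_on S (\<lambda>x. frechet_derivative f (at x) v) n"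
    by (rule higher_differentiable_cong[OF assms(1) assms(3)[of v]]) (use frechet_derivative_at[OF assms(2)] in auto)
qed

lemma higher_differentiable_const: "higher_differentiable_on S (\<lambda>x. c) n"
  by (induction n arbitrary: c) (auto simp: frechet_derivative_const)

lemma higher_differentiable_bounded_linear:
  assumes "bounded_linear h" shows "higher_differentiable_on S h n"
proof (cases n)
  case 0
  then show ?thesis by (simp add: assms linear_continuous_on)
next
  case (Suc m)
  have "frechet_derivative h (at x) v = h v" for x v
    using frechet_derivative_at[OF bounded_linear.has_derivative[OF assms has_derivative_ident]] by metis
  then show ?thesis
    using Suc assms higher_differentiable_const bounded_linear_imp_differentiable by auto
qed

lemma higher_differentiable_compose_linear:
  assumes "open S" "bounded_linear h" "higher_differentiable_on S f n"
  shows "higher_differentiable_on S (\<lambda>x. h (f x)) n"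
  using assms(3)
proof (induction n arbitrary: f)
  case 0
  then show ?case
    using continuous_on_compose2[OF linear_continuous_on[OF assms(2), of UNIV]] by auto
next
  case (Suc n)
  show ?case
  proof (rule higher_differentiable_SucI'[OF assms(1)])
    show "((\<lambda>x. h (f x)) has_derivative (\<lambda>v. h (frechet_derivative f (at x) v))) (at x)" if "x \<in> S" for x
      by (rule bounded_linear.has_derivative[OF assms(2) higher_differentiable_has_derivative[OF Suc.prems that]])
  qed (use Suc in auto)
qed

lemma higher_differentiable_add:
  assumes "open S" "higher_differentiable_on S f n" "higher_differentiable_on S g n"
  shows "higher_differentiable_on S (\<lambda>x. f x + g x) n"
  using assms(2,3)
proof (induction n arbitrary: f g)
  case 0
  then show ?case by (auto intro: continuous_on_add)
next
  case (Suc n)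
  show ?case
    by (rule higher_differentiable_SucI'[OF assms(1) has_derivative_add[OF higher_differentiable_has_derivative higher_differentiable_has_derivative]])
      (use Suc in auto)
qed

lemma higher_differentiable_sum:
  assumes "open S" "\<And>i. i \<in> I \<Longrightarrow> higher_differentiable_on S (f i) n"
  shows "higher_differentiable_on S (\<lambda>x. \<Sum>i\<in>I. f i x) n"
  using assms(2)
  by (induction I rule: infinite_finite_induct) (auto intro: higher_differentiable_add[OF assms(1)] higher_differentiable_const)

lemma higher_differentiable_bilinear:
  assumes "open S" "bounded_bilinear h" "higher_differentiable_on S f n" "higher_differentiable_on S g n"
  shows "higher_differentiable_on S (\<lambda>x. h (f x) (g x)) n"
  using assms(3,4)
proof (induction n arbitrary: f g)
  case 0
  then show ?case by (simp add: bounded_bilinear.continuous_on[OF assms(2)])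
next
  case (Suc n)
  show ?case
  proof (rule higher_differentiable_SucI'[OF assms(1) bounded_bilinear.FDERIV[OF assms(2) higher_differentiable_has_derivative higher_differentiable_has_derivative]])
    \<comment> \<open>In each term of the product rule one factor stays undifferentiated; it is
      needed at the lower order \<open>n\<close>, which
      \<open>higher_differentiable_mono_Suc\<close> supplies.\<close>
    fix v
    show "higher_differentiable_on S
          (\<lambda>x. h (f x) (frechet_derivative g (at x) v) + h (frechet_derivative f (at x) v) (g x)) n"
      by (intro higher_differentiable_add[OF assms(1)] Suc.IH) (use Suc.prems higher_differentiable_mono_Suc[OF Suc.prems(1)] higher_differentiable_mono_Suc[OF Suc.prems(2)] in auto)
  qed (use Suc.prems in auto)
qed

lemma higher_differentiable_compose:
  fixes g :: "'a::real_normed_vector \<Rightarrow> 'b::euclidean_space" and f :: "'b \<Rightarrow> 'c::real_normed_vector"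
  assumes "open S" "higher_differentiable_on T f n" "higher_differentiable_on S g n" "g ` S \<subseteq> T"
  shows "higher_differentiable_on S (\<lambda>x. f (g x)) n"
  using assms(2,3)
proof (induction n arbitrary: f)
  case 0
  then show ?case using continuous_on_compose2 assms(4) by fastforce
next
  case (Suc n)
  let ?f' = "\<lambda>y. frechet_derivative f (at y)" and ?g' = "\<lambda>x. frechet_derivative g (at x)"
  have gT: "g x \<in> T" if "x \<in> S" for x using that assms(4) by auto
  \<comment> \<open>Smoothness is defined through derivatives in fixed directions, while the chain
    rule differentiates \<open>f\<close> in the moving direction \<open>?g' x v\<close>. Expanding
    in the basis turns this into products to which the induction hypothesis applies.\<close>
  have E: "?f' (g x) (?g' x v) = (\<Sum>b\<in>Basis. (?g' x v \<bullet> b) *\<^sub>R ?f' (g x) b)" if "x \<in> S" for x v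
  proof -
    have l: "linear (?f' (g x))"
      using higher_differentiable_has_derivative[OF Suc.prems(1) gT[OF that]] has_derivative_linear by blast
    have "?f' (g x) (?g' x v) = ?f' (g x) (\<Sum>b\<in>Basis. (?g' x v \<bullet> b) *\<^sub>R b)"
      by (simp add: euclidean_representation)
    also have "\<dots> = (\<Sum>b\<in>Basis. (?g' x v \<bullet> b) *\<^sub>R ?f' (g x) b)"
      by (simp add: linear_sum[OF l] linear_scale[OF l])
    finally show ?thesis .
  qed
  have g: "higher_differentiable_on S g n" using Suc.prems(2) higher_differentiable_mono_Suc by blast
  show ?case
  proof (rule higher_differentiable_SucI'[OF assms(1)])
    show "((\<lambda>x. f (g x)) has_derivative (\<lambda>v. ?f' (g x) (?g' x v))) (at x)" if "x \<in> S" for x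
      using diff_chain_at[OF higher_differentiable_has_derivative[OF Suc.prems(2) that] higher_differentiable_has_derivative[OF Suc.prems(1) gT[OF that]]]
      by (simp add: o_def)
    fix v
    have 1: "higher_differentiable_on S (\<lambda>x. ?f' (g x) b) n" for b
      by (rule Suc.IH[OF _ g]) (use Suc.prems(1) in simp)
    have 2: "higher_differentiable_on S (\<lambda>x. ?g' x v \<bullet> b) n" for b
      by (rule higher_differentiable_compose_linear[OF assms(1) bounded_linear_inner_left]) (use Suc.prems(2) in simp)
    have "higher_differentiable_on S (\<lambda>x. \<Sum>b\<in>Basis. (?g' x v \<bullet> b) *\<^sub>R ?f' (g x) b) n"
      by (rule higher_differentiable_sum[OF assms(1) higher_differentiable_bilinear[OF assms(1) bounded_bilinear_scaleR 2 1]])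
    then show "higher_differentiable_on S (\<lambda>x. ?f' (g x) (?g' x v)) n"
      by (rule higher_differentiable_cong[OF assms(1)]) (simp add: E)
  qed
qed

lemma higher_differentiable_Pair:
  assumes "open S" "higher_differentiable_on S f n" "higher_differentiable_on S g n"
  shows "higher_differentiable_on S (\<lambda>x. (f x, g x)) n"
proof -
  have "bounded_linear (\<lambda>y. (y, 0))" "bounded_linear (\<lambda>y. (0, y))"
    by (auto intro!: bounded_linear_Pair bounded_linear_ident bounded_linear_zero)
  from higher_differentiable_add[OF assms(1) higher_differentiable_compose_linear[OF assms(1) this(1) assms(2)] higher_differentiable_compose_linear[OF assms(1) this(2) assms(3)]]
  show ?thesis by simp
qed

lemma bounded_bilinear_matrix_vector:
  "bounded_bilinear (\<lambda>(M::real^'n::finite^'m::finite) v. M *v v)"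
  unfolding bilinear_conv_bounded_bilinear[symmetric] bilinear_def
  by (auto intro!: linearI simp: matrix_vector_mult_add_rdistrib matrix_vector_right_distrib
      matrix_vector_mult_scaleR scaleR_matrix_vector_assoc)

section \<open>Closure properties of smooth maps\<close>

lemma smooth_onD: "smooth_on S f \<Longrightarrow> higher_differentiable_on S f n"
  unfolding smooth_on_def by (rule spec)

lemma smooth_onI: "(\<And>n. higher_differentiable_on S f n) \<Longrightarrow> smooth_on S f"
  unfolding smooth_on_def by (rule allI)

lemma smooth_cong:
  assumes "open S" "smooth_on S f" "\<And>x. x \<in> S \<Longrightarrow> f x = g x"
  shows "smooth_on S g"
  by (rule smooth_onI, rule higher_differentiable_cong[OF assms(1) smooth_onD[OF assms(2)] assms(3)])

lemma smooth_subset: "smooth_on S f \<Longrightarrow> T \<subseteq> S \<Longrightarrow> smooth_on T f"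
  by (rule smooth_onI, rule higher_differentiable_subset, rule smooth_onD)

lemma smooth_continuous: "smooth_on S f \<Longrightarrow> continuous_on S f"
  by (rule higher_differentiable_continuous, rule smooth_onD[of _ _ 0])

lemma smooth_has_derivative:
  "smooth_on S f \<Longrightarrow> x \<in> S \<Longrightarrow> (f has_derivative frechet_derivative f (at x)) (at x)"
  by (rule higher_differentiable_has_derivative, rule smooth_onD[of _ _ "Suc 0"])

lemma smooth_derivative:
  assumes "smooth_on S f" shows "smooth_on S (\<lambda>x. frechet_derivative f (at x) v)"
  unfolding smooth_on_def
proof
  fix n
  have "higher_differentiable_on S f (Suc n)"
    using assms unfolding smooth_on_def by (rule spec)
  then show "higher_differentiable_on S (\<lambda>x. frechet_derivative f (at x) v) n"
    by simp
qed

lemma smoothI: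
  assumes "open S" "\<And>x. x \<in> S \<Longrightarrow> (f has_derivative f' x) (at x)" "\<And>v. smooth_on S (\<lambda>x. f' x v)"
  shows "smooth_on S f"
  by (rule smooth_onI, rule higher_differentiable_mono_Suc, rule higher_differentiable_SucI'[OF assms(1,2) smooth_onD[OF assms(3)]])

lemma smooth_const: "smooth_on S (\<lambda>x. c)"
  by (rule smooth_onI, rule higher_differentiable_const)

lemma smooth_linear: "bounded_linear h \<Longrightarrow> smooth_on S h"
  by (rule smooth_onI, rule higher_differentiable_bounded_linear)

lemma smooth_add: "open S \<Longrightarrow> smooth_on S f \<Longrightarrow> smooth_on S g \<Longrightarrow> smooth_on S (\<lambda>x. f x + g x)"
  by (rule smooth_onI, rule higher_differentiable_add) (auto intro: smooth_onD)

lemma smooth_sum: "open S \<Longrightarrow> (\<And>i. i \<in> I \<Longrightarrow> smooth_on S (f i)) \<Longrightarrow> smooth_on S (\<lambda>x. \<Sum>i\<in>I. f i x)"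
  by (rule smooth_onI, rule higher_differentiable_sum) (auto intro: smooth_onD)

lemma smooth_bilinear:
  "open S \<Longrightarrow> bounded_bilinear h \<Longrightarrow> smooth_on S f \<Longrightarrow> smooth_on S g \<Longrightarrow> smooth_on S (\<lambda>x. h (f x) (g x))"
  by (rule smooth_onI, rule higher_differentiable_bilinear) (auto intro: smooth_onD)

lemma smooth_compose:
  fixes g :: "'a::real_normed_vector \<Rightarrow> 'b::euclidean_space"
  shows "open S \<Longrightarrow> smooth_on T f \<Longrightarrow> smooth_on S g \<Longrightarrow> g ` S \<subseteq> T \<Longrightarrow> smooth_on S (\<lambda>x. f (g x))"
  by (rule smooth_onI, rule higher_differentiable_compose) (auto intro: smooth_onD)

lemma smooth_compose_linear:
  "open S \<Longrightarrow> bounded_linear h \<Longrightarrow> smooth_on S f \<Longrightarrow> smooth_on S (\<lambda>x. h (f x))"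
  by (rule smooth_onI, rule higher_differentiable_compose_linear) (auto intro: smooth_onD)

lemma smooth_scaleR: "open S \<Longrightarrow> smooth_on S f \<Longrightarrow> smooth_on S g \<Longrightarrow> smooth_on S (\<lambda>x. f x *\<^sub>R g x)"
  by (rule smooth_bilinear[OF _ bounded_bilinear_scaleR])

lemma smooth_inner: "open S \<Longrightarrow> smooth_on S f \<Longrightarrow> smooth_on S g \<Longrightarrow> smooth_on S (\<lambda>x. f x \<bullet> g x)"
  by (rule smooth_bilinear[OF _ bounded_bilinear_inner])

lemma smooth_matrix_vector:
  fixes M :: "_ \<Rightarrow> real^'n::finite^'m::finite"
  shows "open S \<Longrightarrow> smooth_on S M \<Longrightarrow> smooth_on S g \<Longrightarrow> smooth_on S (\<lambda>x. M x *v g x)"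
  by (rule smooth_bilinear[OF _ bounded_bilinear_matrix_vector])

text \<open>The same basis expansion as in the chain rule, for a base point and a direction that
  both vary smoothly.\<close>

lemma smooth_derivative_along:
  fixes f :: "'a::euclidean_space \<Rightarrow> 'b::real_normed_vector" and g :: "'c::real_normed_vector \<Rightarrow> 'a"
  assumes "open S" "smooth_on T f" "smooth_on S g" "smooth_on S v" "g ` S \<subseteq> T"
  shows "smooth_on S (\<lambda>x. frechet_derivative f (at (g x)) (v x))"
proof -
  have "frechet_derivative f (at (g x)) (v x) = (\<Sum>b\<in>Basis. (v x \<bullet> b) *\<^sub>R frechet_derivative f (at (g x)) b)"
    if "x \<in> S" for x
  proof -
    have l: "linear (frechet_derivative f (at (g x)))"
      using assms(5) that by (intro has_derivative_linear[OF smooth_has_derivative[OF assms(2)]]) auto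
    have "frechet_derivative f (at (g x)) (v x) = frechet_derivative f (at (g x)) (\<Sum>b\<in>Basis. (v x \<bullet> b) *\<^sub>R b)"
      by (simp add: euclidean_representation)
    then show ?thesis by (simp add: linear_sum[OF l] linear_scale[OF l])
  qed
  moreover have "smooth_on S (\<lambda>x. frechet_derivative f (at (g x)) b)" for b
    by (rule smooth_compose[OF assms(1) smooth_derivative[OF assms(2)] assms(3,5)])
  then have "smooth_on S (\<lambda>x. \<Sum>b\<in>Basis. (v x \<bullet> b) *\<^sub>R frechet_derivative f (at (g x)) b)"
    by (intro smooth_sum[OF assms(1)] smooth_scaleR[OF assms(1)] smooth_inner[OF assms(1,4) smooth_const])
  ultimately show ?thesis
    using smooth_cong[OF assms(1), where g="\<lambda>x. frechet_derivative f (at (g x)) (v x)"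
        and f="\<lambda>x. \<Sum>b\<in>Basis. (v x \<bullet> b) *\<^sub>R frechet_derivative f (at (g x)) b"]
    by metis
qed

section \<open>Ordinary differential equations\<close>

text \<open>The operator norm of the derivative is at most the sum of the norms of its values on the
  basis. That sum is continuous, because \<open>higher_differentiable_on\<close> gives continuity of
  each directional derivative, hence bounded on \<open>K\<close>; convexity turns the bound into a
  Lipschitz constant.\<close>

lemma C1_lipschitz_on_compact_convex:
  fixes F :: "'a::euclidean_space \<Rightarrow> 'b::real_normed_vector"
  assumes F: "higher_differentiable_on W F 1" and K: "compact K" "convex K" "K \<subseteq> W"
  obtains L where "L \<ge> 0" "\<And>x y. x \<in> K \<Longrightarrow> y \<in> K \<Longrightarrow> norm (F x - F y) \<le> L * norm (x - y)"
proof -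
  let ?D = "\<lambda>x. frechet_derivative F (at x)"
  have D: "(F has_derivative ?D x) (at x)" if "x \<in> K" for x
    using F K(3) that by (intro higher_differentiable_has_derivative[of W F 0]) auto
  have "continuous_on K (\<lambda>x. \<Sum>b\<in>Basis. norm (?D x b))"
    using F K(3) by (auto intro!: continuous_intros intro: continuous_on_subset)
  then have "bounded ((\<lambda>x. \<Sum>b\<in>Basis. norm (?D x b)) ` K)"
    using K(1) compact_continuous_image compact_imp_bounded by blast
  then obtain L where L: "L > 0" "\<And>x. x \<in> K \<Longrightarrow> norm (\<Sum>b\<in>Basis. norm (?D x b)) \<le> L"
    by (auto simp: bounded_pos)
  have "onorm (?D x) \<le> L" if "x \<in> K" for x
  proof (rule onorm_le)
    fix v
    have l: "linear (?D x)" using has_derivative_linear[OF D[OF that]] .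
    have "?D x v = ?D x (\<Sum>b\<in>Basis. (v \<bullet> b) *\<^sub>R b)" by (simp add: euclidean_representation)
    also have "\<dots> = (\<Sum>b\<in>Basis. (v \<bullet> b) *\<^sub>R ?D x b)"
      by (simp add: linear_sum[OF l] linear_scale[OF l])
    also have "norm \<dots> \<le> (\<Sum>b\<in>Basis. norm v * norm (?D x b))"
      by (rule sum_norm_le) (auto intro!: mult_right_mono Basis_le_norm)
    also have "\<dots> = norm v * (\<Sum>b\<in>Basis. norm (?D x b))" by (simp add: sum_distrib_left)
    also have "\<dots> \<le> norm v * L" using L(2)[OF that] by (intro mult_left_mono) auto
    finally show "norm (?D x v) \<le> L * norm v" by (simp add: mult.commute)
  qed
  then have "norm (F x - F y) \<le> L * norm (x - y)" if "x \<in> K" "y \<in> K" for x y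
    by (intro differentiable_bound[OF K(2) has_derivative_at_withinI[OF D]] that)
  then show thesis using that L(1) by (meson less_eq_real_def)
qed

text \<open>The integral from \<open>0\<close> to \<open>t\<close> is written as a difference of integrals from \<open>-e\<close>, so that negative
  \<open>t\<close> need no case distinction.\<close>

lemma picard_lindelof:
  fixes F :: "'a::euclidean_space \<Rightarrow> 'a"
  assumes W: "open W" "y0 \<in> W" and F: "higher_differentiable_on W F 1"
  obtains e y where "e > 0" "y 0 = y0"
    "\<And>t. t \<in> {-e<..<e} \<Longrightarrow> y t \<in> W \<and> (y has_vector_derivative F (y t)) (at t)"
proof -
  obtain r where r: "r > 0" "cball y0 r \<subseteq> W" using W open_contains_cball by blast
  obtain L where L: "L \<ge> 0"
    "\<And>x y. x \<in> cball y0 r \<Longrightarrow> y \<in> cball y0 r \<Longrightarrow> norm (F x - F y) \<le> L * norm (x - y)"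
    using C1_lipschitz_on_compact_convex[OF F compact_cball convex_cball r(2)] by blast
  have Fc: "continuous_on (cball y0 r) F"
    using higher_differentiable_continuous[OF F] r(2) continuous_on_subset by blast
  then have "bounded (F ` cball y0 r)"
    using compact_continuous_image[OF _ compact_cball] compact_imp_bounded by blast
  then obtain B where B: "B > 0" "\<And>x. x \<in> cball y0 r \<Longrightarrow> norm (F x) \<le> B"
    by (auto simp: bounded_pos)
  \<comment> \<open>The difference of the two integrals is at most \<open>3 * e\<close> times a
    bound on the integrand: \<open>2 * e\<close> for the one up to \<open>cl t\<close>,
    \<open>e\<close> for the one up to \<open>0\<close>. The first entry of the minimum keeps the
    values in the ball, the second gives the contraction factor 1/2; \<open>L + 1\<close> avoids
    division by zero.\<close>
  define e where "e = min (r / (3 * B)) (1 / (6 * (L + 1)))"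
  have e0: "e > 0" using r B L by (simp add: e_def)
  have eB: "3 * e * B \<le> r"
  proof -
    have "e \<le> r / (3 * B)" by (simp add: e_def)
    then show ?thesis using B by (simp add: field_simps)
  qed
  have eL: "3 * e * L \<le> 1/2"
  proof -
    have "e \<le> 1 / (6 * (L + 1))" by (simp add: e_def)
    then have "e * (6 * (L + 1)) \<le> 1" using L by (simp add: field_simps)
    then have "6 * e * L + 6 * e \<le> 1" by (simp add: algebra_simps)
    then show ?thesis using e0 by linarith
  qed
  \<comment> \<open>Functions on the whole line, so that they form a closed subset of the complete
    space of bounded continuous functions. Clamping the time by \<open>cl\<close> makes the Picard
    map \<open>P\<close> bounded at all times.\<close>
  define S where "S = (PiC UNIV (\<lambda>_. cball y0 r) :: (real \<Rightarrow>\<^sub>C 'a) set)"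
  define cl where "cl t = max (-e) (min e t)" for t :: real
  have cl: "-e \<le> cl t" "cl t \<le> e" for t using e0 by (auto simp: cl_def)
  define P where "P y t = y0 + integral {-e..cl t} (\<lambda>s. F (y s)) - integral {-e..0} (\<lambda>s. F (y s))"
    for y :: "real \<Rightarrow> 'a" and t
  have inS: "y s \<in> cball y0 r" if "y \<in> S" for y :: "real \<Rightarrow>\<^sub>C 'a" and s
    using mem_PiCD[OF that[unfolded S_def]] by (auto simp: Pi_iff)
  have Fy: "continuous_on T (\<lambda>s. F (apply_bcontfun y s))" if "y \<in> S" for y T
    using inS[OF that] by (intro continuous_on_compose2[OF Fc continuous_on_apply_bcontfun]) auto
  have bnd: "norm (integral {-e..cl t} f - integral {-e..0} f) \<le> 3 * e * b"
    if "continuous_on UNIV f" "\<And>s. norm (f s) \<le> b" for f :: "real \<Rightarrow> 'a" and t b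
  proof -
    have b: "b \<ge> 0" using that(2)[of 0] norm_ge_zero order_trans by blast
    have c: "continuous_on T f" for T using that(1) continuous_on_subset by blast
    have "norm (integral {-e..cl t} f) \<le> b * (cl t - (-e))"
      by (rule integral_bound[OF cl(1) c that(2)])
    also have "\<dots> \<le> b * (2 * e)" using cl(2)[of t] b by (intro mult_left_mono) auto
    finally have 1: "norm (integral {-e..cl t} f) \<le> b * (2 * e)" .
    have "norm (integral {-e..0} f) \<le> b * (0 - (-e))"
      using e0 by (intro integral_bound c that(2)) auto
    with 1 have "norm (integral {-e..cl t} f - integral {-e..0} f) \<le> b * (2 * e) + b * e"
      using norm_triangle_ineq4[of "integral {-e..cl t} f" "integral {-e..0} f"] by simp
    then show ?thesis by (simp add: algebra_simps)
  qed
  have Pball: "P y t \<in> cball y0 r" if "y \<in> S" for y :: "real \<Rightarrow>\<^sub>C 'a" and t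
    using bnd[OF Fy[OF that] B(2)[OF inS[OF that]], of t] eB
    by (simp add: P_def dist_norm norm_minus_commute add_diff_eq[symmetric])
  have Pbc: "P y \<in> bcontfun" if "y \<in> S" for y :: "real \<Rightarrow>\<^sub>C 'a"
  proof (rule bcontfun_normI)
    have "continuous_on {-e..e} (\<lambda>t. integral {-e..t} (\<lambda>s. F (y s)))"
      by (intro indefinite_integral_continuous_1 integrable_continuous_real Fy that)
    then have "continuous_on UNIV (\<lambda>t. integral {-e..cl t} (\<lambda>s. F (y s)))"
      by (rule continuous_on_compose2) (use cl in \<open>auto simp: cl_def intro!: continuous_intros\<close>)
    then show "continuous_on UNIV (P y)" unfolding P_def by (intro continuous_intros)
    show "norm (P y x) \<le> norm y0 + r" for x
      using Pball[OF that, of x] norm_triangle_ineq2[of "P y x" y0]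
      by (simp add: dist_norm norm_minus_commute)
  qed
  have app: "apply_bcontfun (Bcontfun (P (apply_bcontfun y))) = P y" if "y \<in> S" for y :: "real \<Rightarrow>\<^sub>C 'a"
    using Bcontfun_inverse[OF Pbc[OF that]] .
  have "\<exists>!y\<in>S. Bcontfun (P (apply_bcontfun y)) = y"
  proof (rule Banach_fix)
    show "complete S" unfolding S_def complete_eq_closed by (rule closed_PiC) simp
    have "const_bcontfun y0 \<in> S" using r by (auto simp: S_def intro!: mem_PiCI)
    then show "S \<noteq> {}" by blast
    show "0 \<le> (1/2::real)" "(1/2::real) < 1" by auto
    show "(\<lambda>y. Bcontfun (P (apply_bcontfun y))) ` S \<subseteq> S"
      using Pball app by (auto simp: S_def mem_PiC_iff simp del: mem_cball)
    fix y z assume yz: "y \<in> S" "z \<in> S"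
    show "dist (Bcontfun (P (apply_bcontfun y))) (Bcontfun (P (apply_bcontfun z))) \<le> 1 / 2 * dist y z"
    proof (rule dist_bound)
      fix t
      let ?d = "\<lambda>s. F (y s) - F (z s)"
      have c: "continuous_on UNIV ?d" by (intro continuous_intros Fy yz)
      have n: "norm (?d s) \<le> L * dist y z" for s
      proof -
        have "norm (?d s) \<le> L * norm (y s - z s)" by (intro L(2) inS yz)
        also have "\<dots> \<le> L * dist y z"
          using dist_bounded[of y s z] L(1) by (intro mult_left_mono) (auto simp: dist_norm)
        finally show ?thesis .
      qed
      have "P y t - P z t = integral {-e..cl t} ?d - integral {-e..0} ?d"
        by (simp add: P_def integral_diff[OF integrable_continuous_real integrable_continuous_real] Fy yz)
      then have "norm (P y t - P z t) \<le> 3 * e * (L * dist y z)" using bnd[OF c n] by simp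
      also have "\<dots> = (3 * e * L) * dist y z" by simp
      also have "\<dots> \<le> 1/2 * dist y z" by (intro mult_right_mono eL) auto
      finally show "dist (Bcontfun (P (apply_bcontfun y)) t) (Bcontfun (P (apply_bcontfun z)) t) \<le> 1/2 * dist y z"
        by (simp add: app yz dist_norm)
    qed
  qed
  then obtain y where y: "y \<in> S" "Bcontfun (P (apply_bcontfun y)) = y" by blast
  then have yP: "y t = P y t" for t using app[OF y(1)] by metis
  show thesis
  proof (rule that[OF e0])
    have "cl 0 = 0" using e0 by (simp add: cl_def)
    then show "y 0 = y0" by (subst yP) (simp add: P_def)
    fix t assume t: "t \<in> {-e<..<e}"
    have "((\<lambda>u. integral {-e..u} (\<lambda>s. F (y s))) has_vector_derivative F (y t)) (at t within {-e..e})"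
      by (rule integral_has_vector_derivative) (use t Fy[OF y(1)] in auto)
    then have "((\<lambda>u. integral {-e..u} (\<lambda>s. F (y s))) has_vector_derivative F (y t)) (at t)"
      using at_within_interior[of t "{-e..e}"] t by (simp add: interior_atLeastAtMost_real)
    then have "((\<lambda>u. y0 + integral {-e..u} (\<lambda>s. F (y s)) - integral {-e..0} (\<lambda>s. F (y s)))
        has_vector_derivative F (y t)) (at t)"
      by (auto intro!: derivative_eq_intros)
    then have "(y has_vector_derivative F (y t)) (at t)"
    proof (rule has_vector_derivative_transform_within_open[where S="{-e<..<e}"])
      fix s assume s: "s \<in> {-e<..<e}"
      then have "cl s = s" by (auto simp: cl_def)
      then show "y0 + integral {-e..s} (\<lambda>s. F (y s)) - integral {-e..0} (\<lambda>s. F (y s)) = y s"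
        using yP[of s] by (simp add: P_def)
    qed (use t in auto)
    then show "y t \<in> W \<and> (y has_vector_derivative F (y t)) (at t)"
      using inS[OF y(1)] r(2) by blast
  qed
qed

text \<open>Bootstrapping: if \<open>y\<close> has order \<open>n\<close>, so has its derivative
  \<open>F (y t)\<close>, and therefore \<open>y\<close> has order \<open>Suc n\<close>.\<close>

lemma smooth_ode_solution:
  fixes F :: "'a::euclidean_space \<Rightarrow> 'a"
  assumes "open I" "smooth_on W F"
    and y: "\<And>t. t \<in> I \<Longrightarrow> y t \<in> W \<and> (y has_vector_derivative F (y t)) (at t)"
  shows "smooth_on I y"
proof (rule smooth_onI)
  fix n
  show "higher_differentiable_on I y n"
  proof (induction n)
    case 0
    then show ?case
      using y by (auto intro!: continuous_at_imp_continuous_on has_vector_derivative_continuous)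
  next
    case (Suc n)
    show ?case
    proof (rule higher_differentiable_SucI'[OF assms(1)])
      show "(y has_derivative (\<lambda>s. s *\<^sub>R F (y t))) (at t)" if "t \<in> I" for t
        using y[OF that] by (simp add: has_vector_derivative_def)
      show "higher_differentiable_on I (\<lambda>t. v *\<^sub>R F (y t)) n" for v
        by (rule higher_differentiable_compose_linear[OF assms(1) bounded_linear_scaleR_right
              higher_differentiable_compose[OF assms(1) smooth_onD[OF assms(2)] Suc.IH]]) (use y in auto)
    qed
  qed
qed

section \<open>Second derivatives and closed forms\<close>

text \<open>The mean value theorem is applied twice: along \<open>u\<close> to the increment of
  \<open>f\<close> in \<open>v\<close>, then along \<open>v\<close> to the difference of first
  derivatives that results. The left-hand side is symmetric in \<open>u\<close> and
  \<open>v\<close>, so exchanging them expresses it through the other mixed derivative.\<close>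

lemma second_difference_mvt:
  fixes f :: "'a::real_normed_vector \<Rightarrow> real"
  assumes s: "s > 0" and sub: "\<And>\<rho> \<sigma>. \<rho> \<in> {0..s} \<Longrightarrow> \<sigma> \<in> {0..s} \<Longrightarrow> x + \<rho> *\<^sub>R u + \<sigma> *\<^sub>R v \<in> S"
    and f: "\<And>y. y \<in> S \<Longrightarrow> (f has_derivative f' y) (at y)"
    and fu: "\<And>y. y \<in> S \<Longrightarrow> ((\<lambda>y. f' y u) has_derivative Du y) (at y)"
  obtains \<rho> \<sigma> where "\<rho> \<in> {0..s}" "\<sigma> \<in> {0..s}"
    "f (x + s *\<^sub>R u + s *\<^sub>R v) - f (x + s *\<^sub>R u) - f (x + s *\<^sub>R v) + f x = s * (s * Du (x + \<rho> *\<^sub>R u + \<sigma> *\<^sub>R v) v)"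
proof -
  have line: "((\<lambda>\<rho>. p + \<rho> *\<^sub>R w) has_derivative (\<lambda>h. h *\<^sub>R w)) (at \<rho>)" for p w :: 'a and \<rho>
    by (auto intro!: derivative_eq_intros)
  let ?g = "\<lambda>\<rho>. f (x + s *\<^sub>R v + \<rho> *\<^sub>R u) - f (x + \<rho> *\<^sub>R u)"
  have 1: "(?g has_real_derivative f' (x + s *\<^sub>R v + \<rho> *\<^sub>R u) u - f' (x + \<rho> *\<^sub>R u) u) (at \<rho>)"
    if "0 \<le> \<rho>" "\<rho> \<le> s" for \<rho>
  proof -
    have in1: "x + s *\<^sub>R v + \<rho> *\<^sub>R u \<in> S" using sub[of \<rho> s] that s by (simp add: algebra_simps)
    have in2: "x + \<rho> *\<^sub>R u \<in> S" using sub[of \<rho> 0] that s by simp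
    have lin: "f' y (h *\<^sub>R u) = h * f' y u" if "y \<in> S" for y h
      using has_derivative_linear[OF f[OF that]] linear_scale by fastforce
    have "(?g has_derivative (\<lambda>h. f' (x + s *\<^sub>R v + \<rho> *\<^sub>R u) (h *\<^sub>R u) - f' (x + \<rho> *\<^sub>R u) (h *\<^sub>R u))) (at \<rho>)"
      by (intro has_derivative_diff has_derivative_compose[OF line f] in1 in2)
    moreover have "(\<lambda>h. f' (x + s *\<^sub>R v + \<rho> *\<^sub>R u) (h *\<^sub>R u) - f' (x + \<rho> *\<^sub>R u) (h *\<^sub>R u))
        = (*) (f' (x + s *\<^sub>R v + \<rho> *\<^sub>R u) u - f' (x + \<rho> *\<^sub>R u) u)"
      by (simp add: fun_eq_iff lin in1 in2 right_diff_distrib mult.commute[of "_ - _"])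
    ultimately show ?thesis by (simp add: has_field_derivative_def)
  qed
  obtain \<rho> where \<rho>: "0 < \<rho>" "\<rho> < s"
    "?g s - ?g 0 = (s - 0) * (f' (x + s *\<^sub>R v + \<rho> *\<^sub>R u) u - f' (x + \<rho> *\<^sub>R u) u)"
    using MVT2[OF s 1] by blast
  let ?k = "\<lambda>\<sigma>. f' (x + \<rho> *\<^sub>R u + \<sigma> *\<^sub>R v) u"
  have 2: "(?k has_real_derivative Du (x + \<rho> *\<^sub>R u + \<sigma> *\<^sub>R v) v) (at \<sigma>)" if "0 \<le> \<sigma>" "\<sigma> \<le> s" for \<sigma>
  proof -
    have in1: "x + \<rho> *\<^sub>R u + \<sigma> *\<^sub>R v \<in> S" using sub[of \<rho> \<sigma>] that \<rho> by simp
    have "(?k has_derivative (\<lambda>h. Du (x + \<rho> *\<^sub>R u + \<sigma> *\<^sub>R v) (h *\<^sub>R v))) (at \<sigma>)"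
      by (rule has_derivative_compose[OF line fu[OF in1]])
    moreover have "Du (x + \<rho> *\<^sub>R u + \<sigma> *\<^sub>R v) (h *\<^sub>R v) = Du (x + \<rho> *\<^sub>R u + \<sigma> *\<^sub>R v) v * h" for h
      using has_derivative_linear[OF fu[OF in1]] linear_scale by (metis mult.commute real_scaleR_def)
    ultimately show ?thesis by (simp add: has_field_derivative_def)
  qed
  obtain \<sigma> where \<sigma>: "0 < \<sigma>" "\<sigma> < s" "?k s - ?k 0 = (s - 0) * Du (x + \<rho> *\<^sub>R u + \<sigma> *\<^sub>R v) v"
    using MVT2[OF s 2] by blast
  show thesis
    by (rule that[of \<rho> \<sigma>]) (use \<rho> \<sigma> in \<open>simp_all add: algebra_simps\<close>)
qed

text \<open>Schwarz's theorem. The two mixed derivatives agree at some pair of points of a small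
  parallelogram, since both compute the same second difference; their continuity carries this to
  \<open>x\<close> up to \<open>e\<close>.\<close>

lemma symmetric_second_derivative:
  fixes f :: "'a::real_normed_vector \<Rightarrow> real"
  assumes S: "open S" "x \<in> S" and f: "\<And>y. y \<in> S \<Longrightarrow> (f has_derivative f' y) (at y)"
    and fu: "\<And>y. y \<in> S \<Longrightarrow> ((\<lambda>y. f' y u) has_derivative Du y) (at y)"
    and fv: "\<And>y. y \<in> S \<Longrightarrow> ((\<lambda>y. f' y v) has_derivative Dv y) (at y)"
    and cu: "continuous_on S (\<lambda>y. Du y v)" and cv: "continuous_on S (\<lambda>y. Dv y u)"
  shows "Du x v = Dv x u"
proof -
  have "\<bar>Du x v - Dv x u\<bar> \<le> e" if e: "e > 0" for e :: real
  proof -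
    have near: "\<forall>\<^sub>F y in nhds x. dist (g y) (g x) < e/2" if "continuous_on S g" for g :: "'a \<Rightarrow> real"
    proof -
      have "(g \<longlongrightarrow> g x) (nhds x)"
        using that S continuous_on_eq_continuous_at
        unfolding isCont_def tendsto_at_iff_tendsto_nhds by blast
      then show ?thesis by (rule tendstoD) (use e in simp)
    qed
    note near[OF cu] near[OF cv]
    moreover have "\<forall>\<^sub>F y in nhds x. y \<in> S" using S eventually_nhds by blast
    ultimately have "\<forall>\<^sub>F y in nhds x. y \<in> S \<and> dist (Du y v) (Du x v) < e/2 \<and> dist (Dv y u) (Dv x u) < e/2"
      by eventually_elim auto
    then obtain d where d: "d > 0" "\<And>y. dist y x < d \<Longrightarrow>
        y \<in> S \<and> dist (Du y v) (Du x v) < e/2 \<and> dist (Dv y u) (Dv x u) < e/2"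
      by (auto simp: eventually_nhds_metric)
    \<comment> \<open>Keeps the parallelogram spanned by \<open>s *\<^sub>R u\<close> and
      \<open>s *\<^sub>R v\<close> at \<open>x\<close> within distance \<open>d / 2\<close> of
      \<open>x\<close>; the summand 1 makes the denominator positive.\<close>
    define s where "s = d / (2 * (norm u + norm v + 1))"
    have s: "s > 0" using d by (simp add: s_def add_nonneg_pos)
    have near: "dist (x + \<rho> *\<^sub>R u + \<sigma> *\<^sub>R v) x < d" if "\<rho> \<in> {0..s}" "\<sigma> \<in> {0..s}" for \<rho> \<sigma>
    proof -
      have "norm (\<rho> *\<^sub>R u + \<sigma> *\<^sub>R v) \<le> s * norm u + s * norm v"
        by (rule norm_triangle_mono) (use that in \<open>auto intro: mult_right_mono\<close>)
      also have "\<dots> \<le> s * (norm u + norm v + 1)" using s by (simp add: algebra_simps)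
      also have "\<dots> = d / 2"
      proof -
        have c: "d / (2 * c) * c = d / 2" if "c > 0" for c :: real using that by simp
        show ?thesis unfolding s_def by (rule c) (simp add: add_nonneg_pos)
      qed
      also have "\<dots> < d" using d by simp
      finally show ?thesis by (simp add: dist_norm add.assoc)
    qed
    obtain \<rho> \<sigma> where 1: "\<rho> \<in> {0..s}" "\<sigma> \<in> {0..s}"
      "f (x + s *\<^sub>R u + s *\<^sub>R v) - f (x + s *\<^sub>R u) - f (x + s *\<^sub>R v) + f x = s * (s * Du (x + \<rho> *\<^sub>R u + \<sigma> *\<^sub>R v) v)"
      by (rule second_difference_mvt[where x=x and v=v and u=u, OF s _ f fu]) (use near d(2) in auto)
    have near': "x + \<rho> *\<^sub>R v + \<sigma> *\<^sub>R u \<in> S" if "\<rho> \<in> {0..s}" "\<sigma> \<in> {0..s}" for \<rho> \<sigma>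
    proof -
      have "x + \<rho> *\<^sub>R v + \<sigma> *\<^sub>R u = x + \<sigma> *\<^sub>R u + \<rho> *\<^sub>R v" by (simp add: algebra_simps)
      then show ?thesis using d(2)[OF near[OF that(2,1)]] by argo
    qed
    obtain \<rho>' \<sigma>' where 2: "\<rho>' \<in> {0..s}" "\<sigma>' \<in> {0..s}"
      "f (x + s *\<^sub>R v + s *\<^sub>R u) - f (x + s *\<^sub>R v) - f (x + s *\<^sub>R u) + f x = s * (s * Dv (x + \<rho>' *\<^sub>R v + \<sigma>' *\<^sub>R u) u)"
      by (rule second_difference_mvt[where x=x and v=u and u=v, OF s _ f fv]) (use near' in auto)
    have "s * (s * Du (x + \<rho> *\<^sub>R u + \<sigma> *\<^sub>R v) v) = s * (s * Dv (x + \<rho>' *\<^sub>R v + \<sigma>' *\<^sub>R u) u)"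
      using 1(3) 2(3) by (simp add: algebra_simps)
    then have "Du (x + \<rho> *\<^sub>R u + \<sigma> *\<^sub>R v) v = Dv (x + \<sigma>' *\<^sub>R u + \<rho>' *\<^sub>R v) u"
      using s by (simp add: algebra_simps)
    moreover have "dist (Du (x + \<rho> *\<^sub>R u + \<sigma> *\<^sub>R v) v) (Du x v) < e/2"
      "dist (Dv (x + \<sigma>' *\<^sub>R u + \<rho>' *\<^sub>R v) u) (Dv x u) < e/2"
      using d(2)[OF near[OF 1(1,2)]] d(2)[OF near[OF 2(2,1)]] by auto
    ultimately show ?thesis unfolding dist_real_def by linarith
  qed
  then have "\<bar>Du x v - Dv x u\<bar> \<le> 0" by (rule field_le_epsilon) simp
  then show ?thesis by simp
qed

text \<open>Reduced to components, because the mean value theorem concerns real-valued functions. It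
  serves the transformation law of the Christoffel symbols.\<close>

lemma smooth_second_derivative_symmetric:
  fixes f :: "'a::real_normed_vector \<Rightarrow> 'b::euclidean_space"
  assumes "open S" "x \<in> S" "smooth_on S f"
  shows "frechet_derivative (\<lambda>y. frechet_derivative f (at y) u) (at x) v =
         frechet_derivative (\<lambda>y. frechet_derivative f (at y) v) (at x) u"
proof (rule euclidean_eqI)
  fix b :: 'b
  let ?D = "\<lambda>u y. frechet_derivative (\<lambda>y. frechet_derivative f (at y) u) (at y)"
  have c: "continuous_on S (\<lambda>y. ?D u y v \<bullet> b)" for u v
    by (intro continuous_intros smooth_continuous smooth_derivative assms)
  show "?D u x v \<bullet> b = ?D v x u \<bullet> b"
    by (rule symmetric_second_derivative[OF assms(1,2), of "\<lambda>y. f y \<bullet> b" "\<lambda>y w. frechet_derivative f (at y) w \<bullet> b"])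
      (rule c has_derivative_inner_left[OF smooth_has_derivative[OF assms(3)]]
        has_derivative_inner_left[OF smooth_has_derivative[OF smooth_derivative[OF assms(3)]]]; assumption)+
qed

text \<open>The primitive is the integral of the form along the radius to \<open>y\<close>.
  Closedness turns the derivative of the integrand in direction \<open>v\<close> into a total
  derivative in \<open>t\<close>, whose integral from 0 to 1 is the value of the form at
  \<open>y\<close>.\<close>

lemma poincare_lemma_ball:
  fixes \<alpha> :: "'a::euclidean_space \<Rightarrow> 'a"
  assumes \<alpha>: "smooth_on (ball x0 r) \<alpha>"
    and closed: "\<And>y u v. y \<in> ball x0 r \<Longrightarrow>
      frechet_derivative \<alpha> (at y) u \<bullet> v = frechet_derivative \<alpha> (at y) v \<bullet> u"
  obtains f where "\<And>y. y \<in> ball x0 r \<Longrightarrow> (f has_derivative (\<lambda>v. \<alpha> y \<bullet> v)) (at y)"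
proof -
  let ?D = "\<lambda>y. frechet_derivative \<alpha> (at y)"
  let ?p = "\<lambda>y t. x0 + t *\<^sub>R (y - x0)"
  \<comment> \<open>The derivative of \<open>t *\<^sub>R \<alpha> (?p y t)\<close> in
    \<open>t\<close>, and by closedness also the gradient of the integrand in
    \<open>y\<close>.\<close>
  let ?w = "\<lambda>y t. t *\<^sub>R ?D (?p y t) (y - x0) + \<alpha> (?p y t)"
  have pin: "?p y t \<in> ball x0 r" if "y \<in> ball x0 r" "t \<in> cbox 0 1" for y and t :: real
  proof -
    have "norm (t *\<^sub>R (y - x0)) \<le> 1 * norm (y - x0)"
      unfolding norm_scaleR using that(2) by (intro mult_right_mono) auto
    then show ?thesis using that(1) by (simp add: dist_norm norm_minus_commute)
  qed
  \<comment> \<open>An open set containing the product of the ball with the closed unit interval,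
    since smooth maps are combined on open sets only.\<close>
  define S where "S = (\<lambda>(y, t). ?p y t) -` ball x0 r"
  have Sopen: "open S"
    unfolding S_def by (rule open_vimage[OF open_ball]) (auto simp: split_beta intro!: continuous_intros)
  have sfst: "smooth_on S (\<lambda>z. fst z - x0)" and ssnd: "smooth_on S (\<lambda>z::'a\<times>real. snd z)"
    using smooth_add[OF Sopen smooth_linear[OF bounded_linear_fst] smooth_const[of _ "- x0"]]
    by (auto intro: smooth_linear bounded_linear_snd)
  have sp: "smooth_on S (\<lambda>z. ?p (fst z) (snd z))"
    by (intro smooth_add[OF Sopen] smooth_const smooth_scaleR[OF Sopen] ssnd sfst)
  have pS: "(\<lambda>z. ?p (fst z) (snd z)) ` S \<subseteq> ball x0 r" by (auto simp: S_def)
  have "smooth_on S (\<lambda>z. ?w (fst z) (snd z))"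
    by (rule smooth_add[OF Sopen smooth_scaleR[OF Sopen ssnd smooth_derivative_along[OF Sopen \<alpha> sp sfst pS]]
          smooth_compose[OF Sopen \<alpha> sp pS]])
  then have wc: "continuous_on (ball x0 r \<times> cbox 0 1) (\<lambda>z. ?w (fst z) (snd z))"
    by (rule continuous_on_subset[OF smooth_continuous]) (use pin in \<open>auto simp: S_def\<close>)
  have ac: "continuous_on (cbox 0 1) (\<lambda>t. \<alpha> (?p y t))" if "y \<in> ball x0 r" for y
    by (rule continuous_on_compose2[OF smooth_continuous[OF \<alpha>]])
      (use pin[OF that] in \<open>auto intro!: continuous_intros\<close>)
  define f where "f y = integral (cbox 0 1) (\<lambda>t. \<alpha> (?p y t) \<bullet> (y - x0))" for y
  show thesis
  proof (rule that[of f])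
    fix y assume y: "y \<in> ball x0 r"
    have lD: "linear (?D z)" if "z \<in> ball x0 r" for z
      using has_derivative_linear[OF smooth_has_derivative[OF \<alpha> that]] .
    have "(f has_derivative integral (cbox 0 1) (\<lambda>t. blinfun_inner_right (?w y t))) (at y within ball x0 r)"
      unfolding f_def
    proof (rule leibniz_rule[OF _ _ _ y convex_ball])
      fix z :: 'a and t :: real assume z: "z \<in> ball x0 r" and t: "t \<in> cbox 0 1"
      have "((\<lambda>y. ?p y t) has_derivative (\<lambda>v. t *\<^sub>R v)) (at z)"
        by (auto intro!: derivative_eq_intros)
      from has_derivative_compose[OF this smooth_has_derivative[OF \<alpha> pin[OF z t]]]
      have "((\<lambda>y. \<alpha> (?p y t) \<bullet> (y - x0)) has_derivative
          (\<lambda>v. \<alpha> (?p z t) \<bullet> v + ?D (?p z t) (t *\<^sub>R v) \<bullet> (z - x0))) (at z)"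
        by (auto intro!: derivative_eq_intros)
      moreover have "?D (?p z t) (t *\<^sub>R v) \<bullet> (z - x0) = t * (?D (?p z t) (z - x0) \<bullet> v)" for v
        using closed[OF pin[OF z t], of v] by (simp add: linear_scale[OF lD[OF pin[OF z t]]])
      then have "(\<lambda>v. \<alpha> (?p z t) \<bullet> v + ?D (?p z t) (t *\<^sub>R v) \<bullet> (z - x0))
          = blinfun_apply (blinfun_inner_right (?w z t))"
        by (simp add: fun_eq_iff inner_add_left)
      ultimately show "((\<lambda>y. \<alpha> (?p y t) \<bullet> (y - x0)) has_derivative
          blinfun_apply (blinfun_inner_right (?w z t))) (at z within ball x0 r)"
        by (simp add: has_derivative_at_withinI)
    next
      fix z :: 'a assume "z \<in> ball x0 r"
      then show "(\<lambda>t. \<alpha> (?p z t) \<bullet> (z - x0)) integrable_on cbox 0 1"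
        by (intro integrable_continuous continuous_intros ac)
    next
      show "continuous_on (ball x0 r \<times> cbox 0 1) (\<lambda>(y, t). blinfun_inner_right (?w y t))"
        using bounded_linear.continuous_on[OF bounded_linear_blinfun_inner_right wc]
        by (simp add: split_beta)
    qed
    then have 1: "(f has_derivative integral (cbox 0 1) (\<lambda>t. blinfun_inner_right (?w y t))) (at y)"
      using at_within_open[OF y open_ball] by simp
    have "continuous_on (cbox 0 1) (Pair y)" "Pair y ` cbox 0 1 \<subseteq> ball x0 r \<times> cbox (0::real) 1"
      using y by (auto intro!: continuous_intros)
    from continuous_on_compose2[OF wc this] have wy: "continuous_on (cbox 0 1) (?w y)" by simp
    have "blinfun_apply (integral (cbox 0 1) (\<lambda>t. blinfun_inner_right (?w y t))) v = \<alpha> y \<bullet> v" for v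
    proof -
      have "blinfun_apply (integral (cbox 0 1) (\<lambda>t. blinfun_inner_right (?w y t))) v
          = integral (cbox 0 1) (\<lambda>t. ?w y t \<bullet> v)"
        using blinfun_apply_integral[OF integrable_continuous[OF
            bounded_linear.continuous_on[OF bounded_linear_blinfun_inner_right wy]], of v] by simp
      moreover have "((\<lambda>t. ?w y t \<bullet> v) has_integral (1 *\<^sub>R \<alpha> (?p y 1)) \<bullet> v - (0 *\<^sub>R \<alpha> (?p y 0)) \<bullet> v) {0..1}"
      proof (rule fundamental_theorem_of_calculus)
        fix t :: real assume "t \<in> {0..1}"
        then have t: "t \<in> cbox 0 1" by simp
        have "((\<lambda>t. ?p y t) has_derivative (\<lambda>h. h *\<^sub>R (y - x0))) (at t)"
          by (auto intro!: derivative_eq_intros)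
        from has_derivative_compose[OF this smooth_has_derivative[OF \<alpha> pin[OF y t]]]
        have "((\<lambda>t. \<alpha> (?p y t)) has_vector_derivative ?D (?p y t) (y - x0)) (at t)"
          by (simp add: has_vector_derivative_def linear_scale[OF lD[OF pin[OF y t]]])
        then have "((\<lambda>t. t *\<^sub>R \<alpha> (?p y t)) has_vector_derivative ?w y t) (at t)"
          by (auto intro!: derivative_eq_intros)
        then have "((\<lambda>t. (t *\<^sub>R \<alpha> (?p y t)) \<bullet> v) has_vector_derivative ?w y t \<bullet> v) (at t)"
          by (rule bounded_linear.has_vector_derivative[OF bounded_linear_inner_left])
        then show "((\<lambda>t. (t *\<^sub>R \<alpha> (?p y t)) \<bullet> v) has_vector_derivative ?w y t \<bullet> v) (at t within {0..1})"
          by (rule has_vector_derivative_at_within)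
      qed simp
      ultimately show ?thesis by (auto dest: integral_unique)
    qed
    then show "(f has_derivative (\<lambda>v. \<alpha> y \<bullet> v)) (at y)" using 1 by presburger
  qed
qed

section \<open>Existence of geodesics\<close>

lemma smooth_Pair:
  "open S \<Longrightarrow> smooth_on S f \<Longrightarrow> smooth_on S g \<Longrightarrow> smooth_on S (\<lambda>x. (f x, g x))"
  by (rule smooth_onI, rule higher_differentiable_Pair) (auto intro: smooth_onD)

lemma bounded_linear_matrix_vector_left:
  "bounded_linear (\<lambda>M::real^'n::finite^'m::finite. M *v v)"
  using bounded_bilinear.bounded_linear_left[OF bounded_bilinear_matrix_vector] .

text \<open>For a transition map \<open>f\<close>, a curve \<open>g\<close> in coordinates and its
  velocity \<open>w\<close>, this differentiates the velocity as seen in the other chart. The second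
  derivative of \<open>f\<close> is the term that the Christoffel symbols have to absorb.\<close>

lemma frechet_derivative_along_has_vector_derivative:
  fixes f :: "'a::euclidean_space \<Rightarrow> 'b::real_normed_vector"
  assumes S: "open S" and f: "smooth_on S f" and T: "open T" "t \<in> T" "\<And>s. s \<in> T \<Longrightarrow> g s \<in> S"
    and g: "(g has_vector_derivative g') (at t)" and w: "(w has_vector_derivative w') (at t)"
  shows "((\<lambda>s. frechet_derivative f (at (g s)) (w s)) has_vector_derivative
      frechet_derivative f (at (g t)) w' +
      frechet_derivative (\<lambda>y. frechet_derivative f (at y) (w t)) (at (g t)) g') (at t)"
proof -
  let ?D = "\<lambda>y. frechet_derivative f (at y)"
  let ?D2 = "\<lambda>a. frechet_derivative (\<lambda>y. frechet_derivative f (at y) a) (at (g t))"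
  have exp: "?D y a = (\<Sum>b\<in>Basis. (a \<bullet> b) *\<^sub>R ?D y b)" if "y \<in> S" for y a
  proof -
    have l: "linear (?D y)" using has_derivative_linear[OF smooth_has_derivative[OF f that]] .
    have "?D y a = ?D y (\<Sum>b\<in>Basis. (a \<bullet> b) *\<^sub>R b)" by (simp add: euclidean_representation)
    then show ?thesis by (simp add: linear_sum[OF l] linear_scale[OF l])
  qed
  have Db: "((\<lambda>y. ?D y b) has_derivative ?D2 b) (at (g t))" for b
    by (rule smooth_has_derivative[OF smooth_derivative[OF f] T(3)[OF T(2)]])
  have l2: "linear (?D2 b)" for b using has_derivative_linear[OF Db] .
  have gD: "((\<lambda>s. ?D (g s) b) has_vector_derivative ?D2 b g') (at t)" for b
    using has_derivative_compose[OF g[unfolded has_vector_derivative_def] Db]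
    by (simp add: has_vector_derivative_def linear_scale[OF l2])
  have wb: "((\<lambda>s. w s \<bullet> b) has_vector_derivative w' \<bullet> b) (at t)" for b
    by (rule bounded_linear.has_vector_derivative[OF bounded_linear_inner_left w])
  have "((\<lambda>s. \<Sum>b\<in>Basis. (w s \<bullet> b) *\<^sub>R ?D (g s) b) has_vector_derivative
      (\<Sum>b\<in>Basis. (w t \<bullet> b) *\<^sub>R ?D2 b g' + (w' \<bullet> b) *\<^sub>R ?D (g t) b)) (at t)"
    using wb by (intro has_vector_derivative_sum has_vector_derivative_scaleR gD)
      (simp add: has_real_derivative_iff_has_vector_derivative)
  moreover have "(\<Sum>b\<in>Basis. (w t \<bullet> b) *\<^sub>R ?D2 b g' + (w' \<bullet> b) *\<^sub>R ?D (g t) b) = ?D (g t) w' + ?D2 (w t) g'"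
  proof -
    have "((\<lambda>y. \<Sum>b\<in>Basis. (w t \<bullet> b) *\<^sub>R ?D y b) has_derivative
        (\<lambda>v. \<Sum>b\<in>Basis. (w t \<bullet> b) *\<^sub>R ?D2 b v)) (at (g t))"
      by (intro has_derivative_sum has_derivative_scaleR_right Db)
    then have "((\<lambda>y. ?D y (w t)) has_derivative
        (\<lambda>v. \<Sum>b\<in>Basis. (w t \<bullet> b) *\<^sub>R ?D2 b v)) (at (g t))"
      by (rule has_derivative_transform_within_open[OF _ S T(3)[OF T(2)]]) (metis exp)
    from frechet_derivative_at[OF this] show ?thesis
      by (simp add: sum.distrib exp[OF T(3)[OF T(2)], of w'] add.commute fun_eq_iff)
  qed
  ultimately have "((\<lambda>s. \<Sum>b\<in>Basis. (w s \<bullet> b) *\<^sub>R ?D (g s) b) has_vector_derivative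
      ?D (g t) w' + ?D2 (w t) g') (at t)" by simp
  then show ?thesis
    by (rule has_vector_derivative_transform_within_open[OF _ T(1,2)]) (metis exp T(3))
qed


section \<open>The Levi-Civita connection in coordinates and its transformation law\<close>

lemma riem_inner_commute:
  assumes "transpose g = g" shows "riem_inner g a b = riem_inner g b a"
  unfolding riem_inner_def using assms by (metis dot_lmul_matrix inner_commute transpose_matrix_vector)

lemma riem_inner_linear:
  "riem_inner g (a + b) c = riem_inner g a c + riem_inner g b c"
  "riem_inner g (a - b) c = riem_inner g a c - riem_inner g b c"
  "riem_inner g a (b + c) = riem_inner g a b + riem_inner g a c"
  "riem_inner g a (b - c) = riem_inner g a b - riem_inner g a c"
  "riem_inner g (r *\<^sub>R a) b = r * riem_inner g a b"
  "riem_inner g a (r *\<^sub>R b) = r * riem_inner g a b"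
  "riem_inner g 0 a = 0" "riem_inner g a 0 = 0"
  by (simp_all add: riem_inner_def inner_add_left inner_diff_left matrix_vector_right_distrib
      matrix_vector_mult_diff_distrib inner_add_right inner_diff_right matrix_vector_mult_scaleR)

lemma invertible_if_positive:
  fixes g :: "real^3^3"
  assumes "\<And>v. v \<noteq> 0 \<Longrightarrow> v \<bullet> (g *v v) > 0"
  shows "invertible g"
proof -
  have "\<forall>x. g *v x = 0 \<longrightarrow> x = 0" using assms by fastforce
  then show ?thesis by (simp add: invertible_left_inverse matrix_left_invertible_ker)
qed

text \<open>The Koszul formula in coordinates: pairing with \<open>b\<close> cancels the inverse
  metric, so that only derivatives of the metric are left to compare.\<close>

lemma riem_inner_christoffel:
  assumes D: "linear (frechet_derivative g (at x))" and inv: "invertible (g x)"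
  shows "riem_inner (g x) b (christoffel g x a c) =
    (b \<bullet> (frechet_derivative g (at x) a *v c) + b \<bullet> (frechet_derivative g (at x) c *v a)
      - a \<bullet> (frechet_derivative g (at x) b *v c)) / 2"
proof -
  let ?D = "frechet_derivative g (at x)"
  have l: "linear (\<lambda>b. a \<bullet> (?D b *v c))"
    by (intro linearI)
      (simp_all add: linear_add[OF D] linear_scale[OF D] matrix_vector_mult_add_rdistrib
        inner_add_right scaleR_matrix_vector_assoc[symmetric])
  have "a \<bullet> (?D b *v c) = (\<lambda>b. a \<bullet> (?D b *v c)) (\<Sum>l\<in>UNIV. b $ l *\<^sub>R axis l 1)"
    using basis_expansion[of b] by (simp add: scalar_mult_eq_scaleR)
  also have "\<dots> = (\<Sum>l\<in>UNIV. b $ l * (a \<bullet> (?D (axis l 1) *v c)))"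
    by (simp only: linear_sum[OF l] linear_scale[OF l] real_scaleR_def)
  finally have "a \<bullet> (?D b *v c) = (\<Sum>l\<in>UNIV. b $ l * (a \<bullet> (?D (axis l 1) *v c)))" .
  then have "b \<bullet> (\<chi> l. a \<bullet> (?D (axis l 1) *v c)) = a \<bullet> (?D b *v c)"
    by (simp add: inner_vec_def)
  moreover have "g x *v (matrix_inv (g x) *v z) = z" for z
    using matrix_mul_matrix_inv[OF inv] by (simp add: matrix_vector_mul_assoc)
  ultimately show ?thesis
    unfolding riem_inner_def christoffel_def
    by (simp only: inner_scaleR_right inner_add_right inner_diff_right)
qed

text \<open>The derivative of the metric along the curve is split between the two factors by
  \<open>christoffel_metric\<close>, completing each ordinary derivative to a covariant one.\<close>

lemma riem_inner_along_curve:
  assumes U: "open U" "x t \<in> U" and sym: "\<And>y. y \<in> U \<Longrightarrow> transpose (g y) = g y"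
    and g: "g differentiable (at (x t))" "invertible (g (x t))"
    and x: "(x has_vector_derivative x') (at t)"
    and Y: "(Y has_vector_derivative Y') (at t)" and Z: "(Z has_vector_derivative Z') (at t)"
  shows "((\<lambda>s. riem_inner (g (x s)) (Y s) (Z s)) has_real_derivative
    riem_inner (g (x t)) (Y' + christoffel g (x t) x' (Y t)) (Z t) +
    riem_inner (g (x t)) (Y t) (Z' + christoffel g (x t) x' (Z t))) (at t)"
proof -
  let ?D = "frechet_derivative g (at (x t))"
  have D: "(g has_derivative ?D) (at (x t))" using g(1) frechet_derivative_works by blast
  have "((\<lambda>s. g (x s)) has_vector_derivative ?D x') (at t)"
    using has_derivative_compose[OF x[unfolded has_vector_derivative_def] D]
    by (simp add: has_vector_derivative_def linear_scale[OF has_derivative_linear[OF D]])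
  from bounded_bilinear.has_vector_derivative[OF bounded_bilinear_matrix_vector this Z]
  have "((\<lambda>s. g (x s) *v Z s) has_vector_derivative (g (x t) *v Z' + ?D x' *v Z t)) (at t)" .
  from bounded_bilinear.has_vector_derivative[OF bounded_bilinear_inner Y this]
  have "((\<lambda>s. Y s \<bullet> (g (x s) *v Z s)) has_vector_derivative
      Y t \<bullet> (g (x t) *v Z' + ?D x' *v Z t) + Y' \<bullet> (g (x t) *v Z t)) (at t)" .
  moreover have "Y t \<bullet> (?D x' *v Z t) = riem_inner (g (x t)) (christoffel g (x t) x' (Y t)) (Z t) +
      riem_inner (g (x t)) (Y t) (christoffel g (x t) x' (Z t))"
    by (rule christoffel_metric[OF U sym g])
  ultimately show ?thesis
    unfolding riem_inner_def has_real_derivative_iff_has_vector_derivative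
    by (simp add: inner_add_right inner_add_left matrix_vector_right_distrib algebra_simps)
qed

text \<open>Both sides are tested against the vectors \<open>J x w\<close>. Differentiating
  \<open>iso\<close> expresses the derivative of \<open>g\<close> through that of \<open>h\<close>
  and second derivatives of \<phi>; in the Koszul formulas all second derivatives except the one
  taken twice along \<open>u\<close> then cancel by symmetry. Equal arguments suffice, as the
  geodesic equation contains no others.\<close>

lemma christoffel_pullback:
  fixes \<phi> :: "real^3 \<Rightarrow> real^3"
  defines "J \<equiv> \<lambda>x. frechet_derivative \<phi> (at x)"
  assumes S: "open S" "x \<in> S" and \<phi>: "smooth_on S \<phi>" and V: "\<phi> x \<in> V" "smooth_on V h"
    and g: "g differentiable (at x)"
    and iso: "\<And>y a b. y \<in> S \<Longrightarrow> riem_inner (g y) a b = riem_inner (h (\<phi> y)) (J y a) (J y b)"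
    and sym: "transpose (h (\<phi> x)) = h (\<phi> x)"
    and inv: "invertible (g x)" "invertible (h (\<phi> x))" and surj: "surj (J x)"
  shows "christoffel h (\<phi> x) (J x u) (J x u) =
    J x (christoffel g x u u) - frechet_derivative (\<lambda>y. J y u) (at x) u"
proof -
  let ?Dg = "frechet_derivative g (at x)" and ?Dh = "frechet_derivative h (at (\<phi> x))"
  let ?D2 = "\<lambda>a. frechet_derivative (\<lambda>y. J y a) (at x)"
  let ?H = "riem_inner (h (\<phi> x))"
  have Dg: "(g has_derivative ?Dg) (at x)" using g frechet_derivative_works by blast
  have DJ: "(\<phi> has_derivative J x) (at x)" unfolding J_def by (rule smooth_has_derivative[OF \<phi> S(2)])
  have Dh: "(h has_derivative ?Dh) (at (\<phi> x))" by (rule smooth_has_derivative[OF V(2,1)])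
  have D2: "((\<lambda>y. J y a) has_derivative ?D2 a) (at x)" for a
    unfolding J_def by (rule smooth_has_derivative[OF smooth_derivative[OF \<phi>] S(2)])
  have D2sym: "?D2 a b = ?D2 b a" for a b
    unfolding J_def by (rule smooth_second_derivative_symmetric[OF S \<phi>])
  have key: "a \<bullet> (?Dg e *v b) = J x a \<bullet> (?Dh (J x e) *v J x b) + ?H (?D2 a e) (J x b) + ?H (J x a) (?D2 b e)"
    for a b e
  proof -
    have "((\<lambda>y. riem_inner (g y) a b) has_derivative (\<lambda>e. a \<bullet> (?Dg e *v b))) (at x)"
      unfolding riem_inner_def
      by (intro has_derivative_inner_right bounded_linear.has_derivative[OF bounded_linear_matrix_vector_left] Dg)
    then have "((\<lambda>y. riem_inner (h (\<phi> y)) (J y a) (J y b)) has_derivative (\<lambda>e. a \<bullet> (?Dg e *v b))) (at x)"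
      by (rule has_derivative_transform_within_open[OF _ S]) (rule iso)
    moreover have "((\<lambda>y. J y a \<bullet> (h (\<phi> y) *v J y b)) has_derivative
        (\<lambda>e. J x a \<bullet> (h (\<phi> x) *v ?D2 b e + ?Dh (J x e) *v J x b) + ?D2 a e \<bullet> (h (\<phi> x) *v J x b))) (at x)"
      by (intro bounded_bilinear.FDERIV[OF bounded_bilinear_inner]
          bounded_bilinear.FDERIV[OF bounded_bilinear_matrix_vector] D2 has_derivative_compose[OF DJ Dh])
    ultimately have "(\<lambda>e. a \<bullet> (?Dg e *v b)) =
        (\<lambda>e. J x a \<bullet> (h (\<phi> x) *v ?D2 b e + ?Dh (J x e) *v J x b) + ?D2 a e \<bullet> (h (\<phi> x) *v J x b))"
      unfolding riem_inner_def by (rule has_derivative_unique)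
    from fun_cong[OF this, of e] show ?thesis
      by (simp add: riem_inner_def inner_add_right)
  qed
  let ?r = "christoffel h (\<phi> x) (J x u) (J x u) - (J x (christoffel g x u u) - ?D2 u u)"
  have "?H z ?r = 0" for z
  proof -
    obtain w where z: "z = J x w" using surj by (meson surjD)
    have "?H z (christoffel h (\<phi> x) (J x u) (J x u)) =
        J x w \<bullet> (?Dh (J x u) *v J x u) - (J x u \<bullet> (?Dh (J x w) *v J x u)) / 2"
      unfolding z riem_inner_christoffel[of h "\<phi> x", OF has_derivative_linear[OF Dh] inv(2)] by argo
    moreover have "?H z (J x (christoffel g x u u)) = w \<bullet> (?Dg u *v u) - (u \<bullet> (?Dg w *v u)) / 2"
      unfolding z iso[OF S(2), symmetric] riem_inner_christoffel[OF has_derivative_linear[OF Dg] inv(1)] by argo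
    moreover have "?H (J x u) (?D2 w u) = ?H (?D2 w u) (J x u)" by (rule riem_inner_commute[OF sym])
    \<comment> \<open>\<open>P\<close> and \<open>Q\<close> stand for the derivatives of
      \<open>h\<close>, \<open>E\<close> for the second derivative of \<phi> twice along
      \<open>u\<close>, \<open>X\<close> and \<open>X'\<close> for the mixed ones, equal because
      \<open>h (\<phi> x)\<close> is symmetric.\<close>
    moreover have "A - (A' - E) = 0" if "A = P - Q / 2" "A' = P + X' + E - (Q + X' + X) / 2" "X = X'"
      for A A' P Q E X X' :: real using that by (simp add: field_simps)
    ultimately show ?thesis
      unfolding riem_inner_linear key z D2sym[of u w] by blast
  qed
  then have "z \<bullet> (h (\<phi> x) *v ?r) = 0" for z unfolding riem_inner_def .
  from this[of "h (\<phi> x) *v ?r"] have "h (\<phi> x) *v ?r = 0" by simp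
  then have "?r = 0"
    using inv(2) matrix_left_invertible_ker invertible_left_inverse by blast
  then show ?thesis by simp
qed

section \<open>Charts, transition maps and geodesics\<close>

lemma oriented_atlas_chart:
  assumes "oriented_atlas A" "c \<in> A"
  shows "open (cdom c)" "open (cimg c)" "continuous_on (cdom c) (coord c)"
    "continuous_on (cimg c) (inv_into (cdom c) (coord c))"
    "\<And>p. p \<in> cdom c \<Longrightarrow> inv_into (cdom c) (coord c) (coord c p) = p"
proof -
  have "is_chart c" using assms by (simp add: oriented_atlas_def)
  then show "open (cdom c)" "open (cimg c)" "continuous_on (cdom c) (coord c)"
    "continuous_on (cimg c) (inv_into (cdom c) (coord c))"
    "\<And>p. p \<in> cdom c \<Longrightarrow> inv_into (cdom c) (coord c) (coord c p) = p"
    by (simp_all add: is_chart_def homeomorphism_def)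
qed

lemma smooth_transition:
  "oriented_atlas A \<Longrightarrow> c \<in> A \<Longrightarrow> d \<in> A \<Longrightarrow> smooth_on (overlap c d) (transition c d)"
  by (simp add: oriented_atlas_def)

lemma open_overlap:
  assumes "oriented_atlas A" "c \<in> A" "d \<in> A"
  shows "open (overlap c d)"
proof -
  note c = oriented_atlas_chart[OF assms(1,2)]
  have "overlap c d = cimg c \<inter> inv_into (cdom c) (coord c) -` cdom d"
    using c(5) by (fastforce simp: overlap_def inv_into_into)
  then show ?thesis
    using continuous_open_preimage[OF c(4) c(2) oriented_atlas_chart(1)[OF assms(1,3)]] by simp
qed

lemma transition_coord:
  assumes "oriented_atlas A" "c \<in> A" "p \<in> cdom c"
  shows "transition c d (coord c p) = coord d p"
  by (simp add: transition_def oriented_atlas_chart(5)[OF assms])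

lemma jacobian_mult:
  assumes "oriented_atlas A" "c \<in> A" "d \<in> A" "x \<in> overlap c d"
  shows "jacobian c d x *v v = frechet_derivative (transition c d) (at x) v"
proof -
  have "(transition c d has_derivative frechet_derivative (transition c d) (at x)) (at x)"
    by (rule smooth_has_derivative[OF smooth_transition[OF assms(1-3)] assms(4)])
  from fun_cong[OF matrix_vector_mul(2)[OF has_derivative_linear[OF this]]] show ?thesis
    unfolding jacobian_def .
qed

lemma metric_at:
  assumes "riemannian_metric A G" "c \<in> A" "x \<in> cimg c"
  shows "transpose (G c x) = G c x" "invertible (G c x)" "\<And>v. v \<noteq> 0 \<Longrightarrow> riem_inner (G c x) v v > 0"
    "G c differentiable (at x)"
proof -
  have *: "smooth_on (cimg c) (G c)" "transpose (G c x) = G c x"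
    "\<And>v. v \<noteq> 0 \<Longrightarrow> v \<bullet> (G c x *v v) > 0"
    using assms unfolding riemannian_metric_def by blast+
  show "transpose (G c x) = G c x" "invertible (G c x)" "\<And>v. v \<noteq> 0 \<Longrightarrow> riem_inner (G c x) v v > 0"
    using * invertible_if_positive by (simp_all add: riem_inner_def)
  show "G c differentiable (at x)"
    using smooth_has_derivative[OF *(1) assms(3)] by (rule differentiableI)
qed

lemma riem_inner_jacobian:
  assumes "riemannian_metric A G" "c \<in> A" "d \<in> A" "x \<in> overlap c d"
  shows "riem_inner (G c x) a b =
    riem_inner (G d (transition c d x)) (jacobian c d x *v a) (jacobian c d x *v b)"
proof -
  have "G c x = transpose (jacobian c d x) ** G d (transition c d x) ** jacobian c d x"
    using assms by (simp add: riemannian_metric_def)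
  then have "riem_inner (G c x) a b =
      a \<bullet> (transpose (jacobian c d x) *v (G d (transition c d x) *v (jacobian c d x *v b)))"
    by (simp add: riem_inner_def matrix_vector_mul_assoc matrix_mul_assoc)
  also have "\<dots> = (jacobian c d x *v a) \<bullet> (G d (transition c d x) *v (jacobian c d x *v b))"
    by (simp only: dot_lmul_matrix[symmetric] transpose_matrix_vector[symmetric] transpose_transpose)
  finally show ?thesis by (simp add: riem_inner_def)
qed

text \<open>The second order equation becomes an autonomous first order system for position and
  velocity, the velocity ranging over the whole space.\<close>

lemma local_geodesic_in_chart:
  fixes \<Gamma> :: "'a::euclidean_space \<Rightarrow> 'a \<Rightarrow> 'a"
  assumes U: "open U" "x0 \<in> U" and \<Gamma>: "smooth_on (U \<times> UNIV) (\<lambda>z. \<Gamma> (fst z) (snd z))"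
  obtains e x v where "e > 0" "x 0 = x0" "v 0 = v0" "smooth_on {-e<..<e} x"
    "\<And>t. t \<in> {-e<..<e} \<Longrightarrow> x t \<in> U \<and> (x has_vector_derivative v t) (at t) \<and>
      (v has_vector_derivative - \<Gamma> (x t) (v t)) (at t)"
proof -
  let ?F = "\<lambda>z. (snd z, - \<Gamma> (fst z) (snd z))"
  have W: "open (U \<times> (UNIV :: 'a set))" by (intro open_Times U open_UNIV)
  have "smooth_on (U \<times> UNIV) (\<lambda>z. - \<Gamma> (fst z) (snd z))"
    using smooth_compose_linear[OF W bounded_linear_minus[OF bounded_linear_ident] \<Gamma>] .
  then have F: "smooth_on (U \<times> UNIV) ?F"
    by (rule smooth_Pair[OF W smooth_linear[OF bounded_linear_snd]])
  obtain e y where e: "e > 0" "y 0 = (x0, v0)"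
    "\<And>t. t \<in> {-e<..<e} \<Longrightarrow> y t \<in> U \<times> UNIV \<and> (y has_vector_derivative ?F (y t)) (at t)"
    using picard_lindelof[OF W _ smooth_onD[OF F], of "(x0, v0)"] U(2) by auto
  show thesis
  proof (rule that[of e "\<lambda>t. fst (y t)" "\<lambda>t. snd (y t)"])
    show "smooth_on {-e<..<e} (\<lambda>t. fst (y t))"
      by (rule smooth_compose_linear[OF open_greaterThanLessThan bounded_linear_fst
            smooth_ode_solution[OF open_greaterThanLessThan F e(3)]])
    fix t assume "t \<in> {-e<..<e}"
    then show "fst (y t) \<in> U \<and> ((\<lambda>t. fst (y t)) has_vector_derivative snd (y t)) (at t) \<and>
      ((\<lambda>t. snd (y t)) has_vector_derivative - \<Gamma> (fst (y t)) (snd (y t))) (at t)"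
      using e(3)[of t] bounded_linear.has_vector_derivative[OF bounded_linear_fst, of y "?F (y t)"]
        bounded_linear.has_vector_derivative[OF bounded_linear_snd, of y "?F (y t)"]
      by (auto simp: mem_Times_iff)
  qed (use e in auto)
qed

text \<open>The equation is solved in the chart \<open>c\<close> alone, but \<open>geodesic\<close>
  demands it in every chart that the curve meets. There the derivative of the velocity contains a
  second derivative of the transition map, exactly the correction in
  \<open>christoffel_pullback\<close>. The last conclusion keeps the acceleration in
  \<open>c\<close> at hand for differentiating along the curve.\<close>

lemma geodesic_exists:
  assumes A: "oriented_atlas A" and G: "riemannian_metric A G" and c: "c \<in> A" "x0 \<in> cimg c"
    and unit: "riem_inner (G c x0) v0 v0 = 1"
    and \<Gamma>: "smooth_on (cimg c \<times> UNIV) (\<lambda>z. christoffel (G c) (fst z) (snd z) (snd z))"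
  obtains e \<gamma> where "e > 0" "geodesic A G {-e<..<e} \<gamma>" "coord c (\<gamma> 0) = x0" "velocity \<gamma> c 0 = v0"
    "\<And>t. t \<in> {-e<..<e} \<Longrightarrow> \<gamma> t \<in> cdom c"
    "\<And>t. t \<in> {-e<..<e} \<Longrightarrow> (velocity \<gamma> c has_vector_derivative
        - christoffel (G c) (coord c (\<gamma> t)) (velocity \<gamma> c t) (velocity \<gamma> c t)) (at t)"
proof -
  note atlas = oriented_atlas_chart[OF A c(1)]
  obtain e x v where e: "e > 0" and x0: "x 0 = x0" "v 0 = v0" and xs: "smooth_on {-e<..<e} x"
    and xv: "\<And>t. t \<in> {-e<..<e} \<Longrightarrow> x t \<in> cimg c \<and> (x has_vector_derivative v t) (at t) \<and>
      (v has_vector_derivative - christoffel (G c) (x t) (v t) (v t)) (at t)"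
    by (rule local_geodesic_in_chart[OF atlas(2) c(2) \<Gamma>, of v0]) (rule that)
  define I where "I = {-e<..<e}"
  have I: "open I" "convex I" "is_interval I" "0 \<in> I" using e by (auto simp: I_def is_interval_convex_1)
  define \<gamma> where "\<gamma> t = inv_into (cdom c) (coord c) (x t)" for t
  have xI: "x t \<in> cimg c" "(x has_vector_derivative v t) (at t)"
    "(v has_vector_derivative - christoffel (G c) (x t) (v t) (v t)) (at t)" if "t \<in> I" for t
    using xv[of t] that by (auto simp: I_def)
  have \<gamma>: "\<gamma> t \<in> cdom c" "coord c (\<gamma> t) = x t" if "t \<in> I" for t
    using xI(1)[OF that] by (auto simp: \<gamma>_def inv_into_into f_inv_into_f)
  have \<gamma>_cont: "continuous_on I \<gamma>"
    unfolding \<gamma>_def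
    by (rule continuous_on_compose2[OF atlas(4) smooth_continuous[OF xs[folded I_def]]]) (use xI(1) in auto)
  \<comment> \<open>The covariant acceleration vanishes, so by metric compatibility the initial unit
    speed persists.\<close>
  have speed: "riem_inner (G c (x t)) (v t) (v t) = 1" if t: "t \<in> I" for t
  proof -
    have zero: "((\<lambda>s. riem_inner (G c (x s)) (v s) (v s)) has_vector_derivative 0) (at s within I)"
      if s: "s \<in> I" for s
    proof -
      note g = metric_at[OF G c(1) xI(1)[OF s]]
      have "((\<lambda>s. riem_inner (G c (x s)) (v s) (v s)) has_real_derivative 0) (at s)"
        using riem_inner_along_curve[OF atlas(2) xI(1)[OF s] metric_at(1)[OF G c(1)] g(4,2) xI(2)[OF s]
            xI(3)[OF s] xI(3)[OF s]] by (simp add: riem_inner_linear)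
      then show ?thesis
        by (simp add: has_real_derivative_iff_has_vector_derivative has_vector_derivative_at_within)
    qed
    obtain k where "\<And>s. s \<in> I \<Longrightarrow> riem_inner (G c (x s)) (v s) (v s) = k"
      by (rule has_vector_derivative_zero_constant[OF I(2) zero]) (assumption, rule that)
    from this[OF t] this[OF I(4)] show ?thesis using unit x0 by simp
  qed
  \<comment> \<open>The curve in another chart \<open>d\<close>, at the times when it lies in the
    domain of \<open>d\<close>.\<close>
  have vel: "velocity \<gamma> d t = frechet_derivative (transition c d) (at (x t)) (v t)"
    and vel_deriv: "(velocity \<gamma> d has_vector_derivative
      frechet_derivative (transition c d) (at (x t)) (- christoffel (G c) (x t) (v t) (v t)) +
      frechet_derivative (\<lambda>y. frechet_derivative (transition c d) (at y) (v t)) (at (x t)) (v t)) (at t)"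
    and over: "x t \<in> overlap c d" "coord d (\<gamma> t) = transition c d (x t)"
    and smooth: "smooth_on {t \<in> I. \<gamma> t \<in> cdom d} (\<lambda>t. coord d (\<gamma> t))"
    if d: "d \<in> A" and t: "t \<in> I" "\<gamma> t \<in> cdom d" for d t
  proof -
    define T where "T = {t \<in> I. \<gamma> t \<in> cdom d}"
    have T: "open T" "t \<in> T"
      using continuous_open_preimage[OF \<gamma>_cont I(1) oriented_atlas_chart(1)[OF A d]] t
      by (auto simp: T_def vimage_def Int_def)
    have xT: "x s \<in> overlap c d" "transition c d (x s) = coord d (\<gamma> s)" if "s \<in> T" for s
    proof -
      have s: "s \<in> I" "\<gamma> s \<in> cdom d" using that by (auto simp: T_def)
      show "x s \<in> overlap c d"
        unfolding overlap_def \<gamma>(2)[OF s(1), symmetric] using \<gamma>(1)[OF s(1)] s(2) by blast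
      show "transition c d (x s) = coord d (\<gamma> s)"
        unfolding \<gamma>(2)[OF s(1), symmetric] by (rule transition_coord[OF A c(1) \<gamma>(1)[OF s(1)]])
    qed
    note \<phi> = smooth_transition[OF A c(1) d]
    have velT: "velocity \<gamma> d s = frechet_derivative (transition c d) (at (x s)) (v s)" if s: "s \<in> T" for s
    proof -
      have sI: "s \<in> I" using s by (simp add: T_def)
      have D: "(transition c d has_derivative frechet_derivative (transition c d) (at (x s))) (at (x s))"
        by (rule smooth_has_derivative[OF \<phi> xT(1)[OF s]])
      have "((\<lambda>s. transition c d (x s)) has_vector_derivative
          frechet_derivative (transition c d) (at (x s)) (v s)) (at s)"
        using has_derivative_compose[OF xI(2)[OF sI, unfolded has_vector_derivative_def] D]
        by (simp add: has_vector_derivative_def linear_scale[OF has_derivative_linear[OF D]])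
      then have "((\<lambda>s. coord d (\<gamma> s)) has_vector_derivative
          frechet_derivative (transition c d) (at (x s)) (v s)) (at s)"
        by (rule has_vector_derivative_transform_within_open[OF _ T(1) s]) (rule xT(2))
      then show ?thesis unfolding velocity_def by (rule vector_derivative_at)
    qed
    show "velocity \<gamma> d t = frechet_derivative (transition c d) (at (x t)) (v t)"
      by (rule velT[OF T(2)])
    show "x t \<in> overlap c d" "coord d (\<gamma> t) = transition c d (x t)" using xT[OF T(2)] by auto
    show "(velocity \<gamma> d has_vector_derivative
      frechet_derivative (transition c d) (at (x t)) (- christoffel (G c) (x t) (v t) (v t)) +
      frechet_derivative (\<lambda>y. frechet_derivative (transition c d) (at y) (v t)) (at (x t)) (v t)) (at t)"
      by (rule has_vector_derivative_transform_within_open[OF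
            frechet_derivative_along_has_vector_derivative[OF open_overlap[OF A c(1) d] \<phi> T xT(1) xI(2,3)[OF t(1)]] T])
        (simp_all add: velT)
    have "smooth_on T (\<lambda>t. transition c d (x t))"
      by (rule smooth_compose[OF T(1) \<phi> smooth_subset[OF xs]]) (use xT(1) in \<open>auto simp: T_def I_def\<close>)
    then have "smooth_on T (\<lambda>t. coord d (\<gamma> t))"
      by (rule smooth_cong[OF T(1)]) (rule xT(2))
    then show "smooth_on {t \<in> I. \<gamma> t \<in> cdom d} (\<lambda>t. coord d (\<gamma> t))" unfolding T_def .
  qed
  have cv: "velocity \<gamma> c t = v t" if t: "t \<in> I" for t
  proof -
    have "((\<lambda>s. coord c (\<gamma> s)) has_vector_derivative v t) (at t)"
      by (rule has_vector_derivative_transform_within_open[OF xI(2)[OF t] I(1) t]) (simp add: \<gamma>(2))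
    then show ?thesis unfolding velocity_def by (rule vector_derivative_at)
  qed
  have "geodesic A G I \<gamma>"
    unfolding geodesic_def
  proof (intro conjI ballI impI I \<gamma>_cont)
    show "I \<noteq> {}" using I(4) by blast
    fix d assume d: "d \<in> A"
    show "smooth_on {t \<in> I. \<gamma> t \<in> cdom d} (\<lambda>t. coord d (\<gamma> t))"
    \<comment> \<open>The fact \<open>smooth\<close> was derived from a time at which the curve
      meets \<open>d\<close>; if there is none, the domain is empty.\<close>
    proof (cases "{t \<in> I. \<gamma> t \<in> cdom d} = {}")
      case True
      have "smooth_on {} (\<lambda>t. coord d (\<gamma> t))"
        by (rule smooth_cong[OF open_empty smooth_const[of _ 0]]) simp
      then show ?thesis unfolding True .
    qed (use smooth[OF d] in blast)
    fix t assume t: "t \<in> I" "\<gamma> t \<in> cdom d"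
    note tr = vel[OF d t] over[OF d t]
    note J = jacobian_mult[OF A c(1) d tr(2)]
    have xd: "transition c d (x t) \<in> cimg d" unfolding tr(3)[symmetric] using t(2) by (rule imageI)
    show "riem_inner (G d (coord d (\<gamma> t))) (velocity \<gamma> d t) (velocity \<gamma> d t) = 1"
      using speed[OF t(1)] riem_inner_jacobian[OF G c(1) d tr(2)] by (simp add: tr J)
    have iso: "riem_inner (G c y) a b = riem_inner (G d (transition c d y))
        (frechet_derivative (transition c d) (at y) a) (frechet_derivative (transition c d) (at y) b)"
      if "y \<in> overlap c d" for y a b
      using riem_inner_jacobian[OF G c(1) d that] by (simp add: jacobian_mult[OF A c(1) d that])
    have "det (jacobian c d (x t)) > 0" using A c(1) d tr(2) by (simp add: oriented_atlas_def)
    then have "surj ((*v) (jacobian c d (x t)))"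
      by (intro linear_injective_imp_surjective inj_matrix_vector_mult)
        (simp_all add: invertible_det_nz)
    then have surj: "surj (frechet_derivative (transition c d) (at (x t)))"
      by (simp add: J[abs_def])
    have Gd: "smooth_on (cimg d) (G d)" using G d by (simp add: riemannian_metric_def)
    have lin: "linear (frechet_derivative (transition c d) (at (x t)))"
      by (rule has_derivative_linear[OF smooth_has_derivative[OF smooth_transition[OF A c(1) d] tr(2)]])
    show "cov_deriv G \<gamma> (velocity \<gamma>) d t = 0"
      unfolding cov_deriv_def vector_derivative_at[OF vel_deriv[OF d t]] tr
      using christoffel_pullback[OF open_overlap[OF A c(1) d] tr(2) smooth_transition[OF A c(1) d] xd Gd
          metric_at(4)[OF G c(1) xI(1)[OF t(1)]] iso metric_at(1)[OF G d xd]
          metric_at(2)[OF G c(1) xI(1)[OF t(1)]] metric_at(2)[OF G d xd] surj]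
      by (simp add: linear_neg[OF lin])
  qed
  then show thesis
  proof (rule that[OF e, folded I_def])
    show "coord c (\<gamma> 0) = x0" "velocity \<gamma> c 0 = v0" using \<gamma>(2)[OF I(4)] cv[OF I(4)] x0 by auto
    fix t assume t: "t \<in> I"
    show "\<gamma> t \<in> cdom c" by (rule \<gamma>(1)[OF t])
    have "(velocity \<gamma> c has_vector_derivative - christoffel (G c) (x t) (v t) (v t)) (at t)"
      by (rule has_vector_derivative_transform_within_open[OF xI(3)[OF t] I(1) t]) (simp add: cv)
    then show "(velocity \<gamma> c has_vector_derivative
        - christoffel (G c) (coord c (\<gamma> t)) (velocity \<gamma> c t) (velocity \<gamma> c t)) (at t)"
      by (simp add: \<gamma> t cv)
  qed
qed

section \<open>Orthonormal frames and covariant derivatives\<close>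

locale orthonormal_triple =
  fixes g :: "real^3^3" and a1 a2 a3 :: "real^3"
  assumes sym: "transpose g = g" and pos: "\<And>v. v \<noteq> 0 \<Longrightarrow> riem_inner g v v > 0"
    and ortho: "riem_inner g a1 a1 = 1" "riem_inner g a1 a2 = 0" "riem_inner g a2 a2 = 1"
      "riem_inner g a1 a3 = 0" "riem_inner g a3 a3 = 1" "riem_inner g a2 a3 = 0"
begin

text \<open>The value of the Riemannian volume form on the triple: 1 or -1 according to its
  orientation.\<close>

definition orient :: real where
  "orient = sqrt (det g) * det (vector [a1, a2, a3] :: real^3^3)"

lemma ortho_sym: "riem_inner g a2 a1 = 0" "riem_inner g a3 a1 = 0" "riem_inner g a3 a2 = 0"
  using ortho riem_inner_commute[OF sym] by metis+

text \<open>With the frame vectors as the rows of a matrix, this single identity yields both the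
  inverse of the metric and, by taking determinants, \<open>orient_square\<close>.\<close>

lemma gram: "(vector [a1, a2, a3] :: real^3^3) ** (g ** transpose (vector [a1, a2, a3])) = mat 1"
proof -
  have "((vector [a1, a2, a3] :: real^3^3) ** (g ** transpose (vector [a1, a2, a3]))) $ i $ j =
      riem_inner g (vector [a1, a2, a3] $ i) (vector [a1, a2, a3] $ j)" for i j :: 3
    by (simp add: riem_inner_def matrix_matrix_mult_def matrix_vector_mult_def transpose_def inner_vec_def)
  then show ?thesis
    by (simp add: vec_eq_iff forall_3 vector_3 ortho ortho_sym mat_def)
qed

lemma invertible_metric: "invertible g"
  using pos by (intro invertible_if_positive) (simp add: riem_inner_def)

lemma metric_inverse: "g *v ((a1 \<bullet> w) *\<^sub>R a1 + (a2 \<bullet> w) *\<^sub>R a2 + (a3 \<bullet> w) *\<^sub>R a3) = w"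
proof -
  let ?P = "vector [a1, a2, a3] :: real^3^3"
  have "(g ** transpose ?P) ** ?P = mat 1"
    using gram by (simp add: matrix_left_right_inverse)
  then have "g *v (transpose ?P *v (?P *v w)) = w"
    by (metis matrix_vector_mul_assoc matrix_vector_mul_lid)
  moreover have "transpose ?P *v (?P *v w) = (a1 \<bullet> w) *\<^sub>R a1 + (a2 \<bullet> w) *\<^sub>R a2 + (a3 \<bullet> w) *\<^sub>R a3"
    by (simp add: vec_eq_iff matrix_vector_mult_def transpose_def sum_3 inner_vec_def vector_3 forall_3
        algebra_simps)
  ultimately show ?thesis by simp
qed

text \<open>Explicit in the frame, hence smooth wherever the frame is;
  \<open>smooth_christoffel\<close> rests on this.\<close>

lemma matrix_inv_metric:
  "matrix_inv g *v w = (a1 \<bullet> w) *\<^sub>R a1 + (a2 \<bullet> w) *\<^sub>R a2 + (a3 \<bullet> w) *\<^sub>R a3"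
proof -
  have "matrix_inv g ** g = mat 1"
    using matrix_mul_matrix_inv[OF invertible_metric] by (simp add: matrix_left_right_inverse)
  then have "matrix_inv g *v (g *v z) = z" for z
    by (metis matrix_vector_mul_assoc matrix_vector_mul_lid)
  from this[of "(a1 \<bullet> w) *\<^sub>R a1 + (a2 \<bullet> w) *\<^sub>R a2 + (a3 \<bullet> w) *\<^sub>R a3"] show ?thesis
    unfolding metric_inverse .
qed

lemma expand:
  "v = riem_inner g v a1 *\<^sub>R a1 + riem_inner g v a2 *\<^sub>R a2 + riem_inner g v a3 *\<^sub>R a3"
proof -
  have "matrix_inv g ** g = mat 1"
    using matrix_mul_matrix_inv[OF invertible_metric] by (simp add: matrix_left_right_inverse)
  then have "v = matrix_inv g *v (g *v v)"
    by (metis matrix_vector_mul_assoc matrix_vector_mul_lid)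
  also have "\<dots> = riem_inner g a1 v *\<^sub>R a1 + riem_inner g a2 v *\<^sub>R a2 + riem_inner g a3 v *\<^sub>R a3"
    unfolding matrix_inv_metric riem_inner_def ..
  finally show ?thesis by (simp only: riem_inner_commute[OF sym, of v])
qed

lemma linear_expand:
  fixes f :: "real^3 \<Rightarrow> 'b::real_vector"
  assumes "linear f"
  shows "f v = riem_inner g v a1 *\<^sub>R f a1 + riem_inner g v a2 *\<^sub>R f a2 + riem_inner g v a3 *\<^sub>R f a3"
  by (subst expand[of v]) (simp only: linear_add[OF assms] linear_scale[OF assms])

lemma inner_expand:
  "riem_inner g v w = riem_inner g v a1 * riem_inner g w a1 + riem_inner g v a2 * riem_inner g w a2 +
    riem_inner g v a3 * riem_inner g w a3"
proof -
  have "linear (riem_inner g v)"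
    by (intro linearI) (simp_all add: riem_inner_linear)
  from linear_expand[OF this, of w] show ?thesis by simp
qed

lemma norm_expand:
  "riem_inner g v v = (riem_inner g v a1)\<^sup>2 + (riem_inner g v a2)\<^sup>2 + (riem_inner g v a3)\<^sup>2"
  by (simp add: inner_expand[of v v] power2_eq_square)

lemma det_metric_pos: "det g > 0"
  and orient_square: "orient\<^sup>2 = 1"
proof -
  let ?D = "det (vector [a1, a2, a3] :: real^3^3)"
  have 1: "?D * (det g * ?D) = 1"
    using arg_cong[OF gram, of det] by (simp add: det_mul)
  then have 2: "det g * ?D\<^sup>2 = 1" by (simp add: power2_eq_square algebra_simps)
  then show "det g > 0"
    by (metis zero_less_mult_pos2 zero_less_one zero_less_power2 mult_zero_right zero_neq_one power_zero_numeral)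
  then show "orient\<^sup>2 = 1" using 2 by (simp add: orient_def power_mult_distrib)
qed

lemma orient_sgn: "orient = sgn (det (vector [a1, a2, a3] :: real^3^3))"
proof -
  have "orient = sgn orient" using orient_square by (auto simp: power2_eq_1_iff)
  also have "\<dots> = sgn (det (vector [a1, a2, a3] :: real^3^3))"
    using det_metric_pos by (simp add: orient_def sgn_mult)
  finally show ?thesis .
qed

text \<open>The volume form is trilinear, so only its value \<open>orient\<close> on the triple
  enters. The two products are those in the rotation speeds of \<open>X3\<close> about the velocity
  and of \<open>X1\<close> about \<open>X3\<close>.\<close>

lemma inner_cross:
  "riem_inner g w (riem_cross g v a3) =
    orient * (riem_inner g w a1 * riem_inner g v a2 - riem_inner g w a2 * riem_inner g v a1)"
  "riem_inner g w (riem_cross g a3 a1) = orient * riem_inner g w a2"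
proof -
  have d: "det (vector [w, v, a3] :: real^3^3) =
      (riem_inner g w a1 * riem_inner g v a2 - riem_inner g w a2 * riem_inner g v a1) * det (vector [a1, a2, a3] :: real^3^3)"
    (is "?l = ?r")
  proof -
    have "det (vector [x1 *\<^sub>R a1 + x2 *\<^sub>R a2 + x3 *\<^sub>R a3, y1 *\<^sub>R a1 + y2 *\<^sub>R a2 + y3 *\<^sub>R a3, a3] :: real^3^3) =
        (x1 * y2 - x2 * y1) * det (vector [a1, a2, a3] :: real^3^3)" for x1 x2 x3 y1 y2 y3 :: real
      by (simp add: det_3 vector_3) algebra
    then show ?thesis by (subst (1) expand[of w], subst (1) expand[of v])
  qed
  have d': "det (vector [w, a3, a1] :: real^3^3) = riem_inner g w a2 * det (vector [a1, a2, a3] :: real^3^3)"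
  proof -
    have "det (vector [x1 *\<^sub>R a1 + x2 *\<^sub>R a2 + x3 *\<^sub>R a3, a3, a1] :: real^3^3) =
        x2 * det (vector [a1, a2, a3] :: real^3^3)" for x1 x2 x3 :: real
      by (simp add: det_3 vector_3) algebra
    then show ?thesis by (subst (1) expand[of w])
  qed
  show "riem_inner g w (riem_cross g v a3) =
    orient * (riem_inner g w a1 * riem_inner g v a2 - riem_inner g w a2 * riem_inner g v a1)"
    "riem_inner g w (riem_cross g a3 a1) = orient * riem_inner g w a2"
    unfolding riem_inner_cross[OF invertible_metric] orient_def d d' by simp_all
qed

end

section \<open>Covariant derivatives of fields and exterior derivatives of their dual forms\<close>

text \<open>Unlike \<open>cov_deriv\<close>, it depends on a point and a direction instead of a
  curve, so linear algebra in the direction applies; \<open>cov_deriv_along\<close> links the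
  two.\<close>

definition nabla :: "'m metric_tensor \<Rightarrow> 'm vfield \<Rightarrow> 'm chart \<Rightarrow> real^3 \<Rightarrow> real^3 \<Rightarrow> real^3" where
  "nabla G X c x u = frechet_derivative (X c) (at x) u + christoffel (G c) x u (X c x)"

lemma linear_christoffel_left:
  assumes D: "linear (frechet_derivative g (at x))"
  shows "linear (\<lambda>u. christoffel g x u v)"
proof -
  let ?D = "frechet_derivative g (at x)"
  have "linear (\<lambda>u. \<chi> l. u \<bullet> (?D (axis l 1) *v v))"
    by (intro linearI) (simp_all add: vec_eq_iff inner_add_left)
  moreover have "linear (\<lambda>u. ?D u *v v)"
    by (intro linearI)
      (simp_all add: linear_add[OF D] linear_scale[OF D] matrix_vector_mult_add_rdistrib
        scaleR_matrix_vector_assoc)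
  moreover have "linear (\<lambda>u. ?D v *v u)" by (rule matrix_vector_mul_linear)
  ultimately have "linear (\<lambda>u. ?D u *v v + ?D v *v u - (\<chi> l. u \<bullet> (?D (axis l 1) *v v)))"
    by (intro linear_compose_sub linear_compose_add)
  from linear_compose[OF linear_compose_scale_right[OF this, of "1/2"] matrix_vector_mul_linear[of "matrix_inv (g x)"]]
  show ?thesis unfolding christoffel_def o_def .
qed

lemma geodesic_curve:
  assumes \<gamma>: "geodesic A G I \<gamma>" and A: "oriented_atlas A" and c: "c \<in> A" and t: "t \<in> I" "\<gamma> t \<in> cdom c"
  shows "((\<lambda>s. coord c (\<gamma> s)) has_vector_derivative velocity \<gamma> c t) (at t)"
    "riem_inner (G c (coord c (\<gamma> t))) (velocity \<gamma> c t) (velocity \<gamma> c t) = 1"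
proof -
  have "smooth_on {t \<in> I. \<gamma> t \<in> cdom c} (\<lambda>s. coord c (\<gamma> s))"
    using \<gamma> c by (simp add: geodesic_def)
  from differentiableI[OF smooth_has_derivative[OF this, of t]] t
  have "(\<lambda>s. coord c (\<gamma> s)) differentiable (at t)" by simp
  then show "((\<lambda>s. coord c (\<gamma> s)) has_vector_derivative velocity \<gamma> c t) (at t)"
    unfolding velocity_def by (simp add: vector_derivative_works)
  show "riem_inner (G c (coord c (\<gamma> t))) (velocity \<gamma> c t) (velocity \<gamma> c t) = 1"
    using \<gamma> c t by (simp add: geodesic_def)
qed

lemma along_has_vector_derivative:
  assumes "smooth_on (cimg c) (X c)" "coord c (\<gamma> t) \<in> cimg c"
    and "((\<lambda>s. coord c (\<gamma> s)) has_vector_derivative velocity \<gamma> c t) (at t)"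
  shows "(along \<gamma> X c has_vector_derivative frechet_derivative (X c) (at (coord c (\<gamma> t))) (velocity \<gamma> c t)) (at t)"
proof -
  have D: "(X c has_derivative frechet_derivative (X c) (at (coord c (\<gamma> t)))) (at (coord c (\<gamma> t)))"
    by (rule smooth_has_derivative[OF assms(1,2)])
  from has_derivative_compose[OF assms(3)[unfolded has_vector_derivative_def] D]
  show ?thesis
    unfolding along_def[abs_def] has_vector_derivative_def
    by (simp add: linear_scale[OF has_derivative_linear[OF D]])
qed

lemma cov_deriv_along:
  assumes "smooth_on (cimg c) (X c)" "coord c (\<gamma> t) \<in> cimg c"
    and "((\<lambda>s. coord c (\<gamma> s)) has_vector_derivative velocity \<gamma> c t) (at t)"
  shows "cov_deriv G \<gamma> (along \<gamma> X) c t = nabla G X c (coord c (\<gamma> t)) (velocity \<gamma> c t)"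
  unfolding cov_deriv_def nabla_def vector_derivative_at[OF along_has_vector_derivative[where X=X and c=c, OF assms]]
  by (simp add: along_def)

lemma linear_nabla:
  assumes "riemannian_metric A G" "c \<in> A" "x \<in> cimg c" "smooth_on (cimg c) (X c)"
  shows "linear (nabla G X c x)"
  unfolding nabla_def[abs_def]
  by (intro linear_compose_add linear_christoffel_left linear_frechet_derivative
      metric_at(4)[OF assms(1-3)] has_derivative_linear[OF smooth_has_derivative[OF assms(4,3)]])

text \<open>\<open>riem_inner_along_curve\<close> for the coordinate line through \<open>x\<close>
  in direction \<open>u\<close>: any curve with this velocity would serve, and the line is available
  for every \<open>u\<close>.\<close>

lemma nabla_metric:
  assumes A: "oriented_atlas A" and G: "riemannian_metric A G" and c: "c \<in> A" "x \<in> cimg c"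
    and Y: "smooth_on (cimg c) (Y c)" and Z: "smooth_on (cimg c) (Z c)"
    and const: "\<And>y. y \<in> cimg c \<Longrightarrow> riem_inner (G c y) (Y c y) (Z c y) = k"
  shows "riem_inner (G c x) (nabla G Y c x u) (Z c x) + riem_inner (G c x) (Y c x) (nabla G Z c x u) = 0"
proof -
  note U = oriented_atlas_chart(2)[OF A c(1)]
  have line: "((\<lambda>s. x + s *\<^sub>R u) has_vector_derivative u) (at 0)"
    by (auto intro!: derivative_eq_intros)
  have comp: "((\<lambda>s. W (x + s *\<^sub>R u)) has_vector_derivative frechet_derivative W (at x) u) (at 0)"
    if "smooth_on (cimg c) W" for W :: "real^3 \<Rightarrow> real^3"
  proof -
    have "(W has_derivative frechet_derivative W (at x)) (at (x + 0 *\<^sub>R u))"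
      using smooth_has_derivative[OF that c(2)] by simp
    from has_derivative_compose[OF line[unfolded has_vector_derivative_def] this] show ?thesis
      by (simp add: has_vector_derivative_def
          linear_scale[OF has_derivative_linear[OF smooth_has_derivative[OF that c(2)]]])
  qed
  have "((\<lambda>s. riem_inner (G c (x + s *\<^sub>R u)) (Y c (x + s *\<^sub>R u)) (Z c (x + s *\<^sub>R u))) has_real_derivative
      riem_inner (G c x) (nabla G Y c x u) (Z c x) + riem_inner (G c x) (Y c x) (nabla G Z c x u)) (at 0)"
    using riem_inner_along_curve[where x="\<lambda>s. x + s *\<^sub>R u" and t=0 and g="G c", OF U _
        metric_at(1)[OF G c(1)] _ _ line comp[OF Y] comp[OF Z]] metric_at(4,2)[OF G c] c(2)
    by (simp add: nabla_def)
  moreover have "((\<lambda>s. riem_inner (G c (x + s *\<^sub>R u)) (Y c (x + s *\<^sub>R u)) (Z c (x + s *\<^sub>R u)))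
      has_real_derivative 0) (at 0)"
  proof (rule has_field_derivative_transform_within_open[OF DERIV_const[of k]])
    show "open ((\<lambda>s. x + s *\<^sub>R u) -` cimg c)"
      by (rule open_vimage[OF U]) (auto intro!: continuous_intros)
  qed (use c(2) const in auto)
  ultimately show ?thesis by (rule DERIV_unique)
qed

text \<open>Written through \<open>nabla\<close>, the derivative of the form leaves a Christoffel
  term symmetric in \<open>u\<close> and \<open>v\<close>, which antisymmetrisation removes. This is
  where the connection being torsion free is used.\<close>

lemma ext_deriv_flat:
  assumes A: "oriented_atlas A" and G: "riemannian_metric A G" and c: "c \<in> A" "x \<in> cimg c"
    and X: "smooth_on (cimg c) (X c)"
    and flat: "\<And>y. y \<in> cimg c \<Longrightarrow> \<omega> c y = G c y *v X c y"
  shows "ext_deriv (\<omega> c) x u v =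
    riem_inner (G c x) (nabla G X c x u) v - riem_inner (G c x) (nabla G X c x v) u"
proof -
  note U = oriented_atlas_chart(2)[OF A c(1)]
  let ?g = "riem_inner (G c x)"
  have DX: "(X c has_derivative frechet_derivative (X c) (at x)) (at x)"
    by (rule smooth_has_derivative[OF X c(2)])
  have DG: "(G c has_derivative frechet_derivative (G c) (at x)) (at x)"
    using metric_at(4)[OF G c] frechet_derivative_works by blast
  have "((\<lambda>y. G c y *v X c y) has_derivative (\<lambda>u. G c x *v frechet_derivative (X c) (at x) u +
      frechet_derivative (G c) (at x) u *v X c x)) (at x)"
    by (rule bounded_bilinear.FDERIV[OF bounded_bilinear_matrix_vector DG DX])
  then have "(\<omega> c has_derivative (\<lambda>u. G c x *v frechet_derivative (X c) (at x) u +
      frechet_derivative (G c) (at x) u *v X c x)) (at x)"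
    by (rule has_derivative_transform_within_open[OF _ U c(2)]) (simp add: flat)
  from fun_cong[OF frechet_derivative_at[OF this], symmetric]
  have D: "frechet_derivative (\<omega> c) (at x) u = G c x *v frechet_derivative (X c) (at x) u +
      frechet_derivative (G c) (at x) u *v X c x" for u .
  have "frechet_derivative (\<omega> c) (at x) u \<bullet> v =
      ?g (nabla G X c x u) v + ?g (christoffel (G c) x u v) (X c x)" for u v
  proof -
    have "frechet_derivative (\<omega> c) (at x) u \<bullet> v =
        ?g v (frechet_derivative (X c) (at x) u) + v \<bullet> (frechet_derivative (G c) (at x) u *v X c x)"
      unfolding D riem_inner_def by (simp only: inner_commute[of _ v] inner_add_right)
    also have "v \<bullet> (frechet_derivative (G c) (at x) u *v X c x) =
        ?g (christoffel (G c) x u v) (X c x) + ?g v (christoffel (G c) x u (X c x))"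
      using christoffel_metric[OF U c(2) metric_at(1)[OF G c(1)] metric_at(4,2)[OF G c]] by simp
    finally show ?thesis
      by (simp add: nabla_def riem_inner_commute[OF metric_at(1)[OF G c], of v] riem_inner_linear)
  qed
  moreover have "christoffel (G c) x u v = christoffel (G c) x v u"
    using christoffel_symmetric[OF U c(2) metric_at(1)[OF G c(1)] metric_at(4)[OF G c]] by simp
  ultimately show ?thesis by (simp add: ext_deriv_def)
qed

section \<open>Tops\<close>

locale top_frame =
  fixes A :: "('m::{t2_space, second_countable_topology}) chart set" and G :: "'m metric_tensor"
    and X1 X2 X3 :: "'m vfield" and \<omega>1 \<omega>2 \<omega>3 :: "'m form1" and \<xi> :: "real \<Rightarrow> 'm plane_bundle"
  assumes manifold: "oriented_riemannian_3manifold A G"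
    and frame: "orthonormal_frame A G X1 X2 X3"
    and dual: "dual_coframe A X1 X2 X3 \<omega>1 \<omega>2 \<omega>3"
    and pencil: "indexed_pencil A \<omega>1 \<omega>2 \<xi>"
    and constant_angle: "geodesic A G I \<gamma> \<Longrightarrow> \<exists>k. has_constant_value A I \<gamma> (angle_with G \<gamma> X3) k"
    and constant_rotation: "geodesic A G I \<gamma> \<Longrightarrow>
      (\<forall>t\<in>I. \<forall>c\<in>A. \<gamma> t \<in> cdom c \<longrightarrow> velocity \<gamma> c t \<notin> axis_bundle \<xi> c (coord c (\<gamma> t))) \<Longrightarrow>
      \<exists>k. has_constant_value A I \<gamma> (rotation_speed G \<gamma> (along \<gamma> X3) (velocity \<gamma>)) k"
    and equal_spin: "geodesic A G I \<gamma> \<Longrightarrow> geodesic A G J \<delta> \<Longrightarrow>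
      has_constant_value A I \<gamma> (angle_with G \<gamma> X3) a \<Longrightarrow>
      has_constant_value A J \<delta> (angle_with G \<delta> X3) a \<Longrightarrow>
      \<exists>k. has_constant_value A I \<gamma> (rotation_speed G \<gamma> (along \<gamma> X1) (along \<gamma> X3)) k \<and>
          has_constant_value A J \<delta> (rotation_speed G \<delta> (along \<delta> X1) (along \<delta> X3)) k"
begin

lemma atlas: "oriented_atlas A" and metric: "riemannian_metric A G"
  and connected: "connected (UNIV :: 'm set)"
  using manifold by (simp_all add: oriented_riemannian_3manifold_def)

lemmas open_cimg = oriented_atlas_chart(2)[OF atlas]

lemma smooth_frame:
  assumes "c \<in> A"
  shows "smooth_on (cimg c) (X1 c)" "smooth_on (cimg c) (X2 c)" "smooth_on (cimg c) (X3 c)"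
  using frame assms by (simp_all add: orthonormal_frame_def vector_field_def)

lemma frame_at:
  assumes "c \<in> A" "x \<in> cimg c"
  shows "orthonormal_triple (G c x) (X1 c x) (X2 c x) (X3 c x)"
proof -
  have "riem_inner (G c x) (X1 c x) (X1 c x) = 1 \<and> riem_inner (G c x) (X1 c x) (X2 c x) = 0 \<and>
        riem_inner (G c x) (X2 c x) (X2 c x) = 1 \<and> riem_inner (G c x) (X1 c x) (X3 c x) = 0 \<and>
        riem_inner (G c x) (X3 c x) (X3 c x) = 1 \<and> riem_inner (G c x) (X2 c x) (X3 c x) = 0"
    using frame assms unfolding orthonormal_frame_def by blast
  then show ?thesis
    using metric_at[OF metric assms] by unfold_locales auto
qed

text \<open>The inverse metric is smooth because it is a sum of squares of the frame vectors;
  everything else is polynomial in the velocity and in derivatives of the metric.\<close>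

lemma smooth_christoffel:
  assumes c: "c \<in> A"
  shows "smooth_on (cimg c \<times> UNIV) (\<lambda>z. christoffel (G c) (fst z) (snd z) (snd z))"
proof -
  let ?S = "cimg c \<times> (UNIV :: (real^3) set)"
  let ?D = "\<lambda>z. frechet_derivative (G c) (at (fst z))"
  have S: "open ?S" by (intro open_Times open_cimg c open_UNIV)
  have G: "smooth_on (cimg c) (G c)" using metric c by (simp add: riemannian_metric_def)
  have fst: "smooth_on ?S fst" "fst ` ?S \<subseteq> cimg c" and snd: "smooth_on ?S snd"
    by (auto intro: smooth_linear bounded_linear_fst bounded_linear_snd)
  have D: "smooth_on ?S (\<lambda>z. ?D z (w z))" if "smooth_on ?S w" for w
    by (rule smooth_derivative_along[OF S G fst(1) that fst(2)])
  have Dv: "smooth_on ?S (\<lambda>z. ?D z (snd z) *v snd z)"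
    by (rule smooth_matrix_vector[OF S D[OF snd] snd])
  \<comment> \<open>The covector to which the inverse metric is applied, with its last term expanded
    along the coordinate axes to make it a sum of smooth maps.\<close>
  define q where "q z = (1/2) *\<^sub>R (?D z (snd z) *v snd z + ?D z (snd z) *v snd z
      + (-1) *\<^sub>R (\<Sum>l\<in>UNIV. (snd z \<bullet> (?D z (axis l 1) *v snd z)) *\<^sub>R axis l 1))" for z :: "(real^3) \<times> (real^3)"
  have "smooth_on ?S (\<lambda>z. (snd z \<bullet> (?D z (axis l 1) *v snd z)) *\<^sub>R axis l 1)" for l
    by (intro smooth_scaleR[OF S] smooth_inner[OF S] smooth_matrix_vector[OF S] D smooth_const snd)
  then have q: "smooth_on ?S q"
    unfolding q_def
    by (intro smooth_compose_linear[OF S bounded_linear_scaleR_right] smooth_add[OF S] Dv smooth_sum[OF S])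
  have X: "smooth_on ?S (\<lambda>z. X (fst z))" if "smooth_on (cimg c) X" for X :: "real^3 \<Rightarrow> real^3"
    by (rule smooth_compose[OF S that fst])
  have "smooth_on ?S (\<lambda>z. (X1 c (fst z) \<bullet> q z) *\<^sub>R X1 c (fst z) + (X2 c (fst z) \<bullet> q z) *\<^sub>R X2 c (fst z)
      + (X3 c (fst z) \<bullet> q z) *\<^sub>R X3 c (fst z))"
    by (intro smooth_add[OF S] smooth_scaleR[OF S] smooth_inner[OF S] q X smooth_frame c)
  then show ?thesis
  proof (rule smooth_cong[OF S])
    fix z assume "z \<in> ?S"
    then interpret orthonormal_triple "G c (fst z)" "X1 c (fst z)" "X2 c (fst z)" "X3 c (fst z)"
      by (intro frame_at c) auto
    have "(\<chi> l. snd z \<bullet> (?D z (axis l 1) *v snd z)) =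
        (\<Sum>l\<in>UNIV. (snd z \<bullet> (?D z (axis l 1) *v snd z)) *\<^sub>R axis l 1)"
      using basis_expansion[of "\<chi> l. snd z \<bullet> (?D z (axis l 1) *v snd z)"]
      by (simp add: scalar_mult_eq_scaleR)
    then show "(X1 c (fst z) \<bullet> q z) *\<^sub>R X1 c (fst z) + (X2 c (fst z) \<bullet> q z) *\<^sub>R X2 c (fst z)
        + (X3 c (fst z) \<bullet> q z) *\<^sub>R X3 c (fst z) = christoffel (G c) (fst z) (snd z) (snd z)"
      by (simp add: christoffel_def matrix_inv_metric q_def)
  qed
qed

lemmas geodesic_from = geodesic_exists[OF atlas metric _ _ _ smooth_christoffel]

section \<open>The covariant derivative of the axis field\<close>

text \<open>The component along \<open>X3\<close> of a unit vector lies between -1 and 1, where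
  \<open>cos\<close> undoes \<open>arccos\<close>. Thus a constant angle is the same as a constant
  \<open>X3\<close>-component of the velocity.\<close>

lemma angle_with_frame:
  assumes \<gamma>: "geodesic A G I \<gamma>" and c: "c \<in> A" and t: "t \<in> I" "\<gamma> t \<in> cdom c"
  shows "angle_with G \<gamma> X3 c t = arccos (riem_inner (G c (coord c (\<gamma> t))) (velocity \<gamma> c t) (X3 c (coord c (\<gamma> t))))"
    "cos (angle_with G \<gamma> X3 c t) = riem_inner (G c (coord c (\<gamma> t))) (velocity \<gamma> c t) (X3 c (coord c (\<gamma> t)))"
proof -
  interpret orthonormal_triple "G c (coord c (\<gamma> t))" "X1 c (coord c (\<gamma> t))" "X2 c (coord c (\<gamma> t))" "X3 c (coord c (\<gamma> t))"
    using c t by (intro frame_at) auto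
  note u = geodesic_curve(2)[OF \<gamma> atlas c t]
  show 1: "angle_with G \<gamma> X3 c t = arccos (riem_inner (G c (coord c (\<gamma> t))) (velocity \<gamma> c t) (X3 c (coord c (\<gamma> t))))"
    by (simp add: angle_with_def riem_angle_def along_def u ortho)
  have "(riem_inner (G c (coord c (\<gamma> t))) (velocity \<gamma> c t) (X3 c (coord c (\<gamma> t))))\<^sup>2
      \<le> riem_inner (G c (coord c (\<gamma> t))) (velocity \<gamma> c t) (velocity \<gamma> c t)"
    unfolding norm_expand[of "velocity \<gamma> c t"] by simp
  then have "(riem_inner (G c (coord c (\<gamma> t))) (velocity \<gamma> c t) (X3 c (coord c (\<gamma> t))))\<^sup>2 \<le> 1\<^sup>2"
    by (simp add: u)
  then have "\<bar>riem_inner (G c (coord c (\<gamma> t))) (velocity \<gamma> c t) (X3 c (coord c (\<gamma> t)))\<bar> \<le> 1"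
    by (metis abs_le_square_iff abs_one)
  then show "cos (angle_with G \<gamma> X3 c t) = riem_inner (G c (coord c (\<gamma> t))) (velocity \<gamma> c t) (X3 c (coord c (\<gamma> t)))"
    unfolding 1 by (rule cos_arccos_abs)
qed

text \<open>Condition (i) keeps the inner product of the velocity with \<open>X3\<close> constant
  along the geodesic starting with \<open>v\<close>. Its derivative at time 0 has no acceleration
  term, so only the derivative of \<open>X3\<close> remains.\<close>

lemma killing_unit:
  assumes c: "c \<in> A" "x \<in> cimg c" and unit: "riem_inner (G c x) v v = 1"
  shows "riem_inner (G c x) v (nabla G X3 c x v) = 0"
proof -
  obtain e \<gamma> where e: "e > 0" and \<gamma>: "geodesic A G {-e<..<e} \<gamma>" and x: "coord c (\<gamma> 0) = x"
    and v: "velocity \<gamma> c 0 = v"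
    and dom: "\<And>t. t \<in> {-e<..<e} \<Longrightarrow> \<gamma> t \<in> cdom c"
    and acc: "\<And>t. t \<in> {-e<..<e} \<Longrightarrow> (velocity \<gamma> c has_vector_derivative
        - christoffel (G c) (coord c (\<gamma> t)) (velocity \<gamma> c t) (velocity \<gamma> c t)) (at t)"
    by (rule geodesic_from[OF c unit c(1)]) (rule that)
  obtain k where k: "has_constant_value A {-e<..<e} \<gamma> (angle_with G \<gamma> X3) k"
    using constant_angle[OF \<gamma>] by blast
  have 0: "0 \<in> {-e<..<e}" using e by simp
  let ?f = "\<lambda>s. riem_inner (G c (coord c (\<gamma> s))) (velocity \<gamma> c s) (along \<gamma> X3 c s)"
  have "?f s = cos k" if s: "s \<in> {-e<..<e}" for s
  proof -
    have "angle_with G \<gamma> X3 c s = k" using k s c(1) dom[OF s] by (simp add: has_constant_value_def)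
    then show ?thesis using angle_with_frame(2)[OF \<gamma> c(1) s dom[OF s]] by (simp add: along_def)
  qed
  then have zero: "(?f has_real_derivative 0) (at 0)"
    by (intro has_field_derivative_transform_within_open[OF DERIV_const[of "cos k"] open_greaterThanLessThan 0]) auto
  have cx: "coord c (\<gamma> 0) \<in> cimg c" using c x by simp
  note curve0 = geodesic_curve(1)[OF \<gamma> atlas c(1) 0 dom[OF 0]] acc[OF 0]
  have "(?f has_real_derivative riem_inner (G c (coord c (\<gamma> 0))) (velocity \<gamma> c 0)
      (nabla G X3 c (coord c (\<gamma> 0)) (velocity \<gamma> c 0))) (at 0)"
    using riem_inner_along_curve[OF open_cimg[OF c(1)] cx metric_at(1)[OF metric c(1)]
        metric_at(4,2)[OF metric c(1) cx] curve0
        along_has_vector_derivative[where X=X3 and c=c, OF smooth_frame(3)[OF c(1)] cx curve0(1)]]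
    by (simp add: nabla_def riem_inner_linear along_def)
  from DERIV_unique[OF this zero] show ?thesis by (simp add: x v)
qed

text \<open>This is \<tau>; by \<open>nabla_axis\<close> it is the only free entry of the covariant
  derivative of \<open>X3\<close>.\<close>

definition twist :: "'m chart \<Rightarrow> real^3 \<Rightarrow> real" where
  "twist c x = riem_inner (G c x) (nabla G X3 c x (X1 c x)) (X2 c x)"

definition orientation :: "'m chart \<Rightarrow> real^3 \<Rightarrow> real" where
  "orientation c x = orthonormal_triple.orient (G c x) (X1 c x) (X2 c x) (X3 c x)"

text \<open>The factor \<open>orientation\<close> makes this the rotation speed of \<open>X1\<close>
  about \<open>X3\<close> along a geodesic with velocity \<open>u\<close>. On \<open>X3\<close> its
  value is \<kappa> times that sign.\<close>

definition spin :: "'m chart \<Rightarrow> real^3 \<Rightarrow> real^3 \<Rightarrow> real" where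
  "spin c x u = orientation c x * riem_inner (G c x) (nabla G X1 c x u) (X2 c x)"

lemma orientation_square:
  assumes "c \<in> A" "x \<in> cimg c"
  shows "orientation c x * orientation c x = 1"
proof -
  interpret orthonormal_triple "G c x" "X1 c x" "X2 c x" "X3 c x" by (rule frame_at[OF assms])
  show ?thesis using orient_square by (simp add: orientation_def power2_eq_square)
qed

lemma frame_nabla_skew:
  assumes c: "c \<in> A" "x \<in> cimg c"
    and Y: "Y \<in> {X1, X2, X3}" and Z: "Z \<in> {X1, X2, X3}"
  shows "riem_inner (G c x) (nabla G Y c x u) (Z c x) = - riem_inner (G c x) (nabla G Z c x u) (Y c x)"
proof -
  \<comment> \<open>For distinct fields the constant is 0, written as the value at \<open>x\<close>
    so that one statement serves all pairs.\<close>
  have ip: "riem_inner (G c y) (Y c y) (Z c y) = (if Y = Z then 1 else riem_inner (G c x) (Y c x) (Z c x))"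
    if y: "y \<in> cimg c" for y
  proof -
    interpret x: orthonormal_triple "G c x" "X1 c x" "X2 c x" "X3 c x" by (rule frame_at[OF c])
    interpret y: orthonormal_triple "G c y" "X1 c y" "X2 c y" "X3 c y" by (rule frame_at[OF c(1) y])
    show ?thesis using Y Z x.ortho x.ortho_sym y.ortho y.ortho_sym by auto
  qed
  have "smooth_on (cimg c) (Y c)" "smooth_on (cimg c) (Z c)"
    using Y Z smooth_frame[OF c(1)] by auto
  from nabla_metric[where Y=Y and Z=Z and c=c, OF atlas metric c this ip] show ?thesis
    using riem_inner_commute[OF metric_at(1)[OF metric c], of "Y c x"] by (simp add: add_eq_0_iff)
qed

text \<open>Polarising the Killing condition makes the bilinear form of \<open>nabla G X3\<close>
  skew. Since \<open>X3\<close> has constant length it lies in the kernel of this form, so only the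
  entry on \<open>X1\<close> and \<open>X2\<close> survives.\<close>

lemma nabla_axis:
  assumes c: "c \<in> A" "x \<in> cimg c"
  shows "riem_inner (G c x) (nabla G X3 c x u) (X1 c x) = - twist c x * riem_inner (G c x) u (X2 c x)"
    "riem_inner (G c x) (nabla G X3 c x u) (X2 c x) = twist c x * riem_inner (G c x) u (X1 c x)"
    "riem_inner (G c x) (nabla G X3 c x u) (X3 c x) = 0"
proof -
  interpret orthonormal_triple "G c x" "X1 c x" "X2 c x" "X3 c x" by (rule frame_at[OF c])
  have lin: "linear (nabla G X3 c x)" by (rule linear_nabla[where X=X3 and c=c, OF metric c smooth_frame(3)[OF c(1)]])
  let ?B = "\<lambda>u w. riem_inner (G c x) (nabla G X3 c x u) w"
  have linB: "linear (\<lambda>u. ?B u w)" for w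
    by (intro linearI) (simp_all add: linear_add[OF lin] linear_scale[OF lin] riem_inner_linear)
  have B0: "?B v v = 0" for v
  proof (cases "v = 0")
    case True
    then show ?thesis by (simp add: riem_inner_linear)
  next
    case False
    define r where "r = sqrt (riem_inner (G c x) v v)"
    have r: "r > 0" "r * r = riem_inner (G c x) v v" using pos[OF False] by (auto simp: r_def)
    define w where "w = (1 / r) *\<^sub>R v"
    have "riem_inner (G c x) w w = (r * r) / (r * r)" by (simp add: w_def riem_inner_linear r(2))
    then have "riem_inner (G c x) w w = 1" using r(1) by simp
    from killing_unit[OF c this] have "?B w w = 0"
      by (simp add: riem_inner_commute[OF sym])
    then show ?thesis using r(1) by (simp add: w_def riem_inner_linear linear_scale[OF lin])
  qed
  have skew: "?B v w = - ?B w v" for v w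
    using B0[of "v + w"] B0[of v] B0[of w] by (simp add: riem_inner_linear linear_add[OF lin])
  show B3: "?B u (X3 c x) = 0" for u
    using frame_nabla_skew[OF c, of X3 X3 u] by simp
  have B3': "?B (X3 c x) w = 0" for w using skew[of "X3 c x" w] B3[of w] by simp
  show "?B u (X1 c x) = - twist c x * riem_inner (G c x) u (X2 c x)"
    "?B u (X2 c x) = twist c x * riem_inner (G c x) u (X1 c x)"
    using linear_expand[OF linB[of "X1 c x"], of u] linear_expand[OF linB[of "X2 c x"], of u]
      skew[of "X2 c x" "X1 c x"] by (simp_all add: B0 B3' twist_def)
qed

section \<open>The rotation of \<open>X1\<close> about the axis\<close>

lemma spin_rotation_speed:
  assumes \<gamma>: "geodesic A G I \<gamma>" and c: "c \<in> A" and t: "t \<in> I" "\<gamma> t \<in> cdom c"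
  shows "rotation_speed G \<gamma> (along \<gamma> X1) (along \<gamma> X3) c t = spin c (coord c (\<gamma> t)) (velocity \<gamma> c t)"
proof -
  have x: "coord c (\<gamma> t) \<in> cimg c" using t by simp
  interpret orthonormal_triple "G c (coord c (\<gamma> t))" "X1 c (coord c (\<gamma> t))" "X2 c (coord c (\<gamma> t))" "X3 c (coord c (\<gamma> t))"
    by (rule frame_at[OF c x])
  show ?thesis
    unfolding rotation_speed_def cov_deriv_along[where X=X1 and c=c, OF smooth_frame(1)[OF c] x geodesic_curve(1)[OF \<gamma> atlas c t]]
      along_def inner_cross(2) spin_def orientation_def ..
qed

text \<open>The geodesics starting with \<open>v\<close> and \<open>w\<close> make equal angles with
  \<open>X3\<close>, so condition (iv) equates their rotation speeds, even at different points and
  in different charts.\<close>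

lemma spin_eq:
  assumes c: "c \<in> A" "x \<in> cimg c" "riem_inner (G c x) v v = 1"
    and d: "d \<in> A" "y \<in> cimg d" "riem_inner (G d y) w w = 1"
    and eq: "riem_inner (G c x) v (X3 c x) = riem_inner (G d y) w (X3 d y)"
  shows "spin c x v = spin d y w"
proof -
  obtain e \<gamma> where e: "e > 0" and \<gamma>: "geodesic A G {-e<..<e} \<gamma>" and x: "coord c (\<gamma> 0) = x"
    and v: "velocity \<gamma> c 0 = v" and "\<And>t. t \<in> {-e<..<e} \<Longrightarrow> \<gamma> t \<in> cdom c"
    by (rule geodesic_from[OF c c(1)]) (rule that)
  then have \<gamma>0: "0 \<in> {-e<..<e}" "\<gamma> 0 \<in> cdom c" by auto
  obtain e' \<delta> where e': "e' > 0" and \<delta>: "geodesic A G {-e'<..<e'} \<delta>" and y: "coord d (\<delta> 0) = y"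
    and w: "velocity \<delta> d 0 = w" and "\<And>t. t \<in> {-e'<..<e'} \<Longrightarrow> \<delta> t \<in> cdom d"
    by (rule geodesic_from[OF d d(1)]) (rule that)
  then have \<delta>0: "0 \<in> {-e'<..<e'}" "\<delta> 0 \<in> cdom d" by auto
  obtain k l where k: "has_constant_value A {-e<..<e} \<gamma> (angle_with G \<gamma> X3) k"
    and l: "has_constant_value A {-e'<..<e'} \<delta> (angle_with G \<delta> X3) l"
    using constant_angle[OF \<gamma>] constant_angle[OF \<delta>] by blast
  have "k = angle_with G \<gamma> X3 c 0" "l = angle_with G \<delta> X3 d 0"
    using k l \<gamma>0 \<delta>0 c(1) d(1) unfolding has_constant_value_def by auto
  then have "l = k"
    using angle_with_frame(1)[OF \<gamma> c(1) \<gamma>0] angle_with_frame(1)[OF \<delta> d(1) \<delta>0] eq by (simp add: x v y w)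
  then obtain m where
    "has_constant_value A {-e<..<e} \<gamma> (rotation_speed G \<gamma> (along \<gamma> X1) (along \<gamma> X3)) m"
    "has_constant_value A {-e'<..<e'} \<delta> (rotation_speed G \<delta> (along \<delta> X1) (along \<delta> X3)) m"
    using equal_spin[OF \<gamma> \<delta> k] l by blast
  then have "rotation_speed G \<gamma> (along \<gamma> X1) (along \<gamma> X3) c 0 = m"
    "rotation_speed G \<delta> (along \<delta> X1) (along \<delta> X3) d 0 = m"
    using \<gamma>0 \<delta>0 c(1) d(1) unfolding has_constant_value_def by auto
  then show ?thesis
    using spin_rotation_speed[OF \<gamma> c(1) \<gamma>0] spin_rotation_speed[OF \<delta> d(1) \<delta>0] by (simp add: x v y w)
qed

text \<open>A unit vector orthogonal to \<open>X3\<close> and its negative have the same axis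
  component, so the linear map \<open>spin\<close> takes equal values on both and vanishes. This
  applies to \<open>X1\<close> and \<open>X2\<close>.\<close>

lemma spin_axis:
  assumes c: "c \<in> A" "x \<in> cimg c"
  shows "spin c x u = riem_inner (G c x) u (X3 c x) * spin c x (X3 c x)"
proof -
  interpret orthonormal_triple "G c x" "X1 c x" "X2 c x" "X3 c x" by (rule frame_at[OF c])
  have lin: "linear (nabla G X1 c x)" by (rule linear_nabla[where X=X1 and c=c, OF metric c smooth_frame(1)[OF c(1)]])
  have lins: "linear (spin c x)"
    unfolding spin_def[abs_def]
    by (intro linearI) (simp_all add: linear_add[OF lin] linear_scale[OF lin] riem_inner_linear algebra_simps)
  have zero: "spin c x v = 0" if "riem_inner (G c x) v v = 1" "riem_inner (G c x) v (X3 c x) = 0" for v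
  proof -
    have "riem_inner (G c x) ((-1) *\<^sub>R v) ((-1) *\<^sub>R v) = 1"
      "riem_inner (G c x) ((-1) *\<^sub>R v) (X3 c x) = 0"
      unfolding riem_inner_linear that by simp_all
    then have "spin c x v = spin c x ((-1) *\<^sub>R v)"
      by (intro spin_eq[OF c that(1) c]) (simp_all only: that)
    then show ?thesis by (simp only: linear_scale[OF lins]) simp
  qed
  show ?thesis
    using linear_expand[OF lins, of u] zero[of "X1 c x"] zero[of "X2 c x"] ortho by simp
qed

lemma spin_axis_constant:
  assumes "c \<in> A" "x \<in> cimg c" "d \<in> A" "y \<in> cimg d"
  shows "spin c x (X3 c x) = spin d y (X3 d y)"
proof -
  interpret x: orthonormal_triple "G c x" "X1 c x" "X2 c x" "X3 c x" by (rule frame_at[OF assms(1,2)])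
  interpret y: orthonormal_triple "G d y" "X1 d y" "X2 d y" "X3 d y" by (rule frame_at[OF assms(3,4)])
  show ?thesis by (rule spin_eq) (simp_all only: assms x.ortho y.ortho)
qed

section \<open>Constancy of the pitch\<close>

definition pitch :: "'m chart \<Rightarrow> real^3 \<Rightarrow> real" where
  "pitch c x = orientation c x * twist c x"

text \<open>The second factor is the squared sine of the angle with the axis. It is constant by (i)
  and nonzero off the axis, so constant rotation speed means constant pitch.\<close>

lemma axis_rotation_speed:
  assumes \<gamma>: "geodesic A G I \<gamma>" and c: "c \<in> A" and t: "t \<in> I" "\<gamma> t \<in> cdom c"
  shows "rotation_speed G \<gamma> (along \<gamma> X3) (velocity \<gamma>) c t = - pitch c (coord c (\<gamma> t)) *
    (1 - (riem_inner (G c (coord c (\<gamma> t))) (velocity \<gamma> c t) (X3 c (coord c (\<gamma> t))))\<^sup>2)"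
proof -
  have x: "coord c (\<gamma> t) \<in> cimg c" using t by simp
  interpret orthonormal_triple "G c (coord c (\<gamma> t))" "X1 c (coord c (\<gamma> t))" "X2 c (coord c (\<gamma> t))" "X3 c (coord c (\<gamma> t))"
    by (rule frame_at[OF c x])
  let ?v = "\<lambda>X. riem_inner (G c (coord c (\<gamma> t))) (velocity \<gamma> c t) (X c (coord c (\<gamma> t)))"
  have 1: "1 - (?v X3)\<^sup>2 = (?v X1)\<^sup>2 + (?v X2)\<^sup>2"
    using norm_expand[of "velocity \<gamma> c t"] geodesic_curve(2)[OF \<gamma> atlas c t] by simp
  show ?thesis
    unfolding 1 rotation_speed_def along_def[of _ X3 c t] pitch_def orientation_def inner_cross(1)
      cov_deriv_along[where X=X3 and c=c, OF smooth_frame(3)[OF c] x geodesic_curve(1)[OF \<gamma> atlas c t]]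
      nabla_axis[OF c x]
    by (simp add: power2_eq_square algebra_simps)
qed

lemma dual_at:
  assumes c: "c \<in> A" "x \<in> cimg c"
  shows "\<omega>1 c x = G c x *v X1 c x" "\<omega>2 c x = G c x *v X2 c x" "\<omega>3 c x = G c x *v X3 c x"
proof -
  interpret orthonormal_triple "G c x" "X1 c x" "X2 c x" "X3 c x" by (rule frame_at[OF c])
  have flat: "a = G c x *v w"
    if a: "a \<bullet> X1 c x = riem_inner (G c x) (X1 c x) w" "a \<bullet> X2 c x = riem_inner (G c x) (X2 c x) w"
      "a \<bullet> X3 c x = riem_inner (G c x) (X3 c x) w" for a w
  proof -
    have la: "linear (\<lambda>v. a \<bullet> v)" by (intro linearI) (simp_all add: inner_add_right)
    have lw: "linear (\<lambda>v. riem_inner (G c x) v w)" by (intro linearI) (simp_all add: riem_inner_linear)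
    have "a \<bullet> v = v \<bullet> (G c x *v w)" for v
      unfolding linear_expand[OF la, of v] a linear_expand[OF lw, of v, symmetric]
      by (simp add: riem_inner_def)
    from this[of "a - G c x *v w"] have "(a - G c x *v w) \<bullet> (a - G c x *v w) = 0"
      by (simp add: inner_diff_left inner_commute)
    then show ?thesis by simp
  qed
  have d: "\<omega>1 c x \<bullet> X1 c x = 1" "\<omega>1 c x \<bullet> X2 c x = 0" "\<omega>1 c x \<bullet> X3 c x = 0"
      "\<omega>2 c x \<bullet> X1 c x = 0" "\<omega>2 c x \<bullet> X2 c x = 1" "\<omega>2 c x \<bullet> X3 c x = 0"
      "\<omega>3 c x \<bullet> X1 c x = 0" "\<omega>3 c x \<bullet> X2 c x = 0" "\<omega>3 c x \<bullet> X3 c x = 1"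
    using dual c unfolding dual_coframe_def by blast+
  show "\<omega>1 c x = G c x *v X1 c x" "\<omega>2 c x = G c x *v X2 c x" "\<omega>3 c x = G c x *v X3 c x"
    by (rule flat; simp add: d ortho ortho_sym)+
qed

lemma kernel_at:
  assumes "c \<in> A" "x \<in> cimg c"
  shows "\<xi> \<theta> c x = {v. pencil_form \<omega>1 \<omega>2 \<theta> c x \<bullet> v = 0}"
proof -
  have "\<forall>\<theta>. \<xi> \<theta> c x = kernel (pencil_form \<omega>1 \<omega>2 \<theta>) c x"
    using pencil assms unfolding indexed_pencil_def by blast
  then show ?thesis by (simp add: kernel_def)
qed

text \<open>A unit vector on the axis has no components on \<open>X1\<close> and \<open>X2\<close>.
  The contrapositive turns the transversality required in (ii) into an inequality for one inner
  product.\<close>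

lemma axis_bundle_unit:
  assumes c: "c \<in> A" "x \<in> cimg c" and v: "v \<in> axis_bundle \<xi> c x" "riem_inner (G c x) v v = 1"
  shows "(riem_inner (G c x) v (X3 c x))\<^sup>2 = 1"
proof -
  interpret orthonormal_triple "G c x" "X1 c x" "X2 c x" "X3 c x" by (rule frame_at[OF c])
  \<comment> \<open>The angles 0 and \<open>pi/2\<close> select \<open>\<omega>1\<close> and
    \<open>\<omega>2\<close> from the pencil.\<close>
  have "v \<in> \<xi> 0 c x" "v \<in> \<xi> (pi/2) c x" using v(1) by (auto simp: axis_bundle_def)
  then have "riem_inner (G c x) v (X1 c x) = 0" "riem_inner (G c x) v (X2 c x) = 0"
    by (simp_all add: kernel_at[OF c] pencil_form_def dual_at[OF c] riem_inner_def inner_commute)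
  then show ?thesis using norm_expand[of v] v(2) by simp
qed

text \<open>The axis component of the velocity is constant by (i), so a geodesic transverse at time
  0 stays transverse and (ii) applies. Dividing by the squared sine leaves the pitch, in every chart
  \<open>d\<close> that the curve meets.\<close>

lemma pitch_along_geodesic:
  assumes c: "c \<in> A" "x \<in> cimg c" and unit: "riem_inner (G c x) v v = 1"
    and transverse: "(riem_inner (G c x) v (X3 c x))\<^sup>2 \<noteq> 1"
  obtains e \<gamma> k where "e > 0" "coord c (\<gamma> 0) = x" "\<And>t. t \<in> {-e<..<e} \<Longrightarrow> \<gamma> t \<in> cdom c"
    "((\<lambda>s. coord c (\<gamma> s)) has_vector_derivative v) (at 0)"
    "\<And>t d. t \<in> {-e<..<e} \<Longrightarrow> d \<in> A \<Longrightarrow> \<gamma> t \<in> cdom d \<Longrightarrow> pitch d (coord d (\<gamma> t)) = k"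
proof -
  obtain e \<gamma> where e: "e > 0" and \<gamma>: "geodesic A G {-e<..<e} \<gamma>" and x: "coord c (\<gamma> 0) = x"
    and v: "velocity \<gamma> c 0 = v" and dom: "\<And>t. t \<in> {-e<..<e} \<Longrightarrow> \<gamma> t \<in> cdom c"
    by (rule geodesic_from[OF c unit c(1)]) (rule that)
  have 0: "0 \<in> {-e<..<e}" using e by simp
  let ?p = "\<lambda>d t. riem_inner (G d (coord d (\<gamma> t))) (velocity \<gamma> d t) (X3 d (coord d (\<gamma> t)))"
  obtain k where k: "has_constant_value A {-e<..<e} \<gamma> (angle_with G \<gamma> X3) k"
    using constant_angle[OF \<gamma>] by blast
  have pk: "?p d t = cos k" if "d \<in> A" "t \<in> {-e<..<e}" "\<gamma> t \<in> cdom d" for d t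
    using angle_with_frame(2)[OF \<gamma> that(1,2,3)] k that by (simp add: has_constant_value_def)
  have p: "?p d t = riem_inner (G c x) v (X3 c x)" if "d \<in> A" "t \<in> {-e<..<e}" "\<gamma> t \<in> cdom d" for d t
    using pk[OF that] pk[OF c(1) 0 dom[OF 0]] by (simp add: x v)
  have "\<forall>t\<in>{-e<..<e}. \<forall>d\<in>A. \<gamma> t \<in> cdom d \<longrightarrow> velocity \<gamma> d t \<notin> axis_bundle \<xi> d (coord d (\<gamma> t))"
  proof (intro ballI impI notI)
    fix t d assume td: "t \<in> {-e<..<e}" "d \<in> A" "\<gamma> t \<in> cdom d"
      and v: "velocity \<gamma> d t \<in> axis_bundle \<xi> d (coord d (\<gamma> t))"
    have "coord d (\<gamma> t) \<in> cimg d" using td(3) by simp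
    from axis_bundle_unit[OF td(2) this v geodesic_curve(2)[OF \<gamma> atlas td(2,1,3)]]
    show False using p[OF td(2,1,3)] transverse by simp
  qed
  then obtain l where l: "has_constant_value A {-e<..<e} \<gamma> (rotation_speed G \<gamma> (along \<gamma> X3) (velocity \<gamma>)) l"
    using constant_rotation[OF \<gamma>] by blast
  have pitch_l: "pitch d (coord d (\<gamma> t)) = l / - (1 - (riem_inner (G c x) v (X3 c x))\<^sup>2)"
    if "t \<in> {-e<..<e}" "d \<in> A" "\<gamma> t \<in> cdom d" for t d
  proof -
    have "- pitch d (coord d (\<gamma> t)) * (1 - (riem_inner (G c x) v (X3 c x))\<^sup>2) = l"
      using axis_rotation_speed[OF \<gamma> that(2,1,3)] l that p[OF that(2,1,3)] by (simp add: has_constant_value_def)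
    then show ?thesis using transverse by (simp add: field_simps)
  qed
  show thesis
  proof (rule that)
    show "((\<lambda>s. coord c (\<gamma> s)) has_vector_derivative v) (at 0)"
      using geodesic_curve(1)[OF \<gamma> atlas c(1) 0 dom[OF 0]] by (simp add: v)
  qed (fact e x dom pitch_l)+
qed

text \<open>The geodesic through \<open>p\<close> with initial velocity \<open>X1\<close> is
  transverse, and its constant is the pitch in both charts at time 0.\<close>

lemma pitch_chart_independent:
  assumes c: "c \<in> A" "p \<in> cdom c" and d: "d \<in> A" "p \<in> cdom d"
  shows "pitch c (coord c p) = pitch d (coord d p)"
proof -
  have x: "coord c p \<in> cimg c" using c by simp
  interpret orthonormal_triple "G c (coord c p)" "X1 c (coord c p)" "X2 c (coord c p)" "X3 c (coord c p)"
    by (rule frame_at[OF c(1) x])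
  have transverse: "(riem_inner (G c (coord c p)) (X1 c (coord c p)) (X3 c (coord c p)))\<^sup>2 \<noteq> 1"
    by (simp add: ortho)
  obtain e \<gamma> k where e: "e > 0" and \<gamma>: "coord c (\<gamma> 0) = coord c p"
    and dom: "\<And>t. t \<in> {-e<..<e} \<Longrightarrow> \<gamma> t \<in> cdom c"
    and "((\<lambda>s. coord c (\<gamma> s)) has_vector_derivative X1 c (coord c p)) (at 0)"
    and k: "\<And>t d. t \<in> {-e<..<e} \<Longrightarrow> d \<in> A \<Longrightarrow> \<gamma> t \<in> cdom d \<Longrightarrow> pitch d (coord d (\<gamma> t)) = k"
    by (rule pitch_along_geodesic[OF c(1) x ortho(1) transverse]) (rule that)
  have 0: "0 \<in> {-e<..<e}" using e by simp
  have "\<gamma> 0 = p"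
    using oriented_atlas_chart(5)[OF atlas c(1)] \<gamma> c(2) dom[OF 0] by metis
  then show ?thesis using k[OF 0 c(1)] k[OF 0 d(1)] c(2) d(2) by simp
qed

text \<open>The two skew entries in \<open>ext_deriv_flat\<close> both contribute
  \<open>twist\<close>, whence the factor 2. The right-hand side involves only
  \<open>\<omega>3\<close> and the frame, which makes smoothness of \<open>twist\<close>
  immediate.\<close>

lemma twist_ext_deriv:
  assumes c: "c \<in> A" "x \<in> cimg c"
  shows "twist c x = ext_deriv (\<omega>3 c) x (X1 c x) (X2 c x) / 2"
proof -
  interpret orthonormal_triple "G c x" "X1 c x" "X2 c x" "X3 c x" by (rule frame_at[OF c])
  show ?thesis
    using ext_deriv_flat[where X=X3 and \<omega>=\<omega>3 and c=c, OF atlas metric c smooth_frame(3)[OF c(1)] dual_at(3)[OF c(1)]]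
      nabla_axis[OF c] by (simp add: ortho)
qed

lemma smooth_twist:
  assumes c: "c \<in> A"
  shows "smooth_on (cimg c) (twist c)"
proof -
  note S = open_cimg[OF c]
  have \<omega>: "smooth_on (cimg c) (\<omega>3 c)" using dual c by (simp add: dual_coframe_def one_form_def)
  have D: "smooth_on (cimg c) (\<lambda>x. frechet_derivative (\<omega>3 c) (at x) (X c x))" if "smooth_on (cimg c) (X c)" for X
    by (rule smooth_derivative_along[OF S \<omega> smooth_linear[OF bounded_linear_ident] that]) simp
  have "smooth_on (cimg c) (\<lambda>x. (1/2) *\<^sub>R (frechet_derivative (\<omega>3 c) (at x) (X1 c x) \<bullet> X2 c x +
      (-1) *\<^sub>R (frechet_derivative (\<omega>3 c) (at x) (X2 c x) \<bullet> X1 c x)))"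
    by (intro smooth_compose_linear[OF S bounded_linear_scaleR_right] smooth_add[OF S] smooth_inner[OF S]
        D smooth_frame c)
  then show ?thesis
    by (rule smooth_cong[OF S]) (simp add: twist_ext_deriv[OF c] ext_deriv_def)
qed

text \<open>By \<open>orient_sgn\<close> it suffices to follow the sign of the determinant of the
  frame in coordinates, which is continuous and has no zero.\<close>

lemma orientation_locally_constant:
  assumes c: "c \<in> A" and B: "connected B" "B \<subseteq> cimg c" "x \<in> B" "y \<in> B"
  shows "orientation c x = orientation c y"
proof -
  let ?D = "\<lambda>z. det (vector [X1 c z, X2 c z, X3 c z] :: real^3^3)"
  have cont: "continuous_on B (\<lambda>z. W z $ i)" if "smooth_on (cimg c) W" for W :: "real^3 \<Rightarrow> real^3" and i :: 3
    by (intro continuous_on_component continuous_on_subset[OF smooth_continuous[OF that] B(2)])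
  have "continuous_on B ?D"
    unfolding det_3 vector_3 by (intro continuous_on_add continuous_on_diff continuous_on_mult cont smooth_frame c)
  from connected_continuous_image[OF this B(1)] have img: "connected (?D ` B)" .
  have nz: "0 \<notin> ?D ` B"
  proof
    assume "0 \<in> ?D ` B"
    then obtain z where z: "0 = ?D z" "z \<in> B" by (rule imageE)
    interpret orthonormal_triple "G c z" "X1 c z" "X2 c z" "X3 c z"
      using B(2) z(2) by (intro frame_at c) auto
    have "orient = 0" unfolding orient_def z(1)[symmetric] by simp
    then show False using orient_square by simp
  qed
  have sgn_eq: "sgn a = sgn b" if "connected I" "0 \<notin> I" "a \<in> I" "b \<in> I" for a b :: real and I
  proof -
    have "\<not> (a \<le> 0 \<and> 0 \<le> b)" "\<not> (b \<le> 0 \<and> 0 \<le> a)"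
      using connectedD_interval[OF that(1,3,4), of 0] connectedD_interval[OF that(1,4,3), of 0] that(2) by auto
    then show ?thesis by (auto simp: sgn_real_def)
  qed
  have "sgn (?D x) = sgn (?D y)"
    by (rule sgn_eq[OF img nz imageI[OF B(3)] imageI[OF B(4)]])
  moreover have "orientation c z = sgn (?D z)" if "z \<in> B" for z
  proof -
    interpret orthonormal_triple "G c z" "X1 c z" "X2 c z" "X3 c z"
      using B(2) that by (intro frame_at c) auto
    show ?thesis unfolding orientation_def by (rule orient_sgn)
  qed
  ultimately show ?thesis using B(3,4) by simp
qed

text \<open>Transverse directions span, and geodesics in these directions force the derivative of
  \<open>twist\<close> to vanish. The argument differentiates \<open>twist\<close>, known to be
  smooth, and passes to \<open>pitch\<close> through \<open>orientation\<close>, which is constant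
  on the ball.\<close>

lemma pitch_constant_on_ball:
  assumes c: "c \<in> A" and B: "ball x r \<subseteq> cimg c" "y \<in> ball x r"
  shows "pitch c y = pitch c x"
proof -
  have D0: "frechet_derivative (twist c) (at z) u = 0" if z: "z \<in> ball x r" for z u
  proof -
    have zc: "z \<in> cimg c" using B(1) z by blast
    interpret orthonormal_triple "G c z" "X1 c z" "X2 c z" "X3 c z" by (rule frame_at[OF c zc])
    have D: "(twist c has_derivative frechet_derivative (twist c) (at z)) (at z)"
      by (rule smooth_has_derivative[OF smooth_twist[OF c] zc])
    have lin: "linear (frechet_derivative (twist c) (at z))" by (rule has_derivative_linear[OF D])
    have transverse_zero: "frechet_derivative (twist c) (at z) v = 0"
      if unit: "riem_inner (G c z) v v = 1" and transverse: "(riem_inner (G c z) v (X3 c z))\<^sup>2 \<noteq> 1" for v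
    proof -
      obtain e \<gamma> k where e: "e > 0" and \<gamma>0: "coord c (\<gamma> 0) = z"
        and dom: "\<And>t. t \<in> {-e<..<e} \<Longrightarrow> \<gamma> t \<in> cdom c"
        and \<gamma>: "((\<lambda>s. coord c (\<gamma> s)) has_vector_derivative v) (at 0)"
        and k: "\<And>t d. t \<in> {-e<..<e} \<Longrightarrow> d \<in> A \<Longrightarrow> \<gamma> t \<in> cdom d \<Longrightarrow> pitch d (coord d (\<gamma> t)) = k"
        by (rule pitch_along_geodesic[OF c zc unit transverse]) (rule that)
      have twist_k: "twist c (coord c (\<gamma> s)) = orientation c z * k"
        if s: "s \<in> {-e<..<e}" "coord c (\<gamma> s) \<in> ball x r" for s
      proof -
        have "orientation c (coord c (\<gamma> s)) = orientation c z"
          by (rule orientation_locally_constant[OF c connected_ball B(1) s(2) z])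
        then have "k = orientation c z * twist c (coord c (\<gamma> s))"
          using k[OF s(1) c dom[OF s(1)]] by (simp add: pitch_def)
        then show ?thesis using orientation_square[OF c zc] by (simp add: mult.assoc[symmetric])
      qed
      have "isCont (\<lambda>s. coord c (\<gamma> s)) 0" by (rule has_vector_derivative_continuous[OF \<gamma>])
      then have "((\<lambda>s. coord c (\<gamma> s)) \<longlongrightarrow> coord c (\<gamma> 0)) (nhds 0)"
        unfolding isCont_def by (rule iffD1[OF tendsto_at_iff_tendsto_nhds])
      then have "((\<lambda>s. coord c (\<gamma> s)) \<longlongrightarrow> z) (nhds 0)" unfolding \<gamma>0 .
      then have "\<forall>\<^sub>F s in nhds 0. coord c (\<gamma> s) \<in> ball x r"
        using open_ball z by (rule topological_tendstoD)
      moreover have "\<forall>\<^sub>F s in nhds 0. s \<in> {-e<..<e}"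
        using e by (intro eventually_nhds_in_open) auto
      ultimately have ev: "\<forall>\<^sub>F s in nhds 0. twist c (coord c (\<gamma> s)) = orientation c z * k"
        by eventually_elim (rule twist_k)
      have "((\<lambda>s. twist c (coord c (\<gamma> s))) has_real_derivative 0) (at 0)"
        by (rule iffD2[OF DERIV_cong_ev[OF refl ev refl] DERIV_const])
      moreover have "((\<lambda>s. twist c (coord c (\<gamma> s))) has_real_derivative frechet_derivative (twist c) (at z) v) (at 0)"
      proof -
        have D': "(twist c has_derivative frechet_derivative (twist c) (at z)) (at (coord c (\<gamma> 0)))"
          unfolding \<gamma>0 by (rule D)
        have "((\<lambda>s. twist c (coord c (\<gamma> s))) has_derivative (\<lambda>h. frechet_derivative (twist c) (at z) (h *\<^sub>R v))) (at 0)"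
          by (rule has_derivative_compose[OF \<gamma>[unfolded has_vector_derivative_def] D'])
        moreover have "(\<lambda>h. frechet_derivative (twist c) (at z) (h *\<^sub>R v)) = (*) (frechet_derivative (twist c) (at z) v)"
          by (simp add: linear_scale[OF lin] fun_eq_iff)
        ultimately show ?thesis unfolding has_field_derivative_def by simp
      qed
      ultimately show ?thesis by (rule DERIV_unique[symmetric])
    qed
    have "frechet_derivative (twist c) (at z) (X1 c z) = 0" "frechet_derivative (twist c) (at z) (X2 c z) = 0"
      by (simp_all add: transverse_zero ortho)
    \<comment> \<open>A transverse unit vector, since 9/25 + 16/25 = 1, with a component on the
      axis: together with the vanishing on \<open>X1\<close> it gives the vanishing on
      \<open>X3\<close>, a direction that (ii) does not cover.\<close>
    moreover have "frechet_derivative (twist c) (at z) ((3/5) *\<^sub>R X1 c z + (4/5) *\<^sub>R X3 c z) = 0"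
      by (rule transverse_zero) (simp_all add: riem_inner_linear ortho ortho_sym power2_eq_square)
    ultimately show ?thesis
      by (simp add: linear_expand[OF lin, of u] linear_add[OF lin] linear_scale[OF lin])
  qed
  have xB: "x \<in> ball x r" using B(2) le_less_trans[OF zero_le_dist, of x y r] by simp
  have "twist c y = twist c x"
  proof (rule has_derivative_zero_unique[OF convex_ball _ B(2) xB])
    fix z assume z: "z \<in> ball x r"
    then have "(twist c has_derivative frechet_derivative (twist c) (at z)) (at z)"
      using B(1) by (intro smooth_has_derivative[OF smooth_twist[OF c]]) auto
    moreover have "frechet_derivative (twist c) (at z) = (\<lambda>u. 0)" using D0[OF z] by auto
    ultimately have "(twist c has_derivative (\<lambda>u. 0)) (at z)" by simp
    then show "(twist c has_derivative (\<lambda>u. 0)) (at z within ball x r)"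
      by (rule has_derivative_at_withinI)
  qed
  moreover have "orientation c y = orientation c x"
    by (rule orientation_locally_constant[OF c connected_ball B(1,2) xB])
  ultimately show ?thesis by (simp add: pitch_def)
qed

text \<open>Choosing a chart around each point makes the pitch a function on the manifold. Chart
  independence lets it be computed near a point in one fixed chart, so it is locally constant, and
  connectedness finishes.\<close>

lemma pitch_constant:
  assumes c: "c \<in> A" "x \<in> cimg c" and d: "d \<in> A" "y \<in> cimg d"
  shows "pitch c x = pitch d y"
proof -
  have "\<exists>c\<in>A. p \<in> cdom c" for p
    using atlas unfolding oriented_atlas_def by blast
  then obtain ch where ch: "\<And>p. ch p \<in> A" "\<And>p. p \<in> cdom (ch p)" by metis
  define f where "f p = pitch (ch p) (coord (ch p) p)" for p
  have f: "f p = pitch c (coord c p)" if "c \<in> A" "p \<in> cdom c" for c p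
    unfolding f_def by (rule pitch_chart_independent[OF ch that])
  have local: "\<forall>\<^sub>F q in at p within UNIV. f p = f q" for p
  proof -
    let ?c = "ch p"
    obtain r where r: "r > 0" "ball (coord ?c p) r \<subseteq> cimg ?c"
      by (rule openE[OF open_cimg[OF ch(1)] imageI[OF ch(2)]]) (rule that)
    define V where "V = cdom ?c \<inter> coord ?c -` ball (coord ?c p) r"
    have "open V"
      unfolding V_def
      by (rule continuous_open_preimage[OF oriented_atlas_chart(3,1)[OF atlas ch(1)] open_ball])
    moreover have "p \<in> V" using ch(2) r(1) by (simp add: V_def)
    moreover have "f p = f q" if "q \<in> V" for q
    proof -
      have q: "q \<in> cdom ?c" "coord ?c q \<in> ball (coord ?c p) r" using that by (auto simp: V_def)
      show ?thesis
        by (rule trans[OF f[OF ch] trans[OF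
              pitch_constant_on_ball[OF ch(1) r(2) q(2), symmetric] f[OF ch(1) q(1), symmetric]]])
    qed
    ultimately show ?thesis unfolding eventually_at_topological by blast
  qed
  obtain p where p: "p \<in> cdom c" "x = coord c p" using c(2) by blast
  obtain q where q: "q \<in> cdom d" "y = coord d q" using d(2) by blast
  have "f p = f q"
    by (rule connected_local_const[OF connected UNIV_I UNIV_I]) (use local in blast)
  then show ?thesis using f[OF c(1) p(1)] f[OF d(1) q(1)] p(2) q(2) by simp
qed

text \<open>\<open>d\<omega>1 = \<delta> \<omega>2 \<and> \<omega>3\<close> and \<open>d\<omega>2 = - \<delta> \<omega>1 \<and> \<omega>3\<close>. The factor \<open>orientation\<close> enters because \<open>pitch\<close>
  and \<open>spin\<close> are defined through rotation speeds, hence through the cross product.\<close>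

lemma structure_equations:
  assumes c: "c \<in> A" "x \<in> cimg c"
  defines "\<delta> \<equiv> orientation c x * (pitch c x - spin c x (X3 c x))"
    and "p \<equiv> \<lambda>u X. riem_inner (G c x) u (X c x)"
  shows "ext_deriv (\<omega>1 c) x u v = \<delta> * (p u X2 * p v X3 - p u X3 * p v X2)"
    "ext_deriv (\<omega>2 c) x u v = - \<delta> * (p u X1 * p v X3 - p u X3 * p v X1)"
proof -
  interpret orthonormal_triple "G c x" "X1 c x" "X2 c x" "X3 c x" by (rule frame_at[OF c])
  let ?ip = "riem_inner (G c x)"
  \<comment> \<open>\<open>K\<close> is \<kappa> and \<open>twist\<close> is \<tau>; the signs
    inside \<open>pitch\<close> and \<open>spin\<close> cancel against the outer factor
    \<open>orientation\<close>.\<close>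
  define K where "K = orientation c x * spin c x (X3 c x)"
  have o: "orientation c x * (orientation c x * r) = r" for r
    using orientation_square[OF c] by (simp add: mult.assoc[symmetric])
  have \<delta>: "\<delta> = twist c x - K" by (simp add: \<delta>_def K_def pitch_def right_diff_distrib o)
  have "orientation c x * spin c x u = K * p u X3" for u
    by (subst spin_axis[OF c]) (simp add: K_def p_def)
  then have n12: "?ip (nabla G X1 c x u) (X2 c x) = K * p u X3" for u
    by (simp add: spin_def o)
  \<comment> \<open>With skew-symmetry, \<open>twist\<close> and \<open>K\<close> determine every
    entry of the connection matrix of the frame.\<close>
  have n11: "?ip (nabla G X1 c x u) (X1 c x) = 0" "?ip (nabla G X2 c x u) (X2 c x) = 0" for u
    using frame_nabla_skew[OF c, of X1 X1 u] frame_nabla_skew[OF c, of X2 X2 u] by auto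
  have n13: "?ip (nabla G X1 c x u) (X3 c x) = twist c x * p u X2"
    "?ip (nabla G X2 c x u) (X3 c x) = - twist c x * p u X1"
    "?ip (nabla G X2 c x u) (X1 c x) = - K * p u X3" for u
    using frame_nabla_skew[OF c, of X1 X3 u] frame_nabla_skew[OF c, of X2 X3 u]
      frame_nabla_skew[OF c, of X2 X1 u] nabla_axis[OF c, of u] n12[of u] by (simp_all add: p_def)
  have n1: "?ip (nabla G X1 c x u) v = K * p u X3 * p v X2 + twist c x * p u X2 * p v X3"
    and n2: "?ip (nabla G X2 c x u) v = - K * p u X3 * p v X1 - twist c x * p u X1 * p v X3" for u v
    by (simp_all add: inner_expand[of "nabla G _ c x u" v] n11 n12 n13 p_def)
  show "ext_deriv (\<omega>1 c) x u v = \<delta> * (p u X2 * p v X3 - p u X3 * p v X2)"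
    by (simp add: ext_deriv_flat[where X=X1 and \<omega>=\<omega>1 and c=c, OF atlas metric c smooth_frame(1)[OF c(1)]
          dual_at(1)[OF c(1)]] n1 \<delta> algebra_simps)
  show "ext_deriv (\<omega>2 c) x u v = - \<delta> * (p u X1 * p v X3 - p u X3 * p v X1)"
    by (simp add: ext_deriv_flat[where X=X2 and \<omega>=\<omega>2 and c=c, OF atlas metric c smooth_frame(2)[OF c(1)]
          dual_at(2)[OF c(1)]] n2 \<delta> algebra_simps)
qed

section \<open>Integrable and contact pencils\<close>

lemma smooth_dual:
  assumes "c \<in> A"
  shows "smooth_on (cimg c) (\<omega>1 c)" "smooth_on (cimg c) (\<omega>2 c)"
  using dual assms by (simp_all add: dual_coframe_def one_form_def)

lemma smooth_pencil_form:
  assumes "c \<in> A" shows "smooth_on (cimg c) (pencil_form \<omega>1 \<omega>2 \<theta> c)"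
proof -
  have "smooth_on (cimg c) (\<lambda>x. cos \<theta> *\<^sub>R \<omega>1 c x + sin \<theta> *\<^sub>R \<omega>2 c x)"
    by (intro smooth_add smooth_compose_linear[OF _ bounded_linear_scaleR_right] open_cimg smooth_dual assms)
  then show ?thesis by (simp add: pencil_form_def[abs_def])
qed

lemma ext_deriv_pencil_form:
  assumes c: "c \<in> A" "x \<in> cimg c"
  shows "ext_deriv (pencil_form \<omega>1 \<omega>2 \<theta> c) x u v =
    cos \<theta> * ext_deriv (\<omega>1 c) x u v + sin \<theta> * ext_deriv (\<omega>2 c) x u v"
proof -
  have "((\<lambda>x. cos \<theta> *\<^sub>R \<omega>1 c x + sin \<theta> *\<^sub>R \<omega>2 c x) has_derivative
    (\<lambda>u. cos \<theta> *\<^sub>R frechet_derivative (\<omega>1 c) (at x) u + sin \<theta> *\<^sub>R frechet_derivative (\<omega>2 c) (at x) u)) (at x)"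
    by (intro has_derivative_add has_derivative_scaleR_right smooth_has_derivative[OF smooth_dual(1)]
        smooth_has_derivative[OF smooth_dual(2)] c)
  from fun_cong[OF frechet_derivative_at[OF this], symmetric] show ?thesis
    by (simp add: ext_deriv_def pencil_form_def[abs_def] inner_add_left algebra_simps)
qed

lemma integrable_case:
  assumes eq: "\<And>c x. c \<in> A \<Longrightarrow> x \<in> cimg c \<Longrightarrow> pitch c x = spin c x (X3 c x)"
  shows "integrable_bundle A (\<xi> \<theta>)"
  unfolding integrable_bundle_def
proof (intro ballI)
  fix c x assume c: "c \<in> A" "x \<in> cimg c"
  let ?\<alpha> = "pencil_form \<omega>1 \<omega>2 \<theta> c"
  obtain r where r: "r > 0" "ball x r \<subseteq> cimg c"
    by (rule openE[OF open_cimg[OF c(1)] c(2)]) (rule that)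
  have \<alpha>: "smooth_on (ball x r) ?\<alpha>" by (rule smooth_subset[OF smooth_pencil_form[OF c(1)] r(2)])
  have closed: "frechet_derivative ?\<alpha> (at y) u \<bullet> v = frechet_derivative ?\<alpha> (at y) v \<bullet> u"
    if "y \<in> ball x r" for y u v
  proof -
    have y: "y \<in> cimg c" using that r(2) by blast
    have "ext_deriv ?\<alpha> y u v = 0"
      by (simp add: ext_deriv_pencil_form[OF c(1) y] structure_equations[OF c(1) y] eq[OF c(1) y])
    then show ?thesis by (simp add: ext_deriv_def)
  qed
  obtain f where f: "\<And>y. y \<in> ball x r \<Longrightarrow> (f has_derivative (\<lambda>v. ?\<alpha> y \<bullet> v)) (at y)"
    by (rule poincare_lemma_ball[OF \<alpha> closed]) (assumption, rule that)
  have df: "frechet_derivative f (at y) = (\<lambda>v. ?\<alpha> y \<bullet> v)" if "y \<in> ball x r" for y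
    using frechet_derivative_at[OF f[OF that]] by simp
  have "smooth_on (ball x r) f"
    by (rule smoothI[OF open_ball f], assumption) (intro smooth_inner open_ball \<alpha> smooth_const)
  moreover have "(\<exists>v. frechet_derivative f (at y) v \<noteq> 0) \<and> \<xi> \<theta> c y = {v. frechet_derivative f (at y) v = 0}"
    if y: "y \<in> ball x r" for y
  proof -
    have yc: "y \<in> cimg c" using y r(2) by blast
    have "\<forall>a b. a *\<^sub>R \<omega>1 c y + b *\<^sub>R \<omega>2 c y = 0 \<longrightarrow> a = 0 \<and> b = 0"
      using pencil c(1) yc unfolding indexed_pencil_def by blast
    \<comment> \<open>\<open>cos\<close> and \<open>sin\<close> have no common zero, so independence
      of \<open>\<omega>1\<close> and \<open>\<omega>2\<close> keeps the pencil form
      nonzero.\<close>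
    then have "?\<alpha> y \<noteq> 0" using sin_zero_abs_cos_one[of \<theta>] unfolding pencil_form_def by fastforce
    then have "?\<alpha> y \<bullet> ?\<alpha> y \<noteq> 0" by simp
    then show ?thesis unfolding df[OF y] kernel_at[OF c(1) yc] by blast
  qed
  ultimately show "\<exists>V (f :: real^3 \<Rightarrow> real). open V \<and> x \<in> V \<and> V \<subseteq> cimg c \<and> smooth_on V f \<and>
     (\<forall>y\<in>V. (\<exists>v. frechet_derivative f (at y) v \<noteq> 0) \<and> \<xi> \<theta> c y = {v. frechet_derivative f (at y) v = 0})"
    using r by (intro exI[of _ "ball x r"] exI[of _ f]) simp
qed

lemma contact_case:
  assumes neq: "\<And>c x. c \<in> A \<Longrightarrow> x \<in> cimg c \<Longrightarrow> pitch c x \<noteq> spin c x (X3 c x)"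
  shows "contact_structure A (\<xi> \<theta>)"
  unfolding contact_structure_def
proof (intro ballI)
  fix c x assume c: "c \<in> A" "x \<in> cimg c"
  let ?\<alpha> = "pencil_form \<omega>1 \<omega>2 \<theta> c"
  have "\<exists>u v w. wedge_ext_deriv ?\<alpha> y u v w \<noteq> 0" if y: "y \<in> cimg c" for y
  proof -
    interpret orthonormal_triple "G c y" "X1 c y" "X2 c y" "X3 c y" by (rule frame_at[OF c(1) y])
    let ?\<delta> = "orientation c y * (pitch c y - spin c y (X3 c y))"
    have \<alpha>: "?\<alpha> y \<bullet> X1 c y = cos \<theta>" "?\<alpha> y \<bullet> X2 c y = sin \<theta>" "?\<alpha> y \<bullet> X3 c y = 0"
      by (simp_all add: pencil_form_def dual_at[OF c(1) y] inner_add_left inner_commute[of "G c y *v _"]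
          riem_inner_def[symmetric] ortho ortho_sym)
    \<comment> \<open>Only the derivative of \<open>\<omega>1\<close> on \<open>X2\<close>,
      \<open>X3\<close> and that of \<open>\<omega>2\<close> on \<open>X3\<close>, \<open>X1\<close>
      contribute, both equal to \<open>?\<delta>\<close>; hence the value does not depend on
      \<theta>.\<close>
    have "wedge_ext_deriv ?\<alpha> y (X1 c y) (X2 c y) (X3 c y) = ?\<delta> * (cos \<theta> * cos \<theta> + sin \<theta> * sin \<theta>)"
      unfolding wedge_ext_deriv_def \<alpha> ext_deriv_pencil_form[OF c(1) y] structure_equations[OF c(1) y]
      by (simp add: ortho ortho_sym algebra_simps del: sin_cos_squared_add3)
    also have "\<dots> = ?\<delta>" by simp
    finally have "wedge_ext_deriv ?\<alpha> y (X1 c y) (X2 c y) (X3 c y) \<noteq> 0"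
      using neq[OF c(1) y] orientation_square[OF c(1) y] by auto
    then show ?thesis by blast
  qed
  then show "\<exists>V \<alpha>. open V \<and> x \<in> V \<and> V \<subseteq> cimg c \<and> smooth_on V \<alpha> \<and>
     (\<forall>y\<in>V. \<xi> \<theta> c y = {v. \<alpha> y \<bullet> v = 0} \<and> (\<exists>u v w. wedge_ext_deriv \<alpha> y u v w \<noteq> 0))"
    using c open_cimg[OF c(1)] smooth_pencil_form[OF c(1)] kernel_at[OF c(1)]
    by (intro exI[of _ "cimg c"] exI[of _ ?\<alpha>]) simp
qed

text \<open>Both sides of the equation \<open>pitch c x = spin c x (X3 c x)\<close> are constant
  over all points and charts, so its validity at a single point decides for the whole
  pencil.\<close>

lemma integrable_or_contact:
  "(\<forall>\<theta>. integrable_bundle A (\<xi> \<theta>)) \<or> (\<forall>\<theta>. contact_structure A (\<xi> \<theta>))"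
proof (cases "\<exists>c\<in>A. \<exists>x\<in>cimg c. pitch c x = spin c x (X3 c x)")
  case True
  then obtain c x where c: "c \<in> A" "x \<in> cimg c" "pitch c x = spin c x (X3 c x)" by blast
  have "pitch d y = spin d y (X3 d y)" if "d \<in> A" "y \<in> cimg d" for d y
    using pitch_constant[OF c(1,2) that] spin_axis_constant[OF c(1,2) that] c(3) by simp
  then show ?thesis using integrable_case by blast
next
  case False
  then show ?thesis using contact_case by blast
qed

end

theorem corollary19:
  fixes A :: "('m::{t2_space, second_countable_topology}) chart set"
    and G :: "'m metric_tensor"
    and \<xi> :: "real \<Rightarrow> 'm plane_bundle"
  assumes "oriented_riemannian_3manifold A G"
    and "is_top A G \<xi>"
  shows "(\<forall>\<theta>. integrable_bundle A (\<xi> \<theta>)) \<or> (\<forall>\<theta>. contact_structure A (\<xi> \<theta>))"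
proof -
  obtain X1 X2 X3 \<omega>1 \<omega>2 \<omega>3 where top: "orthonormal_frame A G X1 X2 X3"
    "dual_coframe A X1 X2 X3 \<omega>1 \<omega>2 \<omega>3" "indexed_pencil A \<omega>1 \<omega>2 \<xi>"
    "\<forall>I \<gamma>. geodesic A G I \<gamma> \<longrightarrow> (\<exists>k. has_constant_value A I \<gamma> (angle_with G \<gamma> X3) k)"
    "\<forall>I \<gamma>. geodesic A G I \<gamma> \<and>
        (\<forall>t\<in>I. \<forall>c\<in>A. \<gamma> t \<in> cdom c \<longrightarrow> velocity \<gamma> c t \<notin> axis_bundle \<xi> c (coord c (\<gamma> t))) \<longrightarrow>
        (\<exists>k. has_constant_value A I \<gamma> (rotation_speed G \<gamma> (along \<gamma> X3) (velocity \<gamma>)) k)"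
    "\<forall>I \<gamma> J \<delta> a. geodesic A G I \<gamma> \<and> geodesic A G J \<delta> \<and>
        has_constant_value A I \<gamma> (angle_with G \<gamma> X3) a \<and>
        has_constant_value A J \<delta> (angle_with G \<delta> X3) a \<longrightarrow>
        (\<exists>k. has_constant_value A I \<gamma> (rotation_speed G \<gamma> (along \<gamma> X1) (along \<gamma> X3)) k \<and>
             has_constant_value A J \<delta> (rotation_speed G \<delta> (along \<delta> X1) (along \<delta> X3)) k)"
    using assms(2) unfolding is_top_def by (elim exE conjE) (rule that)
  have "top_frame A G X1 X2 X3 \<omega>1 \<omega>2 \<omega>3 \<xi>"
  proof
  qed (use assms(1) top in blast)+
  then show ?thesis by (rule top_frame.integrable_or_contact)
qed

end
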